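(* If $\psi\colon\mathbb{F}_{q^2}\to\overline{\mathbb{Q}}_\ell^\times$ is an additive character of conductor $q^2$, then there exists a bijection between $\mathcal A_\psi$ and $\mathcal G_\psi$. Furthermore, every representation in $\mathcal G_\psi$ has dimension $q^{h-1}$.
   Context: Let $p$ be a prime, $q$ a power of $p$, $\ell\ne p$ a prime, and $h\ge2$ an integer. For a commutative $\mathbb{F}_q$-algebra $A$, let $U_h^{2,q}(A)$ be the set of formal expressions $1+\sum_{i=1}^{2(h-1)}a_i\tau^i$ ($a_i\in A$) with multiplication obtained by extending $(a\tau^i)(b\tau^j)=ab^{q^i}\tau^{i+j}$ bi-additively, where $\tau^0=1$ and $\tau^k=0$ for $k>2(h-1)$. Put $\mathcal U=U_h^{2,q}(\mathbb{F}_{q^2})$, $H=\{1+\sum a_i\tau^i\in\mathcal U: a_i=0\text{ for odd } i\}$ and $H_{2(h-1)}=\{1+a\tau^{2(h-1)}: a\in\mathbb{F}_{q^2}\}$. Let $L=\mathbb{F}_{q^2}((\pi))$ and $U_L^i=1+\pi^i\mathbb{F}_{q^2}[[\pi]]$. An additive character $\psi$ of $\mathbb{F}_{q^2}$ has conductor $q^2$ if there exists $x$ with $\psi(x^q)\ne\psi(x)$. $\mathcal A_\psi$ is the set of characters $\chi\colon U_L^1/U_L^h\to\overline{\mathbb{Q}}_\ell^\times$ with $\chi(1+a\pi^{h-1})=\psi(a)$ for all $a\in\mathbb{F}_{q^2}$. $\mathcal G_\psi$ is the set of (isomorphism classes of) irreducible representations of $\mathcal U$ in which each $1+a\tau^{2(h-1)}\in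 H_{2(h-1)}$ acts by the scalar $\psi(a)$. *)

theory Defs
  imports "HOL-Computational_Algebra.Polynomial" "HOL-Library.FuncSet" "Jordan_Normal_Form.Matrix"
begin

text \<open>An element 1 + sum_{i=1}^{N} a_i tau^i (resp. 1 + sum a_i pi^i) is encoded by the
  coefficient function a :: nat => 'a, which must vanish at 0 and above N.\<close>

definition trunc_carrier :: "nat \<Rightarrow> (nat \<Rightarrow> 'a::zero) set" where
  "trunc_carrier N = {a. \<forall>i. (i = 0 \<or> N < i) \<longrightarrow> a i = 0}"

text \<open>Multiplication in U_h^{2,q}: (a tau^i)(b tau^j) = a b^(q^i) tau^(i+j), truncated above N.\<close>
definition U_mul :: "nat \<Rightarrow> nat \<Rightarrow> (nat \<Rightarrow> 'a::field) \<Rightarrow> (nat \<Rightarrow> 'a) \<Rightarrow> (nat \<Rightarrow> 'a)" where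
  "U_mul q N a b = (\<lambda>k. if 1 \<le> k \<and> k \<le> N
      then a k + b k + (\<Sum>i\<in>{1..<k}. a i * b (k - i) ^ (q ^ i)) else 0)"

text \<open>Multiplication in U_L^1 / U_L^h (truncated power series, coefficients of pi^1..pi^(h-1)).\<close>
definition L_mul :: "nat \<Rightarrow> (nat \<Rightarrow> 'a::field) \<Rightarrow> (nat \<Rightarrow> 'a) \<Rightarrow> (nat \<Rightarrow> 'a)" where
  "L_mul N a b = (\<lambda>k. if 1 \<le> k \<and> k \<le> N
      then a k + b k + (\<Sum>i\<in>{1..<k}. a i * b (k - i)) else 0)"

definition mono_elem :: "nat \<Rightarrow> 'a::zero \<Rightarrow> (nat \<Rightarrow> 'a)" where
  "mono_elem m a = (\<lambda>k. if k = m then a else 0)"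

definition additive_character :: "('a::field \<Rightarrow> 'k::field) \<Rightarrow> bool" where
  "additive_character \<psi> \<longleftrightarrow> (\<forall>x y. \<psi> (x + y) = \<psi> x * \<psi> y) \<and> (\<forall>x. \<psi> x \<noteq> 0)"

definition has_conductor_q2 :: "nat \<Rightarrow> ('a::field \<Rightarrow> 'k) \<Rightarrow> bool" where
  "has_conductor_q2 q \<psi> \<longleftrightarrow> (\<exists>x. \<psi> (x ^ q) \<noteq> \<psi> x)"

definition A_psi :: "nat \<Rightarrow> ('a::field \<Rightarrow> 'k::field) \<Rightarrow> ((nat \<Rightarrow> 'a) \<Rightarrow> 'k) set" where
  "A_psi h \<psi> = {\<chi>. \<chi> \<in> extensional (trunc_carrier (h - 1))
      \<and> (\<forall>x\<in>trunc_carrier (h - 1). \<chi> x \<noteq> 0)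
      \<and> (\<forall>x\<in>trunc_carrier (h - 1). \<forall>y\<in>trunc_carrier (h - 1).
            \<chi> (L_mul (h - 1) x y) = \<chi> x * \<chi> y)
      \<and> (\<forall>a. \<chi> (mono_elem (h - 1) a) = \<psi> a)}"

definition is_U_rep :: "nat \<Rightarrow> nat \<Rightarrow> nat \<Rightarrow> ((nat \<Rightarrow> 'a::field) \<Rightarrow> 'k::field mat) \<Rightarrow> bool" where
  "is_U_rep q N n \<rho> \<longleftrightarrow> \<rho> \<in> extensional (trunc_carrier N)
     \<and> (\<forall>g\<in>trunc_carrier N. \<rho> g \<in> carrier_mat n n)
     \<and> \<rho> (\<lambda>_. 0) = 1\<^sub>m n
     \<and> (\<forall>g\<in>trunc_carrier N. \<forall>g'\<in>trunc_carrier N. \<rho> (U_mul q N g g') = \<rho> g * \<rho> g')"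

definition is_subspace_vec :: "nat \<Rightarrow> 'k::field vec set \<Rightarrow> bool" where
  "is_subspace_vec n W \<longleftrightarrow> W \<subseteq> carrier_vec n \<and> 0\<^sub>v n \<in> W
     \<and> (\<forall>v\<in>W. \<forall>w\<in>W. v + w \<in> W) \<and> (\<forall>c. \<forall>v\<in>W. c \<cdot>\<^sub>v v \<in> W)"

definition is_irreducible_U_rep :: "nat \<Rightarrow> nat \<Rightarrow> nat \<Rightarrow> ((nat \<Rightarrow> 'a::field) \<Rightarrow> 'k::field mat) \<Rightarrow> bool" where
  "is_irreducible_U_rep q N n \<rho> \<longleftrightarrow> is_U_rep q N n \<rho> \<and> 0 < n
     \<and> \<not> (\<exists>W. is_subspace_vec n W \<and> W \<noteq> {0\<^sub>v n} \<and> W \<noteq> carrier_vec n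
            \<and> (\<forall>g\<in>trunc_carrier N. \<forall>w\<in>W. \<rho> g *\<^sub>v w \<in> W))"

definition rep_iso :: "nat \<Rightarrow> nat \<times> ((nat \<Rightarrow> 'a::zero) \<Rightarrow> 'k::field mat) \<Rightarrow> nat \<times> ((nat \<Rightarrow> 'a) \<Rightarrow> 'k mat) \<Rightarrow> bool" where
  "rep_iso N r s \<longleftrightarrow> fst r = fst s \<and> (\<exists>P\<in>carrier_mat (fst r) (fst r). invertible_mat P
      \<and> (\<forall>g\<in>trunc_carrier N. P * snd r g = snd s g * P))"

definition G_psi_reps :: "nat \<Rightarrow> nat \<Rightarrow> ('a::field \<Rightarrow> 'k::field) \<Rightarrow> (nat \<times> ((nat \<Rightarrow> 'a) \<Rightarrow> 'k mat)) set" where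
  "G_psi_reps q h \<psi> = {(n, \<rho>). is_irreducible_U_rep q (2 * (h - 1)) n \<rho>
      \<and> (\<forall>a. \<rho> (mono_elem (2 * (h - 1)) a) = \<psi> a \<cdot>\<^sub>m 1\<^sub>m n)}"

definition G_psi :: "nat \<Rightarrow> nat \<Rightarrow> ('a::field \<Rightarrow> 'k::field) \<Rightarrow> (nat \<times> ((nat \<Rightarrow> 'a) \<Rightarrow> 'k mat)) set set" where
  "G_psi q h \<psi> = G_psi_reps q h \<psi> //
     {(r, s). r \<in> G_psi_reps q h \<psi> \<and> s \<in> G_psi_reps q h \<psi> \<and> rep_iso (2 * (h - 1)) r s}"

end

theory Submission
  imports Defs "HOL-Algebra.Multiplicative_Group" "HOL-Number_Theory.Residues"
    "HOL-Computational_Algebra.Formal_Power_Series"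
begin

text \<open>Write \<open>N = 2(h-1)\<close>. If the lowest odd coefficient of \<open>u\<close> is \<open>x \<tau>\<^sup>i\<close> with \<open>i \<le> h-1\<close>, then
  the commutator of \<open>u\<close> with \<open>1 + y \<tau>\<^sup>N\<^sup>-\<^sup>i\<close> has top coefficient \<open>x y\<^sup>q - y x\<^sup>q\<close> and otherwise only
  odd coefficients above \<open>h-1\<close>; the conductor condition makes \<open>\<psi>(x y\<^sup>q - y x\<^sup>q)\<close> a nondegenerate pairing.
  So \<open>\<psi>\<close>, extended trivially to the odd coefficients above \<open>h-1\<close>, behaves as in the Stone--von
  Neumann theorem. Let \<open>J\<close> be the subgroup where the odd coefficients below \<open>h-1\<close> vanish and, if
  \<open>h-1\<close> is odd, the coefficient of \<open>\<tau>\<^sup>h\<^sup>-\<^sup>1\<close> lies in the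
  fixed field of \<open>x \<mapsto> x\<^sup>q\<close>; its index is \<open>q\<^sup>h\<^sup>-\<^sup>1\<close>. A character \<open>\<chi>\<close> of \<open>U\<^sub>L\<^sup>1/U\<^sub>L\<^sup>h \<cong> H\<close> over \<open>\<psi>\<close>
  extends to a character \<open>\<Theta>\<close> of \<open>J\<close>, Mackey's criterion shows that \<open>\<Theta>\<close> induces an irreducible
  representation, and that representation remembers \<open>\<chi>\<close>. Conversely an averaging argument produces, in
  every irreducible representation over \<open>\<psi>\<close>, an eigenvector of \<open>J\<close> with such an eigencharacter, for one
  prescribed extension \<open>\<Theta>\<close> of each \<open>\<chi>\<close>.\<close>

section \<open>Linear algebra\<close>

text \<open>Radical and Lagrangian play different parts. Let S be the subgroup whose odd
  coefficients below h-1 vanish. Commutators in S pair the coefficients of tau^(h-1); J0 is the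
  radical of that pairing, and for odd h-1 the group J comes from a Lagrangian: the fixed field has
  q of the q^2 elements and is its own orthogonal complement. What an irreducible representation
  determines is a character of J0, which is the same datum as \<open>\<chi>\<close>, while
  irreducibility of the induced representation needs the larger J. The obstacle for odd h-1 is that
  \<open>\<chi>\<close> does not determine \<open>\<Theta>\<close>: an extension has to be chosen,
  and every representation over \<open>\<chi>\<close> must be shown to contain the chosen one. No
  trace characters of representations are used. Extensions and eigencharacters come from common
  eigenvectors of finitely many matrices of finite order, irreducibility from an averaging operator,
  isomorphism from Schur's lemma. The coefficient field enters only as an algebraically closed field
  of characteristic 0.\<close>

lemma is_subspace_vecD:
  assumes "is_subspace_vec n W"
  shows "W \<subseteq> carrier_vec n" "0\<^sub>v n \<in> W"
    "\<And>v w. v \<in> W \<Longrightarrow> w \<in> W \<Longrightarrow> v + w \<in> W" "\<And>c v. v \<in> W \<Longrightarrow> c \<cdot>\<^sub>v v \<in> W"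
  using assms unfolding is_subspace_vec_def by auto

lemma mult_mat_zero_vec: "A \<in> carrier_mat n m \<Longrightarrow> A *\<^sub>v 0\<^sub>v m = 0\<^sub>v n"
  by (intro eq_vecI) (auto simp: scalar_prod_def)

lemma smult_zero_vec [simp]: "(c::'k::field) \<cdot>\<^sub>v 0\<^sub>v n = 0\<^sub>v n"
  by (intro eq_vecI) auto

lemma mult_mat_unit_vec:
  fixes A :: "'k::field mat"
  assumes "A \<in> carrier_mat n m" "i < m"
  shows "A *\<^sub>v unit_vec m i = col A i"
  using assms by (intro eq_vecI) auto

section \<open>Eigenvectors from annihilating polynomials; \<open>poly_act A w f\<close> is f(A)w in
  Horner form\<close>

definition poly_act :: "'k::field mat \<Rightarrow> 'k vec \<Rightarrow> 'k poly \<Rightarrow> 'k vec" where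
  "poly_act A w f = fold_coeffs (\<lambda>c u. c \<cdot>\<^sub>v w + A *\<^sub>v u) f (0\<^sub>v (dim_vec w))"

context
  fixes A :: "'k::field mat" and w :: "'k vec" and n :: nat
  assumes A: "A \<in> carrier_mat n n" and w: "w \<in> carrier_vec n"
begin

lemma poly_act_0: "poly_act A w 0 = 0\<^sub>v n"
  using w by (simp add: poly_act_def)

lemma poly_act_pCons: "poly_act A w (pCons c f) = c \<cdot>\<^sub>v w + A *\<^sub>v poly_act A w f"
proof (cases "c = 0 \<and> f = 0")
  case True
  then show ?thesis using A w mult_mat_zero_vec[OF A] by (auto simp: poly_act_def)
next
  case False
  then show ?thesis by (auto simp: poly_act_def fold_coeffs_pCons_not_0_0_eq
    fold_coeffs_pCons_coeff_not_0_eq)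
qed

lemma poly_act_carrier: "poly_act A w f \<in> carrier_vec n"
  using A w by (induction f) (auto simp: poly_act_pCons poly_act_0)

lemma poly_act_add: "poly_act A w (f + g) = poly_act A w f + poly_act A w g"
proof (induction f arbitrary: g)
  case 0
  then show ?case using poly_act_carrier by (auto simp: poly_act_0)
next
  case (pCons a f)
  obtain b g' where g: "g = pCons b g'" by (cases g)
  have [simp]: "A *\<^sub>v (u + v) = A *\<^sub>v u + A *\<^sub>v v" if "u \<in> carrier_vec n" "v \<in> carrier_vec n" for u v
    using mult_add_distrib_mat_vec[OF A that] .
  show ?case using A w poly_act_carrier[of f] poly_act_carrier[of g']
    by (auto simp: g pCons.IH poly_act_pCons add_smult_distrib_vec intro!: eq_vecI)
qed

lemma poly_act_smult: "poly_act A w (Polynomial.smult a f) = a \<cdot>\<^sub>v poly_act A w f"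
proof (induction f)
  case 0
  then show ?case by (auto simp: poly_act_0)
next
  case (pCons b f)
  have "A *\<^sub>v (a \<cdot>\<^sub>v u) = a \<cdot>\<^sub>v (A *\<^sub>v u)" if "u \<in> carrier_vec n" for u
    using mult_mat_vec[OF A that] .
  then show ?case using A w poly_act_carrier[of f]
    by (auto simp: pCons.IH poly_act_pCons algebra_simps smult_add_distrib_vec smult_smult_assoc)
qed

lemma poly_act_linear_mult:
  "poly_act A w ([:- r, 1:] * f) = A *\<^sub>v poly_act A w f + (- r) \<cdot>\<^sub>v poly_act A w f"
proof -
  have "[:- r, 1:] * f = Polynomial.smult (- r) f + pCons 0 f" by simp
  then have "poly_act A w ([:- r, 1:] * f) = (- r) \<cdot>\<^sub>v poly_act A w f + (0 \<cdot>\<^sub>v w + A *\<^sub>v poly_act A w f)"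
    by (simp only: poly_act_add poly_act_smult poly_act_pCons)
  then show ?thesis using A w poly_act_carrier[of f] by (auto intro!: eq_vecI)
qed

lemma poly_act_monom: "poly_act A w (Polynomial.monom c m) = c \<cdot>\<^sub>v (((*\<^sub>v) A ^^ m) w)"
proof (induction m)
  case 0
  then show ?case using A w mult_mat_zero_vec[OF A] by (auto simp: monom_0 poly_act_pCons poly_act_0)
next
  case (Suc m)
  have c: "((*\<^sub>v) A ^^ m) w \<in> carrier_vec n" for m using A w by (induction m) auto
  have "A *\<^sub>v (a \<cdot>\<^sub>v u) = a \<cdot>\<^sub>v (A *\<^sub>v u)" if "u \<in> carrier_vec n" for a u
    using mult_mat_vec[OF A that] .
  then show ?case using A w c[of m]
    by (auto simp: monom_Suc poly_act_pCons Suc intro!: eq_vecI)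
qed

lemma poly_act_subspace:
  assumes "is_subspace_vec n W" "w \<in> W" "\<And>v. v \<in> W \<Longrightarrow> A *\<^sub>v v \<in> W"
  shows "poly_act A w f \<in> W"
  using assms is_subspace_vecD[OF assms(1)] by (induction f) (auto simp: poly_act_pCons poly_act_0)

text \<open>Dividing out linear factors of an annihilating polynomial one at a time, the last nonzero
  value is an eigenvector.\<close>

lemma eigenvector_of_annihilator:
  assumes alg: "\<forall>f::'k poly. 0 < degree f \<longrightarrow> (\<exists>x. poly f x = 0)"
    and W: "is_subspace_vec n W" "w \<in> W" "w \<noteq> 0\<^sub>v n" and AW: "\<And>v. v \<in> W \<Longrightarrow> A *\<^sub>v v \<in> W"
    and f: "f \<noteq> 0" "poly_act A w f = 0\<^sub>v n"
  shows "\<exists>v\<in>W. v \<noteq> 0\<^sub>v n \<and> (\<exists>r. A *\<^sub>v v = r \<cdot>\<^sub>v v)"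
  using f
proof (induction "degree f" arbitrary: f rule: less_induct)
  case less
  show ?case
  proof (cases "degree f = 0")
    case True
    then obtain c where c: "f = [:c:]" using degree_eq_zeroE by blast
    then have "c \<noteq> 0" "c \<cdot>\<^sub>v w = 0\<^sub>v n"
      using less.prems A w mult_mat_zero_vec[OF A] by (auto simp: poly_act_pCons poly_act_0)
    then have "w = 0\<^sub>v n"
      using w by (auto simp: vec_eq_iff)
    then show ?thesis using W by simp
  next
    case False
    then obtain r where "poly f r = 0" using alg by blast
    then obtain g where g: "f = [:- r, 1:] * g" by (metis dvdE poly_eq_0_iff_dvd)
    with less.prems have g0: "g \<noteq> 0" by auto
    then have dg: "degree g < degree f" unfolding g by (subst degree_mult_eq) auto
    show ?thesis
    proof (cases "poly_act A w g = 0\<^sub>v n")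
      case True
      then show ?thesis using less.hyps[OF dg g0] by blast
    next
      case v0: False
      let ?v = "poly_act A w g"
      have v: "?v \<in> carrier_vec n" "?v \<in> W"
        using poly_act_carrier poly_act_subspace[OF W(1,2) AW] by auto
      have "A *\<^sub>v ?v + (- r) \<cdot>\<^sub>v ?v = 0\<^sub>v n"
        using less.prems by (simp only: g poly_act_linear_mult)
      then have "(A *\<^sub>v ?v) $ i = r * ?v $ i" if "i < n" for i
        using that v A by (auto simp: vec_eq_iff)
      then have "A *\<^sub>v ?v = r \<cdot>\<^sub>v ?v"
        using v A by (intro eq_vecI) auto
      then show ?thesis using v v0 by blast
    qed
  qed
qed

end

text \<open>An eigenspace of one operator inside W stays stable under the others, so induction on I
  works; a first eigenvector exists because X^m - 1 annihilates the vectors of W. Commutation is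
  asked only on W: in the applications the matrices commute only up to factors that fix W
  pointwise.\<close>

lemma common_eigenvector:
  fixes A :: "'i \<Rightarrow> 'k::field mat"
  assumes alg: "\<forall>f::'k poly. 0 < degree f \<longrightarrow> (\<exists>x. poly f x = 0)"
    and I: "finite I"
    and A: "\<And>i. i \<in> I \<Longrightarrow> A i \<in> carrier_mat n n"
    and W: "is_subspace_vec n W" "W \<noteq> {0\<^sub>v n}"
    and AW: "\<And>i v. i \<in> I \<Longrightarrow> v \<in> W \<Longrightarrow> A i *\<^sub>v v \<in> W"
    and comm: "\<And>i j v. i \<in> I \<Longrightarrow> j \<in> I \<Longrightarrow> v \<in> W \<Longrightarrow> A i *\<^sub>v (A j *\<^sub>v v) = A j *\<^sub>v (A i *\<^sub>v v)"
    and fin_order: "\<And>i. i \<in> I \<Longrightarrow> \<exists>m>0. \<forall>v\<in>W. ((*\<^sub>v) (A i) ^^ m) v = v"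
  shows "\<exists>v\<in>W. v \<noteq> 0\<^sub>v n \<and> (\<forall>i\<in>I. \<exists>r. A i *\<^sub>v v = r \<cdot>\<^sub>v v)"
  using I A W AW comm fin_order
proof (induction I arbitrary: W rule: finite_induct)
  case empty
  then show ?case using is_subspace_vecD(2)[of n W] by auto
next
  case (insert x F)
  have Ax: "A x \<in> carrier_mat n n" using insert.prems by auto
  note W = is_subspace_vecD[OF insert.prems(2)]
  obtain w where w: "w \<in> W" "w \<noteq> 0\<^sub>v n" using insert.prems W by blast
  then have wc: "w \<in> carrier_vec n" using W by auto
  obtain m where m: "m > 0" "((*\<^sub>v) (A x) ^^ m) w = w" using insert.prems(6)[of x] w by auto
  let ?f = "Polynomial.monom 1 m + [:-1:] :: 'k poly"
  have "Polynomial.coeff ?f m = 1" using m(1) by (cases m) auto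
  then have f0: "?f \<noteq> 0" by (metis coeff_0 zero_neq_one)
  have "poly_act (A x) w ?f = 0\<^sub>v n"
    using Ax wc m(2) mult_mat_zero_vec[OF Ax]
    by (auto simp: poly_act_add[OF Ax wc] poly_act_monom[OF Ax wc] poly_act_pCons[OF Ax wc]
        poly_act_0[OF Ax wc] intro!: eq_vecI)
  from eigenvector_of_annihilator[OF Ax wc alg insert.prems(2) w _ f0 this] insert.prems(4)[of x]
  obtain v r where v: "v \<in> W" "v \<noteq> 0\<^sub>v n" "A x *\<^sub>v v = r \<cdot>\<^sub>v v" by auto
  define W' where "W' = {v \<in> W. A x *\<^sub>v v = r \<cdot>\<^sub>v v}"
  have lin: "A i *\<^sub>v (u + v) = A i *\<^sub>v u + A i *\<^sub>v v" "A i *\<^sub>v (c \<cdot>\<^sub>v u) = c \<cdot>\<^sub>v (A i *\<^sub>v u)"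
    if "i \<in> insert x F" "u \<in> W" "v \<in> W" for i u v c
  proof -
    have "A i \<in> carrier_mat n n" "u \<in> carrier_vec n" "v \<in> carrier_vec n" using that insert.prems W by auto
    then show "A i *\<^sub>v (u + v) = A i *\<^sub>v u + A i *\<^sub>v v" "A i *\<^sub>v (c \<cdot>\<^sub>v u) = c \<cdot>\<^sub>v (A i *\<^sub>v u)"
      by (auto simp: mult_add_distrib_mat_vec mult_mat_vec)
  qed
  have W': "is_subspace_vec n W'"
    unfolding is_subspace_vec_def
  proof (intro conjI ballI allI)
    show "W' \<subseteq> carrier_vec n" using W by (auto simp: W'_def)
    show "0\<^sub>v n \<in> W'" using W mult_mat_zero_vec[OF Ax] by (auto simp: W'_def)
    show "v + w \<in> W'" if "v \<in> W'" "w \<in> W'" for v w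
      using that W lin[of x v w] unfolding W'_def
      by (auto simp: smult_add_distrib_vec[of v n w] subset_iff)
    show "c \<cdot>\<^sub>v v \<in> W'" if "v \<in> W'" for c v
      using that W lin(2)[of x v v c] unfolding W'_def
      by (auto simp: smult_smult_assoc mult.commute)
  qed
  have "\<exists>v\<in>W'. v \<noteq> 0\<^sub>v n \<and> (\<forall>i\<in>F. \<exists>r. A i *\<^sub>v v = r \<cdot>\<^sub>v v)"
  proof (rule insert.IH)
    show "W' \<noteq> {0\<^sub>v n}" using v by (auto simp: W'_def)
    show "A i *\<^sub>v v \<in> W'" if "i \<in> F" "v \<in> W'" for i v
      using that insert.prems(4)[of i v] insert.prems(5)[of x i v] lin(2)[of i v v r]
      by (auto simp: W'_def)
    show "\<exists>m>0. \<forall>v\<in>W'. ((*\<^sub>v) (A i) ^^ m) v = v" if "i \<in> F" for i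
      using insert.prems(6)[of i] that unfolding W'_def by blast
    show "A i *\<^sub>v (A j *\<^sub>v v) = A j *\<^sub>v (A i *\<^sub>v v)" if "i \<in> F" "j \<in> F" "v \<in> W'" for i j v
      using insert.prems(5)[of i j v] that unfolding W'_def by blast
  qed (use insert.prems(1) W' in auto)
  then show ?case by (auto simp: W'_def)
qed

section \<open>Finite sums of vectors, with the length given explicitly so that empty sums make
  sense\<close>

definition vsum :: "nat \<Rightarrow> 'i set \<Rightarrow> ('i \<Rightarrow> 'k::field vec) \<Rightarrow> 'k vec" where
  "vsum n I f = vec n (\<lambda>k. \<Sum>i\<in>I. f i $ k)"

lemma vsum_carrier [simp]: "vsum n I f \<in> carrier_vec n" "dim_vec (vsum n I f) = n"
  by (auto simp: vsum_def)

lemma index_vsum [simp]: "k < n \<Longrightarrow> vsum n I f $ k = (\<Sum>i\<in>I. f i $ k)"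
  by (simp add: vsum_def)

lemma vsum_cong: "(\<And>i. i \<in> I \<Longrightarrow> f i = g i) \<Longrightarrow> vsum n I f = vsum n I g"
  by (auto simp: vsum_def)

lemma mult_mat_vsum:
  assumes "A \<in> carrier_mat m n" "\<And>i. i \<in> I \<Longrightarrow> f i \<in> carrier_vec n"
  shows "A *\<^sub>v vsum n I f = vsum m I (\<lambda>i. A *\<^sub>v f i)"
proof (rule eq_vecI)
  fix k assume k: "k < dim_vec (vsum m I (\<lambda>i. A *\<^sub>v f i))"
  then have "(A *\<^sub>v vsum n I f) $ k = (\<Sum>l<n. A $$ (k, l) * (\<Sum>i\<in>I. f i $ l))"
    using assms by (auto simp: scalar_prod_def atLeast0LessThan)
  also have "\<dots> = (\<Sum>i\<in>I. \<Sum>l<n. A $$ (k, l) * f i $ l)"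
    by (subst sum.swap) (simp add: sum_distrib_left)
  also have "\<dots> = (\<Sum>i\<in>I. (A *\<^sub>v f i) $ k)"
  proof (rule sum.cong)
    fix i assume "i \<in> I"
    then have "dim_vec (f i) = n" using assms(2) by auto
    then show "(\<Sum>l<n. A $$ (k, l) * f i $ l) = (A *\<^sub>v f i) $ k"
      using assms(1) k by (auto simp: scalar_prod_def atLeast0LessThan)
  qed simp
  also have "\<dots> = vsum m I (\<lambda>i. A *\<^sub>v f i) $ k" using k by simp
  finally show "(A *\<^sub>v vsum n I f) $ k = vsum m I (\<lambda>i. A *\<^sub>v f i) $ k" .
qed (use assms in auto)

lemma smult_vsum:
  assumes "\<And>i. i \<in> I \<Longrightarrow> f i \<in> carrier_vec n"
  shows "c \<cdot>\<^sub>v vsum n I f = vsum n I (\<lambda>i. c \<cdot>\<^sub>v f i)"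
proof (rule eq_vecI)
  fix k assume "k < dim_vec (vsum n I (\<lambda>i. c \<cdot>\<^sub>v f i))"
  moreover have "dim_vec (f i) = n" if "i \<in> I" for i using assms[OF that] by auto
  ultimately show "(c \<cdot>\<^sub>v vsum n I f) $ k = vsum n I (\<lambda>i. c \<cdot>\<^sub>v f i) $ k"
    by (auto simp: sum_distrib_left intro!: sum.cong)
qed simp

lemma vsum_swap: "vsum n I (\<lambda>i. vsum n K (f i)) = vsum n K (\<lambda>k. vsum n I (\<lambda>i. f i k))"
  by (intro eq_vecI) (auto intro: sum.swap)

lemma vsum_smult_const:
  assumes "v \<in> carrier_vec n"
  shows "vsum n I (\<lambda>i. c i \<cdot>\<^sub>v v) = (\<Sum>i\<in>I. c i) \<cdot>\<^sub>v v"
  using assms by (intro eq_vecI) (auto simp: sum_distrib_right)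

lemma vsum_reindex_bij:
  assumes "bij_betw \<phi> I K"
  shows "vsum n K f = vsum n I (\<lambda>i. f (\<phi> i))"
  unfolding vsum_def by (intro arg_cong[where f = "vec n"] ext sum.reindex_bij_betw[symmetric] assms)

lemma vsum_subset:
  assumes "finite K" "I \<subseteq> K" "\<And>i. i \<in> K - I \<Longrightarrow> f i = 0\<^sub>v n"
  shows "vsum n K f = vsum n I f"
  using assms by (intro eq_vecI) (auto intro!: sum.mono_neutral_right)

lemma vsum_subspace:
  assumes "is_subspace_vec n W" "\<And>i. i \<in> I \<Longrightarrow> f i \<in> W"
  shows "vsum n I f \<in> W"
proof (cases "finite I")
  case True
  note W = is_subspace_vecD[OF assms(1)]
  show ?thesis using True assms(2)
  proof (induction I rule: finite_induct)
    case empty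
    have "vsum n {} f = 0\<^sub>v n" by (intro eq_vecI) auto
    then show ?case using W by simp
  next
    case (insert x F)
    then have "f x \<in> carrier_vec n" using W by auto
    then have "vsum n (insert x F) f = f x + vsum n F f"
      using insert by (intro eq_vecI) auto
    then show ?case using insert W by auto
  qed
next
  case False
  then have "vsum n I f = 0\<^sub>v n" by (intro eq_vecI) auto
  then show ?thesis using is_subspace_vecD[OF assms(1)] by simp
qed

text \<open>PQ and QP have the same trace, which reads n = m in the field; characteristic 0 lifts
  this to the naturals.\<close>

lemma square_of_two_sided_inverse:
  fixes P :: "'k::field_char_0 mat"
  assumes P: "P \<in> carrier_mat n m" and Q: "Q \<in> carrier_mat m n"
    and PQ: "P * Q = 1\<^sub>m n" and QP: "Q * P = 1\<^sub>m m"
  shows "n = m"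
proof -
  have "(of_nat n :: 'k) = (\<Sum>i<n. (P * Q) $$ (i, i))" by (simp add: PQ)
  also have "\<dots> = (\<Sum>i<n. \<Sum>k<m. P $$ (i, k) * Q $$ (k, i))"
    using P Q by (auto simp: scalar_prod_def atLeast0LessThan intro!: sum.cong)
  also have "\<dots> = (\<Sum>k<m. \<Sum>i<n. Q $$ (k, i) * P $$ (i, k))"
    by (subst sum.swap) (simp add: mult.commute)
  also have "\<dots> = (\<Sum>k<m. (Q * P) $$ (k, k))"
    using P Q by (auto simp: scalar_prod_def atLeast0LessThan intro!: sum.cong)
  also have "\<dots> = of_nat m" by (simp add: QP)
  finally show ?thesis by simp
qed

text \<open>Preimages of the unit vectors form a right inverse Q. Then P(QP) = P, and injectivity
  cancels P to give QP = 1. P may be rectangular, so that Schur's lemma can compare representations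
  of different dimensions.\<close>

lemma invertible_of_bijective:
  fixes P :: "'k::field_char_0 mat"
  assumes P: "P \<in> carrier_mat n m"
    and inj: "\<And>x. x \<in> carrier_vec m \<Longrightarrow> P *\<^sub>v x = 0\<^sub>v n \<Longrightarrow> x = 0\<^sub>v m"
    and surj: "\<And>y. y \<in> carrier_vec n \<Longrightarrow> \<exists>x\<in>carrier_vec m. P *\<^sub>v x = y"
  shows "n = m \<and> invertible_mat P"
proof -
  obtain f where f: "\<And>y. y \<in> carrier_vec n \<Longrightarrow> f y \<in> carrier_vec m \<and> P *\<^sub>v f y = y"
    using surj by metis
  define Q where "Q = mat_of_cols m (map (\<lambda>i. f (unit_vec n i)) [0..<n])"
  have Q: "Q \<in> carrier_mat m n" by (auto simp: Q_def)
  have colQ: "col Q i = f (unit_vec n i)" if "i < n" for i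
    using that f[of "unit_vec n i"] by (auto simp: Q_def)
  have PQ: "P * Q = 1\<^sub>m n"
  proof (rule mat_col_eqI)
    fix i assume "i < dim_col (1\<^sub>m n :: 'k mat)"
    then show "col (P * Q) i = col (1\<^sub>m n) i"
      using P Q f[of "unit_vec n i"] by (simp add: col_mult2[of P n m Q n] colQ)
  qed (use P Q in auto)
  have "Q * P = 1\<^sub>m m"
  proof (rule mat_col_eqI)
    fix i assume "i < dim_col (1\<^sub>m m :: 'k mat)"
    then have i: "i < m" by simp
    let ?x = "col (Q * P) i" and ?y = "unit_vec m i :: 'k vec"
    have x: "?x \<in> carrier_vec m" using Q by (intro carrier_vecI) simp
    have Px: "P *\<^sub>v ?x = col (P * (Q * P)) i"
      using P Q i by (subst col_mult2[of P n m "Q * P" m]) auto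
    also have "P * (Q * P) = P" using P Q PQ by (simp flip: assoc_mult_mat[of P n m Q n P m])
    finally have "P *\<^sub>v ?x = P *\<^sub>v ?y" using P i by (simp add: mult_mat_unit_vec[OF P])
    then have "P *\<^sub>v (?x - ?y) = 0\<^sub>v n"
      using P x by (subst mult_minus_distrib_mat_vec[of P n m]) auto
    then have "?x - ?y = 0\<^sub>v m" using x by (intro inj) auto
    then have "?x $ k = ?y $ k" if "k < m" for k
      using that x i by (simp add: vec_eq_iff)
    moreover have "dim_vec ?x = m" using carrier_vecD[OF x] .
    ultimately have "?x = ?y" by (intro eq_vecI) simp_all
    then show "col (Q * P) i = col (1\<^sub>m m) i" using i by simp
  qed (use P Q in auto)
  with PQ P Q show ?thesis
    using square_of_two_sided_inverse[OF P Q]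
    by (auto simp: invertible_mat_def inverts_mat_def square_mat.simps)
qed

lemma smult_vec_cancel:
  fixes v :: "'k::field vec"
  assumes "v \<in> carrier_vec n" "v \<noteq> 0\<^sub>v n" "r \<cdot>\<^sub>v v = s \<cdot>\<^sub>v v"
  shows "r = s"
proof -
  obtain i where i: "i < n" "v $ i \<noteq> 0"
  proof (rule ccontr)
    assume *: "\<not> thesis"
    have "v = 0\<^sub>v n" using assms(1) * that by (intro eq_vecI) auto
    then show False using assms(2) by simp
  qed
  have "(r \<cdot>\<^sub>v v) $ i = (s \<cdot>\<^sub>v v) $ i" using assms(3) by simp
  then show ?thesis using i assms(1) by simp
qed

lemma invertible_mat_inverse:
  assumes "invertible_mat P" "P \<in> carrier_mat n n"
  obtains Q where "Q \<in> carrier_mat n n" "P * Q = 1\<^sub>m n" "Q * P = 1\<^sub>m n"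
proof -
  obtain Q where Q: "P * Q = 1\<^sub>m n" "Q * P = 1\<^sub>m (dim_row Q)"
    using assms by (auto simp: invertible_mat_def inverts_mat_def)
  have "dim_col Q = n" "dim_row Q = n"
    using arg_cong[OF Q(1), of dim_col] arg_cong[OF Q(2), of dim_col] assms(2) by auto
  then show thesis using that[of Q] Q by auto
qed

lemma invertible_matI:
  assumes "P \<in> carrier_mat n n" "Q \<in> carrier_mat n n" "P * Q = 1\<^sub>m n" "Q * P = 1\<^sub>m n"
  shows "invertible_mat P"
  using assms by (auto simp: invertible_mat_def inverts_mat_def)

lemma invertible_mat_mult:
  assumes P: "invertible_mat P" "P \<in> carrier_mat n n" and P': "invertible_mat P'" "P' \<in> carrier_mat n n"
  shows "invertible_mat (P * P')"
proof -
  obtain Q where Q: "Q \<in> carrier_mat n n" "P * Q = 1\<^sub>m n" "Q * P = 1\<^sub>m n"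
    using invertible_mat_inverse[OF P] .
  obtain Q' where Q': "Q' \<in> carrier_mat n n" "P' * Q' = 1\<^sub>m n" "Q' * P' = 1\<^sub>m n"
    using invertible_mat_inverse[OF P'] .
  have cancel: "(A * B) * (C * D) = 1\<^sub>m n"
    if "A \<in> carrier_mat n n" "B \<in> carrier_mat n n" "C \<in> carrier_mat n n" "D \<in> carrier_mat n n"
      "B * C = 1\<^sub>m n" "A * D = 1\<^sub>m n" for A B C D :: "'a mat"
  proof -
    have "(A * B) * (C * D) = A * ((B * C) * D)"
      using that(1-4) by (simp add: assoc_mult_mat[of _ n n _ n _ n])
    then show ?thesis using that by simp
  qed
  show ?thesis
    by (rule invertible_matI[of _ n "Q' * Q"]) (use P P' Q Q' cancel in auto)
qed

section \<open>Matrix representations of finite groups\<close>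

text \<open>Right translation by an element of H is injective on the finite set H, hence onto; this
  produces the identity and the inverses.\<close>

lemma (in group) finite_subgroupI:
  assumes H: "finite H" "H \<subseteq> carrier G" "H \<noteq> {}"
    and closed: "\<And>x y. x \<in> H \<Longrightarrow> y \<in> H \<Longrightarrow> x \<otimes> y \<in> H"
  shows "subgroup H G"
proof -
  have surj: "(\<lambda>y. y \<otimes> x) ` H = H" if x: "x \<in> H" for x
  proof (rule endo_inj_surj[OF H(1)])
    show "(\<lambda>y. y \<otimes> x) ` H \<subseteq> H" using closed x by auto
    show "inj_on (\<lambda>y. y \<otimes> x) H"
      using x H(2) by (intro inj_onI) (metis right_cancel subsetD)
  qed
  have one: "\<one> \<in> H"
  proof -
    obtain x where x: "x \<in> H" using H(3) by blast
    then have "x \<in> (\<lambda>y. y \<otimes> x) ` H" unfolding surj[OF x] .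
    then obtain y where y: "y \<in> H" "x = y \<otimes> x" by blast
    then have "y = \<one>" using x H(2) r_cancel_one'[of x y] by blast
    then show ?thesis using y by simp
  qed
  show ?thesis
  proof (rule subgroupI)
    fix x assume x: "x \<in> H"
    have "\<one> \<in> (\<lambda>y. y \<otimes> x) ` H" unfolding surj[OF x] by (rule one)
    then obtain y where y: "y \<in> H" "\<one> = y \<otimes> x" by blast
    then have "inv x = y" using x H(2) inv_equality[of y x] by auto
    then show "inv x \<in> H" using y by simp
  qed (use H closed in auto)
qed

text \<open>The conditions of \<open>is_U_rep\<close> for an arbitrary group; extensionality is left
  out because it concerns only values outside the group.\<close>

definition mat_rep :: "('g, 'b) monoid_scheme \<Rightarrow> nat \<Rightarrow> ('g \<Rightarrow> 'k::field mat) \<Rightarrow> bool" where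
  "mat_rep G n \<rho> \<longleftrightarrow> (\<forall>g\<in>carrier G. \<rho> g \<in> carrier_mat n n) \<and> \<rho> \<one>\<^bsub>G\<^esub> = 1\<^sub>m n
     \<and> (\<forall>g\<in>carrier G. \<forall>g'\<in>carrier G. \<rho> (g \<otimes>\<^bsub>G\<^esub> g') = \<rho> g * \<rho> g')"

definition irred_mat_rep :: "('g, 'b) monoid_scheme \<Rightarrow> nat \<Rightarrow> ('g \<Rightarrow> 'k::field mat) \<Rightarrow> bool" where
  "irred_mat_rep G n \<rho> \<longleftrightarrow> mat_rep G n \<rho> \<and> 0 < n
     \<and> \<not> (\<exists>W. is_subspace_vec n W \<and> W \<noteq> {0\<^sub>v n} \<and> W \<noteq> carrier_vec n
            \<and> (\<forall>g\<in>carrier G. \<forall>w\<in>W. \<rho> g *\<^sub>v w \<in> W))"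

lemma mat_repD:
  assumes "mat_rep G n \<rho>"
  shows "g \<in> carrier G \<Longrightarrow> \<rho> g \<in> carrier_mat n n" "\<rho> \<one>\<^bsub>G\<^esub> = 1\<^sub>m n"
    "g \<in> carrier G \<Longrightarrow> g' \<in> carrier G \<Longrightarrow> \<rho> (g \<otimes>\<^bsub>G\<^esub> g') = \<rho> g * \<rho> g'"
  using assms by (auto simp: mat_rep_def)

lemma mat_rep_mult_vec:
  assumes "mat_rep G n \<rho>" "g \<in> carrier G" "g' \<in> carrier G" "v \<in> carrier_vec n"
  shows "\<rho> (g \<otimes>\<^bsub>G\<^esub> g') *\<^sub>v v = \<rho> g *\<^sub>v (\<rho> g' *\<^sub>v v)"
  using mat_repD[OF assms(1)] assms by (simp add: assoc_mult_mat_vec[of _ n n _ n])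

lemma mat_rep_vec_carrier:
  assumes "mat_rep G n \<rho>" "g \<in> carrier G" "v \<in> carrier_vec n"
  shows "\<rho> g *\<^sub>v v \<in> carrier_vec n"
  using mat_repD(1)[OF assms(1,2)] assms(3) by auto

lemma mat_rep_inj:
  assumes "group G" "mat_rep G n \<rho>" "g \<in> carrier G" "v \<in> carrier_vec n" "\<rho> g *\<^sub>v v = 0\<^sub>v n"
  shows "v = 0\<^sub>v n"
proof -
  interpret group G by fact
  have "v = \<rho> (inv\<^bsub>G\<^esub> g \<otimes>\<^bsub>G\<^esub> g) *\<^sub>v v" using assms mat_repD[OF assms(2)] by simp
  also have "\<dots> = \<rho> (inv\<^bsub>G\<^esub> g) *\<^sub>v 0\<^sub>v n"
    using assms by (subst mat_rep_mult_vec[OF assms(2)]) auto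
  also have "\<dots> = 0\<^sub>v n"
    by (rule mult_mat_zero_vec[OF mat_repD(1)[OF assms(2)]]) (use assms in auto)
  finally show ?thesis .
qed

lemma mat_rep_pow_order:
  assumes "group G" "finite (carrier G)" "mat_rep G n \<rho>" "g \<in> carrier G"
  shows "\<exists>m>0. \<forall>v\<in>carrier_vec n. ((*\<^sub>v) (\<rho> g) ^^ m) v = v"
proof -
  interpret group G by fact
  have "((*\<^sub>v) (\<rho> g) ^^ m) v = \<rho> (g [^]\<^bsub>G\<^esub> m) *\<^sub>v v" if "v \<in> carrier_vec n" for m v
  proof (induction m)
    case 0
    then show ?case using that mat_repD[OF assms(3)] by simp
  next
    case (Suc m)
    have "\<rho> (g [^]\<^bsub>G\<^esub> Suc m) *\<^sub>v v = \<rho> g *\<^sub>v (\<rho> (g [^]\<^bsub>G\<^esub> m) *\<^sub>v v)"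
      unfolding nat_pow_Suc2[OF assms(4)] using assms that by (subst mat_rep_mult_vec[OF assms(3)]) auto
    then show ?case using Suc by simp
  qed
  moreover have "g [^]\<^bsub>G\<^esub> order G = \<one>\<^bsub>G\<^esub>" using pow_order_eq_1[OF assms(4)] .
  moreover have "order G > 0" using assms(2) order_gt_0_iff_finite by blast
  ultimately show ?thesis using mat_repD(2)[OF assms(3)] by (intro exI[of _ "order G"]) auto
qed

text \<open>The kernel of P is stable and, as P is nonzero, proper; the image is stable and nonzero.
  Irreducibility of both sides therefore makes P bijective, which also forces the dimensions to
  agree.\<close>

lemma schur:
  fixes \<rho> \<sigma> :: "'g \<Rightarrow> 'k::field_char_0 mat"
  assumes \<rho>: "irred_mat_rep G n \<rho>" and \<sigma>: "irred_mat_rep G m \<sigma>"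
    and P: "P \<in> carrier_mat n m" "P \<noteq> 0\<^sub>m n m"
    and comm: "\<And>g. g \<in> carrier G \<Longrightarrow> \<rho> g * P = P * \<sigma> g"
  shows "n = m \<and> invertible_mat P"
proof (rule invertible_of_bijective[OF P(1)])
  have r: "mat_rep G n \<rho>" "mat_rep G m \<sigma>" using \<rho> \<sigma> by (auto simp: irred_mat_rep_def)
  have comm': "\<rho> g *\<^sub>v (P *\<^sub>v x) = P *\<^sub>v (\<sigma> g *\<^sub>v x)" if "g \<in> carrier G" "x \<in> carrier_vec m" for g x
    using comm[OF that(1)] P(1) that mat_repD(1)[OF r(1)] mat_repD(1)[OF r(2)]
    by (metis assoc_mult_mat_vec)
  have lin: "P *\<^sub>v (x + y) = P *\<^sub>v x + P *\<^sub>v y" "P *\<^sub>v (c \<cdot>\<^sub>v x) = c \<cdot>\<^sub>v (P *\<^sub>v x)"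
    if "x \<in> carrier_vec m" "y \<in> carrier_vec m" for x y c
    using that P by (auto simp: mult_add_distrib_mat_vec mult_mat_vec)
  obtain l where l: "l < m" "col P l \<noteq> 0\<^sub>v n"
  proof (rule ccontr)
    assume *: "\<not> thesis"
    have "P = 0\<^sub>m n m"
      using P * that by (intro mat_col_eqI) auto
    then show False using P by simp
  qed
  then have Pl: "P *\<^sub>v unit_vec m l \<noteq> 0\<^sub>v n" using mult_mat_unit_vec[OF P(1)] by simp
  define K where "K = {x \<in> carrier_vec m. P *\<^sub>v x = 0\<^sub>v n}"
  have "is_subspace_vec m K"
    unfolding is_subspace_vec_def K_def using mult_mat_zero_vec[OF P(1)] by (auto simp: lin)
  moreover have "\<forall>g\<in>carrier G. \<forall>w\<in>K. \<sigma> g *\<^sub>v w \<in> K"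
    unfolding K_def using mat_rep_vec_carrier[OF r(2)] mult_mat_zero_vec[OF mat_repD(1)[OF r(1)]]
    by (auto simp flip: comm')
  moreover have "K \<noteq> carrier_vec m"
  proof -
    have "unit_vec m l \<notin> K" using Pl unfolding K_def by blast
    then show ?thesis using unit_vec_carrier by metis
  qed
  ultimately have "K = {0\<^sub>v m}" using \<sigma> by (auto simp: irred_mat_rep_def)
  then show "x = 0\<^sub>v m" if "x \<in> carrier_vec m" "P *\<^sub>v x = 0\<^sub>v n" for x
    using that by (auto simp: K_def)
  define R where "R = (\<lambda>x. P *\<^sub>v x) ` carrier_vec m"
  have "is_subspace_vec n R"
    unfolding is_subspace_vec_def
  proof (intro conjI ballI allI)
    show "R \<subseteq> carrier_vec n" using P by (auto simp: R_def)
    show "0\<^sub>v n \<in> R" unfolding R_def by (rule image_eqI[of _ _ "0\<^sub>v m"]) (auto simp: mult_mat_zero_vec[OF P(1)])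
    show "v + w \<in> R" if "v \<in> R" "w \<in> R" for v w
      using that unfolding R_def by (auto simp flip: lin(1))
    show "c \<cdot>\<^sub>v v \<in> R" if "v \<in> R" for v c
      using that unfolding R_def by (auto simp flip: lin(2))
  qed
  moreover have "\<forall>g\<in>carrier G. \<forall>w\<in>R. \<rho> g *\<^sub>v w \<in> R"
    unfolding R_def using mat_rep_vec_carrier[OF r(2)] by (auto simp: comm')
  moreover have "R \<noteq> {0\<^sub>v n}"
  proof -
    have "P *\<^sub>v unit_vec m l \<in> R" unfolding R_def by (rule imageI) simp
    then show ?thesis using Pl by blast
  qed
  ultimately have "R = carrier_vec n" using \<rho> by (auto simp: irred_mat_rep_def)
  then show "\<exists>x\<in>carrier_vec m. P *\<^sub>v x = y" if "y \<in> carrier_vec n" for y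
    using that unfolding R_def by (metis imageE)
qed

section \<open>Induction of a linear character, in matrix form\<close>

text \<open>The \<open>u k\<close> represent the left cosets: every g lies in u_k J for exactly one
  k. The normalisation of \<open>u i0\<close> singles out a basis vector on which J acts by
  \<open>\<Theta>\<close>.\<close>

locale induced_rep = group G for G (structure) +
  fixes J :: "'a set" and \<Theta> :: "'a \<Rightarrow> 'k::field_char_0" and u :: "nat \<Rightarrow> 'a" and m i0 :: nat
  assumes finite_carrier: "finite (carrier G)"
    and J: "subgroup J G"
    and char_mult: "\<And>x y. x \<in> J \<Longrightarrow> y \<in> J \<Longrightarrow> \<Theta> (x \<otimes> y) = \<Theta> x * \<Theta> y"
    and char_one: "\<Theta> \<one> = 1"
    and u_closed: "\<And>k. k < m \<Longrightarrow> u k \<in> carrier G"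
    and i0: "i0 < m" "u i0 = \<one>"
    and transversal: "\<And>g. g \<in> carrier G \<Longrightarrow> \<exists>!k. k < m \<and> inv (u k) \<otimes> g \<in> J"
begin

text \<open>Extension by zero gives all entries of the induced matrices by one formula: entry (i,k)
  of \<open>ind g\<close> is nonzero exactly when g maps the coset of u_k to the coset of
  u_i.\<close>

definition char_ext :: "'a \<Rightarrow> 'k" where
  "char_ext g = (if g \<in> J then \<Theta> g else 0)"

definition ind :: "'a \<Rightarrow> 'k mat" where
  "ind = (\<lambda>g\<in>carrier G. mat m m (\<lambda>(i, k). char_ext (inv (u i) \<otimes> g \<otimes> u k)))"

lemma J_closed: "x \<in> J \<Longrightarrow> x \<in> carrier G"
  using subgroup.mem_carrier[OF J] .

lemmas J_mult = subgroup.m_closed[OF J]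
lemmas J_inv = subgroup.m_inv_closed[OF J]
lemmas J_one = subgroup.one_closed[OF J]

lemma char_inv: "x \<in> J \<Longrightarrow> \<Theta> (inv x) * \<Theta> x = 1"
  using char_mult[OF J_inv, of x x] char_one J_closed[of x] by simp

lemma mem_J_cancel:
  assumes "x \<in> carrier G" "y \<in> J"
  shows "x \<otimes> y \<in> J \<longleftrightarrow> x \<in> J"
proof
  assume "x \<otimes> y \<in> J"
  then have "x \<otimes> y \<otimes> inv y \<in> J" using assms J_mult J_inv by blast
  then show "x \<in> J" using assms J_closed[of y] by (simp add: m_assoc)
qed (use assms J_mult in blast)

lemma char_ext_mult: "x \<in> carrier G \<Longrightarrow> y \<in> J \<Longrightarrow> char_ext (x \<otimes> y) = char_ext x * \<Theta> y"
  by (auto simp: char_ext_def mem_J_cancel char_mult)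

lemma rep_unique: "k < m \<Longrightarrow> l < m \<Longrightarrow> inv (u k) \<otimes> u l \<in> J \<Longrightarrow> k = l"
  using transversal[of "u l"] u_closed[of l] J_one by auto

text \<open>For \<open>x = u l\<close> this says that column l of \<open>ind g\<close> has a single
  nonzero entry; it collapses the sums in matrix products.\<close>

lemma transversal_mult:
  assumes "g \<in> carrier G" "x \<in> carrier G"
  obtains k0 where "k0 < m" "inv (u k0) \<otimes> g \<otimes> x \<in> J"
    "\<And>k. k < m \<Longrightarrow> inv (u k) \<otimes> g \<otimes> x \<in> J \<Longrightarrow> k = k0"
proof -
  have eq: "inv (u k) \<otimes> g \<otimes> x = inv (u k) \<otimes> (g \<otimes> x)" if "k < m" for k
    using assms u_closed[OF that] by (simp add: m_assoc)
  obtain k0 where k0: "k0 < m" "inv (u k0) \<otimes> (g \<otimes> x) \<in> J"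
    using transversal[of "g \<otimes> x"] assms by blast
  show thesis
  proof (rule that)
    show "k0 < m" "inv (u k0) \<otimes> g \<otimes> x \<in> J" using k0 by (simp_all only: eq)
    show "k = k0" if "k < m" "inv (u k) \<otimes> g \<otimes> x \<in> J" for k
      using transversal[of "g \<otimes> x"] assms k0 that by (auto simp only: eq m_closed)
  qed
qed

lemma conj_cancel:
  assumes "g \<in> carrier G" "x \<in> carrier G" "y \<in> carrier G"
  shows "inv (inv g \<otimes> x) \<otimes> (inv g \<otimes> y) = inv x \<otimes> y"
proof -
  have "g \<otimes> (inv g \<otimes> y) = y" using assms by (simp flip: m_assoc)
  then show ?thesis using assms by (simp add: inv_mult_group m_assoc)
qed

text \<open>The version for rows: with g = y^(-1) u_i it says that row i of \<open>ind y\<close> has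
  at most one nonzero entry.\<close>

lemma row_unique:
  assumes "k < m" "l < m" "g \<in> carrier G" "inv g \<otimes> u k \<in> J" "inv g \<otimes> u l \<in> J"
  shows "k = l"
proof -
  have "inv (inv g \<otimes> u k) \<otimes> (inv g \<otimes> u l) \<in> J" using assms J_mult J_inv by blast
  also have "inv (inv g \<otimes> u k) \<otimes> (inv g \<otimes> u l) = inv (u k) \<otimes> u l"
    using conj_cancel[of g "u k" "u l"] assms u_closed by simp
  finally show ?thesis using assms rep_unique by blast
qed

lemma ind_carrier: "g \<in> carrier G \<Longrightarrow> ind g \<in> carrier_mat m m"
  by (simp add: ind_def)

lemma ind_index: "g \<in> carrier G \<Longrightarrow> i < m \<Longrightarrow> k < m \<Longrightarrow>
    ind g $$ (i, k) = char_ext (inv (u i) \<otimes> g \<otimes> u k)"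
  by (simp add: ind_def)

lemma ind_mult_vec_index: "g \<in> carrier G \<Longrightarrow> i < m \<Longrightarrow> v \<in> carrier_vec m \<Longrightarrow>
    (ind g *\<^sub>v v) $ i = (\<Sum>k<m. char_ext (inv (u i) \<otimes> g \<otimes> u k) * v $ k)"
  using ind_carrier[of g] by (auto simp: scalar_prod_def ind_index[symmetric] atLeast0LessThan intro!: sum.cong)

lemma char_ext_rep: "k < m \<Longrightarrow> l < m \<Longrightarrow> char_ext (inv (u k) \<otimes> u l) = (if k = l then 1 else 0)"
  using rep_unique[of k l] u_closed[of l] J_one char_one by (auto simp: char_ext_def)

lemma mat_rep_ind: "mat_rep G m ind"
  unfolding mat_rep_def
proof (intro conjI ballI)
  show "ind g \<in> carrier_mat m m" if "g \<in> carrier G" for g by (rule ind_carrier[OF that])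
  show "ind \<one> = 1\<^sub>m m"
    using u_closed by (intro eq_matI) (auto simp: ind_index char_ext_rep ind_def)
  fix g g' assume g: "g \<in> carrier G" "g' \<in> carrier G"
  show "ind (g \<otimes> g') = ind g * ind g'"
  proof (rule eq_matI)
    fix i l assume "i < dim_row (ind g * ind g')" "l < dim_col (ind g * ind g')"
    then have il: "i < m" "l < m" using carrier_matD[OF ind_carrier] g by auto
    let ?f = "\<lambda>k. inv (u k) \<otimes> g' \<otimes> u l"
    \<comment> \<open>g' sends the coset of u_l to that of u_k0, so only k0 contributes, and the
      product formula reduces to \<open>char_ext_mult\<close>.\<close>
    obtain k0 where k0: "k0 < m" "?f k0 \<in> J" and un: "\<And>k. k < m \<Longrightarrow> ?f k \<in> J \<Longrightarrow> k = k0"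
      using transversal_mult[OF g(2) u_closed[OF il(2)]] by blast
    have zero: "char_ext (?f k) = 0" if "k < m" "k \<noteq> k0" for k
      using un[OF that(1)] that(2) by (auto simp: char_ext_def)
    have "(ind g * ind g') $$ (i, l) = (\<Sum>k<m. ind g $$ (i, k) * ind g' $$ (k, l))"
      using carrier_matD[OF ind_carrier[OF g(1)]] carrier_matD[OF ind_carrier[OF g(2)]] il
      by (simp add: scalar_prod_def atLeast0LessThan)
    also have "\<dots> = (\<Sum>k<m. char_ext (inv (u i) \<otimes> g \<otimes> u k) * char_ext (?f k))"
      using g il by (simp add: ind_index)
    also have "\<dots> = (\<Sum>k\<in>{k0}. char_ext (inv (u i) \<otimes> g \<otimes> u k) * char_ext (?f k))"
      using k0 zero by (intro sum.mono_neutral_right) (auto simp del: mult_eq_0_iff)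
    also have "\<dots> = char_ext (inv (u i) \<otimes> g \<otimes> u k0) * \<Theta> (?f k0)"
      using k0 by (simp add: char_ext_def)
    also have "\<dots> = char_ext (inv (u i) \<otimes> g \<otimes> u k0 \<otimes> ?f k0)"
      using k0 g il u_closed by (subst char_ext_mult) auto
    also have "inv (u i) \<otimes> g \<otimes> u k0 \<otimes> ?f k0 = inv (u i) \<otimes> (g \<otimes> g') \<otimes> u l"
    proof -
      have "u k0 \<otimes> ?f k0 = g' \<otimes> u l"
        using k0 il g u_closed by (simp add: m_assoc[symmetric])
      then show ?thesis using k0 il g u_closed[of i] u_closed[of k0] u_closed[of l]
        by (simp add: m_assoc)
    qed
    finally show "ind (g \<otimes> g') $$ (i, l) = (ind g * ind g') $$ (i, l)"
      using g il by (simp add: ind_index)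
  qed (use g ind_carrier[of g] ind_carrier[of g'] ind_carrier[of "g \<otimes> g'"] in auto)
qed

text \<open>The translates of the basis vector i0 by the \<open>u k\<close> are the whole standard
  basis, so this vector generates the induced representation.\<close>

lemma ind_unit_vec:
  assumes "k < m" "j \<in> J"
  shows "ind (u k \<otimes> j) *\<^sub>v unit_vec m i0 = \<Theta> j \<cdot>\<^sub>v unit_vec m k"
proof (rule eq_vecI)
  fix i assume "i < dim_vec (\<Theta> j \<cdot>\<^sub>v unit_vec m k)"
  then have i: "i < m" by simp
  have c: "u k \<otimes> j \<in> carrier G" using assms u_closed J_closed by blast
  have "(ind (u k \<otimes> j) *\<^sub>v unit_vec m i0) $ i = char_ext (inv (u i) \<otimes> (u k \<otimes> j) \<otimes> \<one>)"
    using i0 i c ind_carrier[OF c] by (subst mult_mat_unit_vec) (auto simp: ind_index)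
  also have "\<dots> = char_ext (inv (u i) \<otimes> u k \<otimes> j)"
    using assms i u_closed J_closed by (simp add: m_assoc)
  also have "\<dots> = (if i = k then 1 else 0) * \<Theta> j"
    using assms i u_closed by (subst char_ext_mult) (auto simp: char_ext_rep)
  finally show "(ind (u k \<otimes> j) *\<^sub>v unit_vec m i0) $ i = (\<Theta> j \<cdot>\<^sub>v unit_vec m k) $ i"
    using i assms by auto
qed (use assms u_closed J_closed ind_carrier[of "u k \<otimes> j"] in auto)

lemma ind_eigenvector: "j \<in> J \<Longrightarrow> ind j *\<^sub>v unit_vec m i0 = \<Theta> j \<cdot>\<^sub>v unit_vec m i0"
  using ind_unit_vec[of i0 j] i0 J_closed[of j] by simp

text \<open>Let v have a nonzero entry at l. As soon as u_l^(-1) j u_l lies in J, the only nonzero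
  entry in row l of \<open>ind j\<close> is the diagonal one, \<open>\<Theta>\<close> of that
  conjugate; compare the entries at l. So a J-character occurring in the induced representation
  agrees with a conjugate of \<open>\<Theta>\<close> wherever both are defined. This is how
  \<open>\<chi>\<close> is recovered later.\<close>

lemma ind_conjugate_character:
  assumes v: "v \<in> carrier_vec m" "v \<noteq> 0\<^sub>v m" and eig: "\<And>j. j \<in> J \<Longrightarrow> ind j *\<^sub>v v = \<Theta>1 j \<cdot>\<^sub>v v"
  shows "\<exists>x\<in>carrier G. \<forall>j\<in>J. inv x \<otimes> j \<otimes> x \<in> J \<longrightarrow> \<Theta>1 j = \<Theta> (inv x \<otimes> j \<otimes> x)"
proof -
  obtain l where l: "l < m" "v $ l \<noteq> 0"
  proof (rule ccontr)
    assume *: "\<not> thesis"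
    have "v = 0\<^sub>v m" using v * that by (intro eq_vecI) auto
    then show False using v by simp
  qed
  have "\<Theta>1 j = \<Theta> (inv (u l) \<otimes> j \<otimes> u l)" if j: "j \<in> J" "inv (u l) \<otimes> j \<otimes> u l \<in> J" for j
  proof -
    have ul: "u l \<in> carrier G" "j \<in> carrier G" using l u_closed J_closed j by auto
    have "k = l" if "k < m" "inv (u l) \<otimes> j \<otimes> u k \<in> J" for k
      using row_unique[of k l "inv j \<otimes> u l"] that l j ul by (simp add: inv_mult_group)
    then have "(\<Sum>k<m. char_ext (inv (u l) \<otimes> j \<otimes> u k) * v $ k) =
        (\<Sum>k\<in>{l}. char_ext (inv (u l) \<otimes> j \<otimes> u k) * v $ k)"
      using l by (intro sum.mono_neutral_right) (auto simp: char_ext_def)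
    then have "(ind j *\<^sub>v v) $ l = (\<Sum>k\<in>{l}. char_ext (inv (u l) \<otimes> j \<otimes> u k) * v $ k)"
      using l v ul by (simp only: ind_mult_vec_index)
    moreover have "(ind j *\<^sub>v v) $ l = \<Theta>1 j * v $ l" using eig[OF j(1)] l v by simp
    ultimately show ?thesis using l j by (simp add: char_ext_def)
  qed
  then show ?thesis using u_closed l by blast
qed

lemma card_carrier: "card (carrier G) = m * card J"
proof -
  let ?f = "\<lambda>(k, j). u k \<otimes> j"
  have "bij_betw ?f ({..<m} \<times> J) (carrier G)"
    unfolding bij_betw_def
  proof
    show "inj_on ?f ({..<m} \<times> J)"
    proof (rule inj_onI, clarify)
      fix k j k' j' assume *: "k < m" "k' < m" "j \<in> J" "j' \<in> J" "u k \<otimes> j = u k' \<otimes> j'"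
      have c: "u k \<in> carrier G" "u k' \<in> carrier G" "j \<in> carrier G" "j' \<in> carrier G"
        using * u_closed J_closed by auto
      have "inv (u k) \<otimes> u k' \<otimes> j' = j" using c
        by (simp add: m_assoc flip: *(5)) (simp add: m_assoc[symmetric])
      then have "k = k'" using rep_unique[of k k'] mem_J_cancel[of "inv (u k) \<otimes> u k'" j'] c * by auto
      then show "k = k' \<and> j = j'" using * c by simp
    qed
    show "?f ` ({..<m} \<times> J) = carrier G"
    proof
      show "carrier G \<subseteq> ?f ` ({..<m} \<times> J)"
      proof
        fix g assume g: "g \<in> carrier G"
        then obtain k where k: "k < m" "inv (u k) \<otimes> g \<in> J" using transversal by blast
        then have "g = u k \<otimes> (inv (u k) \<otimes> g)" using g u_closed by (simp add: m_assoc[symmetric])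
        then show "g \<in> ?f ` ({..<m} \<times> J)" using k by (intro image_eqI[of _ _ "(k, inv (u k) \<otimes> g)"]) auto
      qed
    qed (use u_closed J_closed in auto)
  qed
  from bij_betw_same_card[OF this] show ?thesis by (simp add: card_cartesian_product)
qed

end

section \<open>Mackey's irreducibility criterion and Frobenius reciprocity\<close>

locale mackey_induced_rep = induced_rep G J \<Theta> u m i0
  for G (structure) and J and \<Theta> :: "'a \<Rightarrow> 'k::field_char_0" and u m i0 +
  assumes mackey: "\<And>x. x \<in> carrier G \<Longrightarrow> x \<notin> J \<Longrightarrow>
    \<exists>j\<in>J. x \<otimes> j \<otimes> inv x \<in> J \<and> \<Theta> (x \<otimes> j \<otimes> inv x) \<noteq> \<Theta> j"
begin

text \<open>These are the entries of the operator that sums \<open>\<Theta> (inv j)\<close> times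
  \<open>ind j\<close> over J. Mackey's condition kills every column except i0, so the operator is
  |J| times the projection to the coordinate i0.\<close>

lemma average_char_ext:
  assumes k: "k < m" and l: "l < m"
  shows "(\<Sum>j\<in>J. \<Theta> (inv j) * char_ext (inv (u k) \<otimes> j \<otimes> u l)) =
    (if k = i0 \<and> l = i0 then of_nat (card J) else 0)"
proof (cases "l = i0")
  case False
  then have nJ: "u l \<notin> J" using rep_unique[of i0 l] i0 l u_closed by auto
  have ul: "u l \<in> carrier G" "u k \<in> carrier G" using l k u_closed by auto
  have "inv (u l) \<notin> J" using nJ J_inv[of "inv (u l)"] ul by auto
  \<comment> \<open>Replacing j by j j0 multiplies the sum by \<open>\<Theta> (inv j0)\<close> times
    \<open>\<Theta>\<close> of u_l^(-1) j0 u_l. Mackey's condition at u_l^(-1) makes this factor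
    different from 1.\<close>
  then obtain j0 where j0: "j0 \<in> J" and j1: "inv (u l) \<otimes> j0 \<otimes> u l \<in> J"
    "\<Theta> (inv (u l) \<otimes> j0 \<otimes> u l) \<noteq> \<Theta> j0"
    using mackey[of "inv (u l)"] ul by auto
  let ?j1 = "inv (u l) \<otimes> j0 \<otimes> u l"
  let ?S = "\<Sum>j\<in>J. \<Theta> (inv j) * char_ext (inv (u k) \<otimes> j \<otimes> u l)"
  have j0c: "j0 \<in> carrier G" using J_closed j0 by auto
  have "bij_betw (\<lambda>j. j \<otimes> j0) J J"
    by (rule bij_betw_byWitness[where f' = "\<lambda>j. j \<otimes> inv j0"])
      (use j0 j0c J_mult J_inv J_closed in \<open>auto simp: m_assoc\<close>)
  then have "?S = (\<Sum>j\<in>J. \<Theta> (inv (j \<otimes> j0)) * char_ext (inv (u k) \<otimes> (j \<otimes> j0) \<otimes> u l))"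
    by (rule sum.reindex_bij_betw[symmetric])
  also have "\<dots> = (\<Sum>j\<in>J. \<Theta> (inv j0) * \<Theta> ?j1 * (\<Theta> (inv j) * char_ext (inv (u k) \<otimes> j \<otimes> u l)))"
  proof (rule sum.cong)
    fix j assume j: "j \<in> J"
    have jc: "j \<in> carrier G" using J_closed j by auto
    have "\<Theta> (inv (j \<otimes> j0)) = \<Theta> (inv j0) * \<Theta> (inv j)"
      using j j0 jc j0c by (simp add: inv_mult_group char_mult J_inv)
    moreover have "inv (u k) \<otimes> (j \<otimes> j0) \<otimes> u l = (inv (u k) \<otimes> j \<otimes> u l) \<otimes> ?j1"
    proof -
      have "u l \<otimes> ?j1 = j0 \<otimes> u l" using ul j0c by (simp add: m_assoc[symmetric])
      then show ?thesis using ul j0c jc by (simp add: m_assoc)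
    qed
    ultimately show "\<Theta> (inv (j \<otimes> j0)) * char_ext (inv (u k) \<otimes> (j \<otimes> j0) \<otimes> u l) =
        \<Theta> (inv j0) * \<Theta> ?j1 * (\<Theta> (inv j) * char_ext (inv (u k) \<otimes> j \<otimes> u l))"
      using j1(1) ul jc by (simp add: char_ext_mult)
  qed simp
  also have "\<dots> = \<Theta> (inv j0) * \<Theta> ?j1 * ?S" by (simp add: sum_distrib_left)
  finally have "?S = \<Theta> (inv j0) * \<Theta> ?j1 * ?S" .
  moreover have "\<Theta> (inv j0) * \<Theta> ?j1 \<noteq> 1"
  proof
    assume "\<Theta> (inv j0) * \<Theta> ?j1 = 1"
    then have "\<Theta> (inv j0) * \<Theta> ?j1 = \<Theta> (inv j0) * \<Theta> j0" "\<Theta> (inv j0) \<noteq> 0"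
      using char_inv[OF j0] by auto
    then show False using j1(2) by simp
  qed
  moreover have "s = 0" if "s = c * s" "c \<noteq> 1" for s c :: 'k using that by simp
  ultimately have "?S = 0" by blast
  then show ?thesis using False by simp
next
  case True
  show ?thesis
  proof (cases "k = i0")
    case k0: True
    have "\<Theta> (inv j) * char_ext (inv (u k) \<otimes> j \<otimes> u l) = 1" if "j \<in> J" for j
      using that True k0 i0 J_closed[of j] char_inv[of j] by (simp add: char_ext_def)
    then have "(\<Sum>j\<in>J. \<Theta> (inv j) * char_ext (inv (u k) \<otimes> j \<otimes> u l)) = (\<Sum>j\<in>J. 1)"
      by (rule sum.cong[OF refl])
    then show ?thesis using True k0 by simp
  next
    case k0: False
    have "inv (u k) \<otimes> j \<otimes> u l \<notin> J" if "j \<in> J" for j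
    proof -
      have "inv (u k) \<notin> J" using k0 rep_unique[of k i0] k u_closed i0 by auto
      then show ?thesis using that True i0 k u_closed mem_J_cancel[of "inv (u k)" j] J_closed by auto
    qed
    then show ?thesis using k0 by (auto simp: char_ext_def intro!: sum.neutral)
  qed
qed

lemma irred_mat_rep_ind: "irred_mat_rep G m ind"
  unfolding irred_mat_rep_def
proof (intro conjI notI; (elim exE conjE)?)
  show "mat_rep G m ind" by (rule mat_rep_ind)
  show "0 < m" using i0 by simp
  fix W assume W: "is_subspace_vec m W" "W \<noteq> {0\<^sub>v m}" "W \<noteq> carrier_vec m"
    and inv: "\<forall>g\<in>carrier G. \<forall>w\<in>W. ind g *\<^sub>v w \<in> W"
  note Ws = is_subspace_vecD[OF W(1)]
  obtain w0 where w0: "w0 \<in> W" "w0 \<noteq> 0\<^sub>v m" using W Ws by blast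
  have w0c: "w0 \<in> carrier_vec m" using w0 Ws by auto
  obtain i where i: "i < m" "w0 $ i \<noteq> 0"
  proof (rule ccontr)
    assume *: "\<not> thesis"
    have "w0 = 0\<^sub>v m" using w0c * that by (intro eq_vecI) auto
    then show False using w0 by simp
  qed
  \<comment> \<open>Translation by u_i^(-1) moves the nonzero coordinate i into position i0, the
    only one that the averaging operator sees.\<close>
  define w where "w = ind (inv (u i)) *\<^sub>v w0"
  have w: "w \<in> W" using inv w0 u_closed i by (auto simp: w_def)
  then have wc: "w \<in> carrier_vec m" using Ws by auto
  have "w $ i0 = (\<Sum>k<m. (if i = k then 1 else 0) * w0 $ k)"
    unfolding w_def using i i0 u_closed w0c
    by (subst ind_mult_vec_index) (auto simp: char_ext_rep intro!: sum.cong)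
  also have "\<dots> = w0 $ i" using i by (simp add: if_distrib[where f = "\<lambda>x. x * _"] cong: if_cong)
  finally have w_i0: "w $ i0 \<noteq> 0" using i by simp
  let ?x = "vsum m J (\<lambda>j. \<Theta> (inv j) \<cdot>\<^sub>v (ind j *\<^sub>v w))"
  have x: "?x \<in> W"
    by (rule vsum_subspace[OF W(1)]) (use Ws inv w J_closed in blast)
  \<comment> \<open>The average of w is a multiple of the generating basis vector, and a nonzero one
    because |J| is invertible in characteristic 0.\<close>
  have "?x = (of_nat (card J) * w $ i0) \<cdot>\<^sub>v unit_vec m i0"
  proof (rule eq_vecI)
    fix k assume "k < dim_vec ((of_nat (card J) * w $ i0) \<cdot>\<^sub>v unit_vec m i0)"
    then have k: "k < m" by simp
    have "?x $ k = (\<Sum>j\<in>J. \<Theta> (inv j) * (\<Sum>l<m. char_ext (inv (u k) \<otimes> j \<otimes> u l) * w $ l))"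
    proof -
      have "(\<Theta> (inv j) \<cdot>\<^sub>v (ind j *\<^sub>v w)) $ k = \<Theta> (inv j) * (\<Sum>l<m. char_ext (inv (u k) \<otimes> j \<otimes> u l) * w $ l)"
        if "j \<in> J" for j
        using carrier_vecD[OF mat_rep_vec_carrier[OF mat_rep_ind J_closed[OF that] wc]] k
          ind_mult_vec_index[OF J_closed[OF that] k wc]
        by (simp del: index_mult_mat_vec dim_mult_mat_vec)
      then show ?thesis using k by simp
    qed
    also have "\<dots> = (\<Sum>l<m. (\<Sum>j\<in>J. \<Theta> (inv j) * char_ext (inv (u k) \<otimes> j \<otimes> u l)) * w $ l)"
      unfolding sum_distrib_left sum_distrib_right by (subst sum.swap) (simp add: mult.assoc)
    also have "\<dots> = (\<Sum>l<m. (if l = i0 then (if k = i0 then of_nat (card J) else 0) * w $ l else 0))"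
      using k by (intro sum.cong) (auto simp: average_char_ext)
    also have "\<dots> = (if k = i0 then of_nat (card J) else 0) * w $ i0" using i0 by simp
    finally show "?x $ k = ((of_nat (card J) * w $ i0) \<cdot>\<^sub>v unit_vec m i0) $ k"
      using k i0 by simp
  qed simp
  moreover have "card J \<noteq> 0"
    using J_one finite_subset[OF subsetI finite_carrier, of J] J_closed by (auto simp: card_eq_0_iff)
  ultimately have "unit_vec m i0 = inverse (of_nat (card J) * w $ i0) \<cdot>\<^sub>v ?x"
    using w_i0 by (simp add: smult_smult_assoc del: inverse_mult_distrib)
  then have e0: "unit_vec m i0 \<in> W" using x Ws(4) by metis
  have e: "unit_vec m k \<in> W" if "k < m" for k
  proof -
    have "ind (u k \<otimes> \<one>) *\<^sub>v unit_vec m i0 \<in> W" using inv e0 that u_closed by simp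
    then show ?thesis using ind_unit_vec[OF that J_one] char_one by simp
  qed
  have "v \<in> W" if "v \<in> carrier_vec m" for v
  proof -
    have "v = vsum m {..<m} (\<lambda>k. v $ k \<cdot>\<^sub>v unit_vec m k)"
      using that by (intro eq_vecI) (auto simp: if_distrib[where f = "\<lambda>x. _ * x"] cong: if_cong)
    moreover have "\<dots> \<in> W" by (rule vsum_subspace[OF W(1)]) (use e Ws in auto)
    ultimately show ?thesis by metis
  qed
  then show False using W Ws by blast
qed

text \<open>Frobenius reciprocity made explicit: P sends the basis vector k to
  \<open>\<rho> (u k)\<close> applied to v. It intertwines, and it is nonzero because its column i0
  is v, so Schur's lemma applies.\<close>

lemma ind_iso:
  assumes \<rho>: "irred_mat_rep G n \<rho>" and v: "v \<in> carrier_vec n" "v \<noteq> 0\<^sub>v n"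
    and eig: "\<And>j. j \<in> J \<Longrightarrow> \<rho> j *\<^sub>v v = \<Theta> j \<cdot>\<^sub>v v"
  shows "n = m \<and> (\<exists>P\<in>carrier_mat n n. invertible_mat P \<and> (\<forall>g\<in>carrier G. P * ind g = \<rho> g * P))"
proof -
  have r: "mat_rep G n \<rho>" using \<rho> by (simp add: irred_mat_rep_def)
  note rc = mat_rep_vec_carrier[OF r]
  define P where "P = mat n m (\<lambda>(i, k). (\<rho> (u k) *\<^sub>v v) $ i)"
  have P: "P \<in> carrier_mat n m" by (simp add: P_def)
  have colP: "col P k = \<rho> (u k) *\<^sub>v v" if "k < m" for k
    using that carrier_vecD[OF rc[OF u_closed[OF that] v(1)]]
    by (intro eq_vecI) (simp_all add: P_def del: index_mult_mat_vec dim_mult_mat_vec)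
  have comm: "\<rho> g * P = P * ind g" if g: "g \<in> carrier G" for g
  proof (rule eq_matI)
    fix i l assume "i < dim_row (P * ind g)" "l < dim_col (P * ind g)"
    then have il: "i < n" "l < m" using P ind_carrier[OF g] by auto
    let ?f = "\<lambda>k. inv (u k) \<otimes> g \<otimes> u l"
    obtain k0 where k0: "k0 < m" "?f k0 \<in> J" and un: "\<And>k. k < m \<Longrightarrow> ?f k \<in> J \<Longrightarrow> k = k0"
      using transversal_mult[OF g u_closed[OF il(2)]] by blast
    have zero: "char_ext (?f k) = 0" if "k < m" "k \<noteq> k0" for k
      using un[OF that(1)] that(2) by (auto simp: char_ext_def)
    have c: "u k0 \<in> carrier G" "u l \<in> carrier G" using k0 il u_closed by auto
    have "(P * ind g) $$ (i, l) = (\<Sum>k<m. (\<rho> (u k) *\<^sub>v v) $ i * char_ext (?f k))"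
      using P il ind_carrier[OF g] g
      by (auto simp: scalar_prod_def P_def ind_index atLeast0LessThan intro!: sum.cong)
    also have "\<dots> = (\<Sum>k\<in>{k0}. (\<rho> (u k) *\<^sub>v v) $ i * char_ext (?f k))"
      using k0 zero by (intro sum.mono_neutral_right) (auto simp del: mult_eq_0_iff)
    also have "\<dots> = (\<rho> (u k0) *\<^sub>v (\<Theta> (?f k0) \<cdot>\<^sub>v v)) $ i"
      using k0 il rc[OF c(1) v(1)] mat_repD(1)[OF r c(1)] v by (simp add: char_ext_def mult_mat_vec)
    also have "\<dots> = (\<rho> (u k0 \<otimes> ?f k0) *\<^sub>v v) $ i"
      using mat_rep_mult_vec[OF r c(1) J_closed[OF k0(2)] v(1)] eig[OF k0(2)] by simp
    also have "u k0 \<otimes> ?f k0 = g \<otimes> u l" using c g by (simp add: m_assoc[symmetric])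
    also have "\<rho> (g \<otimes> u l) *\<^sub>v v = \<rho> g *\<^sub>v col P l"
      using mat_rep_mult_vec[OF r g c(2) v(1)] il by (simp add: colP)
    finally show "(\<rho> g * P) $$ (i, l) = (P * ind g) $$ (i, l)"
      using il P mat_repD(1)[OF r g] by simp
  qed (use P ind_carrier[OF g] mat_repD(1)[OF r g] in auto)
  have "P \<noteq> 0\<^sub>m n m"
  proof
    assume "P = 0\<^sub>m n m"
    then have "v = 0\<^sub>v n" using colP[of i0] i0 mat_repD(2)[OF r] v by simp
    then show False using v by simp
  qed
  from schur[OF \<rho> irred_mat_rep_ind P this comm] P comm show ?thesis
    by (auto intro!: bexI[of _ P])
qed

end

section \<open>Transversals, and eigenvectors of subgroups\<close>

definition left_transversal ::
    "('g, 'b) monoid_scheme \<Rightarrow> 'g set \<Rightarrow> (nat \<Rightarrow> 'g) \<Rightarrow> nat \<Rightarrow> nat \<Rightarrow> bool" where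
  "left_transversal G J u m i0 \<longleftrightarrow> (\<forall>k<m. u k \<in> carrier G) \<and> i0 < m \<and> u i0 = \<one>\<^bsub>G\<^esub>
    \<and> (\<forall>g\<in>carrier G. \<exists>!k. k < m \<and> inv\<^bsub>G\<^esub> (u k) \<otimes>\<^bsub>G\<^esub> g \<in> J)"

lemma left_transversalD:
  assumes "left_transversal G J u m i0"
  shows "k < m \<Longrightarrow> u k \<in> carrier G" "i0 < m" "u i0 = \<one>\<^bsub>G\<^esub>"
    "g \<in> carrier G \<Longrightarrow> \<exists>!k. k < m \<and> inv\<^bsub>G\<^esub> (u k) \<otimes>\<^bsub>G\<^esub> g \<in> J"
  using assms unfolding left_transversal_def by (simp_all only: Ball_def)

text \<open>Representatives of the right cosets of J are chosen, with 1 for J itself; their inverses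
  represent the left cosets.\<close>

lemma (in group) exists_transversal:
  assumes "finite (carrier G)" "subgroup J G"
  shows "\<exists>(u :: nat \<Rightarrow> 'a) m i0. left_transversal G J u m i0"
proof -
  have fin: "finite (rcosets J)" unfolding RCOSETS_def by (intro finite_UN_I assms(1) finite.intros)
  then obtain f where f: "bij_betw f {0..<card (rcosets J)} (rcosets J)"
    using ex_bij_betw_nat_finite by blast
  let ?m = "card (rcosets J)"
  define r where "r k = (if f k = J then \<one> else (SOME x. x \<in> f k))" for k
  have fk: "f k \<in> rcosets J" if "k < ?m" for k using f that by (auto simp: bij_betw_def)
  have r: "r k \<in> f k" if k: "k < ?m" for k
  proof (cases "f k = J")
    case True
    then show ?thesis using subgroup.one_closed[OF assms(2)] by (simp add: r_def)
  next
    case False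
    obtain a where "a \<in> carrier G" "f k = J #> a" using fk[OF k] unfolding RCOSETS_def by blast
    then have "a \<in> f k" using rcos_self[OF _ assms(2)] by simp
    then show ?thesis using False by (auto simp: r_def intro: someI)
  qed
  have rc: "r k \<in> carrier G" if "k < ?m" for k
    using r[OF that] subgroup.rcosets_carrier[OF assms(2) is_group fk[OF that]] by blast
  have fr: "f k = J #> r k" if k: "k < ?m" for k
  proof -
    obtain a where a: "a \<in> carrier G" "f k = J #> a" using fk[OF k] unfolding RCOSETS_def by blast
    have "r k \<in> J #> a" using r[OF k] unfolding a(2) .
    from repr_independence[OF this a(1) assms(2)] show ?thesis unfolding a(2) .
  qed
  have "J \<in> rcosets J" using subgroup.subgroup_in_rcosets[OF assms(2) is_group] .
  then have "J \<in> f ` {0..<?m}" unfolding bij_betw_imp_surj_on[OF f] .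
  then obtain i0 where i0: "i0 < ?m" "f i0 = J" by (auto simp: image_iff)
  show ?thesis
    unfolding left_transversal_def
  proof (rule exI[of _ "\<lambda>k. inv (r k)"], rule exI[of _ ?m], rule exI[of _ i0],
      intro conjI allI impI ballI)
    show "inv (r k) \<in> carrier G" if "k < ?m" for k using rc[OF that] by simp
    show "i0 < ?m" by fact
    show "inv (r i0) = \<one>" using i0 by (simp add: r_def)
    fix g assume g: "g \<in> carrier G"
    have iff: "inv (inv (r k)) \<otimes> g \<in> J \<longleftrightarrow> f k = J #> inv g" if k: "k < ?m" for k
    proof -
      have "r k \<otimes> g \<in> J \<longleftrightarrow> r k \<in> J #> inv g"
        using subgroup.rcos_module[OF assms(2) is_group, of "inv g" "r k"] g rc[OF k] by simp
      also have "\<dots> \<longleftrightarrow> f k = J #> inv g"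
    proof
      assume "r k \<in> J #> inv g"
      from repr_independence[OF this inv_closed[OF g] assms(2)] show "f k = J #> inv g"
        unfolding fr[OF k] by (rule sym)
    next
      assume "f k = J #> inv g"
      with r[OF k] show "r k \<in> J #> inv g" by (rule back_subst[of "(\<in>) (r k)"])
    qed
      finally show ?thesis using rc[OF k] by simp
    qed
    have "J #> inv g \<in> rcosets J" using g unfolding RCOSETS_def by blast
    then have "J #> inv g \<in> f ` {0..<?m}" unfolding bij_betw_imp_surj_on[OF f] .
    then obtain k where k: "k < ?m" "f k = J #> inv g" by (auto simp: image_iff)
    show "\<exists>!k. k < ?m \<and> inv (inv (r k)) \<otimes> g \<in> J"
    proof (rule ex1I[of _ k])
      show "k < ?m \<and> inv (inv (r k)) \<otimes> g \<in> J" using k iff by blast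
      fix l assume l: "l < ?m \<and> inv (inv (r l)) \<otimes> g \<in> J"
      then have "f l = f k" using iff[of l] k by simp
      then show "l = k" using inj_onD[OF bij_betw_imp_inj_on[OF f], of l k] l k by simp
    qed
  qed
qed

lemma (in group) exists_eigencharacter:
  fixes \<rho> :: "'a \<Rightarrow> 'k::field mat"
  assumes \<rho>: "mat_rep G n \<rho>" and B: "subgroup B G" and v: "v \<in> carrier_vec n" "v \<noteq> 0\<^sub>v n"
    and eig: "\<And>g. g \<in> B \<Longrightarrow> \<exists>r. \<rho> g *\<^sub>v v = r \<cdot>\<^sub>v v"
  shows "\<exists>\<Theta>. (\<forall>g\<in>B. \<rho> g *\<^sub>v v = \<Theta> g \<cdot>\<^sub>v v) \<and> (\<forall>x\<in>B. \<forall>y\<in>B. \<Theta> (x \<otimes> y) = \<Theta> x * \<Theta> y)"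
proof -
  obtain \<Theta> where \<Theta>: "\<And>g. g \<in> B \<Longrightarrow> \<rho> g *\<^sub>v v = \<Theta> g \<cdot>\<^sub>v v" using eig by metis
  have "\<Theta> (x \<otimes> y) = \<Theta> x * \<Theta> y" if xy: "x \<in> B" "y \<in> B" for x y
  proof -
    have c: "x \<in> carrier G" "y \<in> carrier G" using xy subgroup.mem_carrier[OF B] by auto
    have "\<Theta> (x \<otimes> y) \<cdot>\<^sub>v v = \<rho> x *\<^sub>v (\<rho> y *\<^sub>v v)"
      using \<Theta>[OF subgroup.m_closed[OF B xy]] mat_rep_mult_vec[OF \<rho> c v(1)] by simp
    also have "\<dots> = \<Theta> y \<cdot>\<^sub>v (\<Theta> x \<cdot>\<^sub>v v)"
      using \<Theta> xy mult_mat_vec[OF mat_repD(1)[OF \<rho> c(1)] v(1)] by simp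
    also have "\<dots> = (\<Theta> x * \<Theta> y) \<cdot>\<^sub>v v" by (simp add: smult_smult_assoc mult.commute)
    finally show ?thesis using smult_vec_cancel[OF v] by blast
  qed
  with \<Theta> show ?thesis by blast
qed

text \<open>If the projections of all the translates \<open>\<rho> (u x) v\<close> onto the \<open>\<theta>\<close>-eigenspace of \<open>A\<close> were
  zero, translating them back and summing over \<open>x\<close> would leave a nonzero multiple of \<open>v\<close>.\<close>

lemma (in group) exists_translated_eigenvector:
  fixes \<rho> :: "'a \<Rightarrow> 'k::field_char_0 mat" and u :: "'x \<Rightarrow> 'a"
  assumes fin: "finite (carrier G)" and \<rho>: "mat_rep G n \<rho>"
    and A: "subgroup A G" and B: "B \<subseteq> A" "B \<noteq> {}"
    and \<theta>: "\<And>x y. x \<in> A \<Longrightarrow> y \<in> A \<Longrightarrow> \<theta> (x \<otimes> y) = \<theta> x * \<theta> y" "\<theta> \<one> = 1"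
    and v: "v \<in> carrier_vec n" "v \<noteq> 0\<^sub>v n" and eig: "\<And>j. j \<in> B \<Longrightarrow> \<rho> j *\<^sub>v v = \<theta> j \<cdot>\<^sub>v v"
    and u: "\<And>x. u x \<in> carrier G"
    and comm: "\<And>x j. j \<in> A \<Longrightarrow> \<rho> j *\<^sub>v (\<rho> (u x) *\<^sub>v v) = f x j \<cdot>\<^sub>v (\<rho> (u x) *\<^sub>v (\<rho> j *\<^sub>v v))"
    and f: "\<And>j. j \<in> A \<Longrightarrow> j \<notin> B \<Longrightarrow> (\<Sum>x\<in>X. f x j) = 0" "\<And>j. j \<in> B \<Longrightarrow> (\<Sum>x\<in>X. f x j) = c" "c \<noteq> 0"
  shows "\<exists>w\<in>carrier_vec n. w \<noteq> 0\<^sub>v n \<and> (\<forall>j\<in>A. \<rho> j *\<^sub>v w = \<theta> j \<cdot>\<^sub>v w)"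
proof -
  have Ac: "j \<in> carrier G" if "j \<in> A" for j using that subgroup.mem_carrier[OF A] by blast
  have finA: "finite A" using finite_subset[OF subgroup.subset[OF A] fin] .
  note closed = mat_rep_vec_carrier[OF \<rho>]
  have \<theta>inv: "\<theta> (inv j) * \<theta> j = 1" if "j \<in> A" for j
    using \<theta>(1)[OF subgroup.m_inv_closed[OF A that] that] \<theta>(2) Ac[OF that] by simp
  define E where "E x = vsum n A (\<lambda>j. \<theta> (inv j) \<cdot>\<^sub>v (\<rho> j *\<^sub>v (\<rho> (u x) *\<^sub>v v)))" for x
  have eigen: "\<rho> i *\<^sub>v E x = \<theta> i \<cdot>\<^sub>v E x" if i: "i \<in> A" for i x
  proof -
    let ?w = "\<rho> (u x) *\<^sub>v v"
    have w: "?w \<in> carrier_vec n" using closed u v by blast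
    have "\<rho> i *\<^sub>v E x = vsum n A (\<lambda>j. \<rho> i *\<^sub>v (\<theta> (inv j) \<cdot>\<^sub>v (\<rho> j *\<^sub>v ?w)))"
      unfolding E_def by (rule mult_mat_vsum[OF mat_repD(1)[OF \<rho> Ac[OF i]]]) (use closed Ac w in auto)
    also have "\<dots> = vsum n A (\<lambda>j. \<theta> i \<cdot>\<^sub>v (\<theta> (inv (i \<otimes> j)) \<cdot>\<^sub>v (\<rho> (i \<otimes> j) *\<^sub>v ?w)))"
    proof (rule vsum_cong)
      fix j assume j: "j \<in> A"
      have "\<theta> i * \<theta> (inv (i \<otimes> j)) = \<theta> (inv j)"
        using \<theta>inv[OF i] \<theta>(1)[OF subgroup.m_inv_closed[OF A j] subgroup.m_inv_closed[OF A i]] Ac i j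
        by (simp add: inv_mult_group mult.commute mult.left_commute)
      moreover have "\<rho> i *\<^sub>v (\<theta> (inv j) \<cdot>\<^sub>v (\<rho> j *\<^sub>v ?w)) = \<theta> (inv j) \<cdot>\<^sub>v (\<rho> (i \<otimes> j) *\<^sub>v ?w)"
        using mult_mat_vec[OF mat_repD(1)[OF \<rho> Ac[OF i]] closed[OF Ac[OF j] w]]
          mat_rep_mult_vec[OF \<rho> Ac[OF i] Ac[OF j] w] by simp
      ultimately show "\<rho> i *\<^sub>v (\<theta> (inv j) \<cdot>\<^sub>v (\<rho> j *\<^sub>v ?w)) =
          \<theta> i \<cdot>\<^sub>v (\<theta> (inv (i \<otimes> j)) \<cdot>\<^sub>v (\<rho> (i \<otimes> j) *\<^sub>v ?w))"
        by (simp add: smult_smult_assoc)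
    qed
    also have "\<dots> = vsum n A (\<lambda>j. \<theta> i \<cdot>\<^sub>v (\<theta> (inv j) \<cdot>\<^sub>v (\<rho> j *\<^sub>v ?w)))"
    proof (rule vsum_reindex_bij[symmetric])
      show "bij_betw (\<lambda>j. i \<otimes> j) A A"
        by (rule bij_betw_byWitness[where f' = "\<lambda>j. inv i \<otimes> j"])
          (use i Ac subgroup.m_closed[OF A] subgroup.m_inv_closed[OF A] in \<open>auto simp flip: m_assoc\<close>)
    qed
    also have "\<dots> = \<theta> i \<cdot>\<^sub>v E x"
      unfolding E_def by (rule smult_vsum[symmetric]) (use closed Ac w in auto)
    finally show ?thesis .
  qed
  have Ec: "E x \<in> carrier_vec n" for x by (simp add: E_def)
  have "\<exists>x. E x \<noteq> 0\<^sub>v n"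
  proof (rule ccontr)
    assume "\<not> (\<exists>x. E x \<noteq> 0\<^sub>v n)"
    then have E0: "E x = 0\<^sub>v n" for x by blast
    define z where "z x = vsum n A (\<lambda>j. (\<theta> (inv j) * f x j) \<cdot>\<^sub>v (\<rho> j *\<^sub>v v))" for x
    have z0: "z x = 0\<^sub>v n" for x
    proof (rule mat_rep_inj[OF is_group \<rho> u])
      show "z x \<in> carrier_vec n" by (simp add: z_def)
      have "\<rho> (u x) *\<^sub>v z x = vsum n A (\<lambda>j. \<rho> (u x) *\<^sub>v ((\<theta> (inv j) * f x j) \<cdot>\<^sub>v (\<rho> j *\<^sub>v v)))"
        unfolding z_def by (rule mult_mat_vsum[OF mat_repD(1)[OF \<rho> u]]) (use closed Ac v in auto)
      also have "\<dots> = E x"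
        unfolding E_def
      proof (rule vsum_cong)
        fix j assume j: "j \<in> A"
        show "\<rho> (u x) *\<^sub>v ((\<theta> (inv j) * f x j) \<cdot>\<^sub>v (\<rho> j *\<^sub>v v)) =
            \<theta> (inv j) \<cdot>\<^sub>v (\<rho> j *\<^sub>v (\<rho> (u x) *\<^sub>v v))"
          using mult_mat_vec[OF mat_repD(1)[OF \<rho> u] closed[OF Ac[OF j] v(1)]] comm[OF j]
          by (simp add: smult_smult_assoc)
      qed
      finally show "\<rho> (u x) *\<^sub>v z x = 0\<^sub>v n" by (simp add: E0)
    qed
    have "0\<^sub>v n = vsum n X z" by (intro eq_vecI) (simp_all add: z0)
    also have "\<dots> = vsum n A (\<lambda>j. vsum n X (\<lambda>x. (\<theta> (inv j) * f x j) \<cdot>\<^sub>v (\<rho> j *\<^sub>v v)))"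
      unfolding z_def by (rule vsum_swap)
    also have "\<dots> = vsum n A (\<lambda>j. (\<theta> (inv j) * (\<Sum>x\<in>X. f x j)) \<cdot>\<^sub>v (\<rho> j *\<^sub>v v))"
      using closed Ac v by (intro vsum_cong) (simp add: vsum_smult_const sum_distrib_left)
    also have "\<dots> = vsum n B (\<lambda>j. (\<theta> (inv j) * (\<Sum>x\<in>X. f x j)) \<cdot>\<^sub>v (\<rho> j *\<^sub>v v))"
    proof (rule vsum_subset[OF finA B(1)])
      fix j assume "j \<in> A - B"
      then show "(\<theta> (inv j) * (\<Sum>x\<in>X. f x j)) \<cdot>\<^sub>v (\<rho> j *\<^sub>v v) = 0\<^sub>v n"
        using f(1)[of j] carrier_vecD[OF closed[OF Ac v(1)], of j] by (intro eq_vecI) auto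
    qed
    also have "\<dots> = vsum n B (\<lambda>j. c \<cdot>\<^sub>v v)"
    proof (rule vsum_cong)
      fix j assume j: "j \<in> B"
      then have "\<theta> (inv j) * \<theta> j = 1" using \<theta>inv B by blast
      then show "(\<theta> (inv j) * (\<Sum>x\<in>X. f x j)) \<cdot>\<^sub>v (\<rho> j *\<^sub>v v) = c \<cdot>\<^sub>v v"
        using eig[OF j] f(2)[OF j] by (simp add: smult_smult_assoc mult.commute mult.left_commute)
    qed
    also have "\<dots> = (of_nat (card B) * c) \<cdot>\<^sub>v v" using v by (simp add: vsum_smult_const)
    finally have "(of_nat (card B) * c) \<cdot>\<^sub>v v = 0 \<cdot>\<^sub>v v" using v(1) by (intro eq_vecI) (auto simp: vec_eq_iff)
    then have "of_nat (card B) * c = 0" using smult_vec_cancel[OF v] by blast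
    moreover have "card B \<noteq> 0" using B finite_subset[OF B(1) finA] by (simp add: card_eq_0_iff)
    ultimately show False using f(3) by simp
  qed
  then show ?thesis using eigen Ec by blast
qed

lemma (in induced_rep) ind_central:
  assumes z: "z \<in> J" and central: "\<And>x. x \<in> carrier G \<Longrightarrow> x \<otimes> z = z \<otimes> x"
  shows "ind z = \<Theta> z \<cdot>\<^sub>m 1\<^sub>m m"
proof (rule eq_matI)
  fix i k assume "i < dim_row (\<Theta> z \<cdot>\<^sub>m 1\<^sub>m m)" "k < dim_col (\<Theta> z \<cdot>\<^sub>m 1\<^sub>m m)"
  then have ik: "i < m" "k < m" by auto
  have c: "u i \<in> carrier G" "u k \<in> carrier G" "z \<in> carrier G" using ik u_closed z J_closed by auto
  have "inv (u i) \<otimes> z \<otimes> u k = inv (u i) \<otimes> u k \<otimes> z"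
    using c central[OF c(2)] by (simp add: m_assoc)
  then show "ind z $$ (i, k) = (\<Theta> z \<cdot>\<^sub>m 1\<^sub>m m) $$ (i, k)"
    using ik c z by (simp add: ind_index char_ext_mult char_ext_rep)
qed (use ind_carrier[OF J_closed[OF z]] in auto)

lemma rep_iso_equiv:
  assumes R: "\<And>n \<rho> g. (n, \<rho>) \<in> R \<Longrightarrow> g \<in> trunc_carrier M \<Longrightarrow> \<rho> g \<in> carrier_mat n n"
  shows "equiv R {(r, s). r \<in> R \<and> s \<in> R \<and> rep_iso M r s}"
proof (rule equivI)
  show "{(r, s). r \<in> R \<and> s \<in> R \<and> rep_iso M r s} \<subseteq> R \<times> R" by auto
  show "refl_on R {(r, s). r \<in> R \<and> s \<in> R \<and> rep_iso M r s}"
  proof (rule refl_onI)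
    fix r assume r: "r \<in> R"
    have "rep_iso M r r"
      unfolding rep_iso_def
    proof (intro conjI bexI[of _ "1\<^sub>m (fst r)"] ballI refl)
      show "invertible_mat (1\<^sub>m (fst r))"
        by (rule invertible_matI[of _ "fst r" "1\<^sub>m (fst r)"]) auto
      show "1\<^sub>m (fst r) * snd r g = snd r g * 1\<^sub>m (fst r)" if "g \<in> trunc_carrier M" for g
        using R[of "fst r" "snd r" g] r that by simp
    qed simp
    then show "(r, r) \<in> {(r, s). r \<in> R \<and> s \<in> R \<and> rep_iso M r s}" using r by simp
  qed
  show "sym {(r, s). r \<in> R \<and> s \<in> R \<and> rep_iso M r s}"
  proof (rule symI)
    fix x y assume xy: "(x, y) \<in> {(r, s). r \<in> R \<and> s \<in> R \<and> rep_iso M r s}"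
    obtain n \<rho> n' \<sigma> where x: "x = (n, \<rho>)" and y: "y = (n', \<sigma>)" by (cases x, cases y)
    have r: "(n, \<rho>) \<in> R" and s: "(n', \<sigma>) \<in> R" and "rep_iso M (n, \<rho>) (n', \<sigma>)"
      using xy by (auto simp: x y)
    then obtain P where P: "n' = n" "P \<in> carrier_mat n n" "invertible_mat P"
      "\<And>g. g \<in> trunc_carrier M \<Longrightarrow> P * \<rho> g = \<sigma> g * P"
      unfolding rep_iso_def fst_conv snd_conv by blast
    obtain Q where Qc: "Q \<in> carrier_mat n n" and Q: "P * Q = 1\<^sub>m n" "Q * P = 1\<^sub>m n"
      using invertible_mat_inverse[OF P(3,2)] .
    have "Q * \<sigma> g = \<rho> g * Q" if g: "g \<in> trunc_carrier M" for g
    proof -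
      have c: "\<rho> g \<in> carrier_mat n n" "\<sigma> g \<in> carrier_mat n n" using R r s g P(1) by auto
      have "Q * \<sigma> g = Q * (\<sigma> g * (P * Q))" using c Q by simp
      also have "\<dots> = Q * (\<sigma> g * P * Q)" using c Qc P(2) by (simp add: assoc_mult_mat[of _ n n _ n _ n])
      also have "\<dots> = Q * (P * \<rho> g * Q)" by (simp only: P(4)[OF g])
      also have "\<dots> = (Q * P) * (\<rho> g * Q)" using c Qc P(2) by (simp add: assoc_mult_mat[of _ n n _ n _ n])
      also have "\<dots> = \<rho> g * Q" using c Qc Q by simp
      finally show ?thesis .
    qed
    moreover have "invertible_mat Q"
      by (rule invertible_matI[OF Qc P(2) Q(2,1)])
    ultimately have "rep_iso M (n', \<sigma>) (n, \<rho>)" using P(1) Qc by (auto simp: rep_iso_def)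
    then show "(y, x) \<in> {(r, s). r \<in> R \<and> s \<in> R \<and> rep_iso M r s}" using r s by (simp add: x y)
  qed
  show "trans {(r, s). r \<in> R \<and> s \<in> R \<and> rep_iso M r s}"
  proof (rule transI)
    fix x y z assume xyz: "(x, y) \<in> {(r, s). r \<in> R \<and> s \<in> R \<and> rep_iso M r s}"
      "(y, z) \<in> {(r, s). r \<in> R \<and> s \<in> R \<and> rep_iso M r s}"
    obtain n \<rho> n' \<sigma> n'' \<tau> where x: "x = (n, \<rho>)" and y: "y = (n', \<sigma>)" and z: "z = (n'', \<tau>)"
      by (cases x, cases y, cases z)
    have r: "(n, \<rho>) \<in> R" "(n', \<sigma>) \<in> R" "(n'', \<tau>) \<in> R"
      and i: "rep_iso M (n, \<rho>) (n', \<sigma>)" "rep_iso M (n', \<sigma>) (n'', \<tau>)"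
      using xyz by (simp_all add: x y z)
    have n: "n' = n" "n'' = n" using i by (simp_all add: rep_iso_def)
    obtain P where P: "P \<in> carrier_mat n n" "invertible_mat P"
      "\<And>g. g \<in> trunc_carrier M \<Longrightarrow> P * \<rho> g = \<sigma> g * P"
      using i(1) unfolding rep_iso_def fst_conv snd_conv by blast
    obtain P' where P': "P' \<in> carrier_mat n n" "invertible_mat P'"
      "\<And>g. g \<in> trunc_carrier M \<Longrightarrow> P' * \<sigma> g = \<tau> g * P'"
      using i(2) unfolding rep_iso_def fst_conv snd_conv n by blast
    have "(P' * P) * \<rho> g = \<tau> g * (P' * P)" if g: "g \<in> trunc_carrier M" for g
    proof -
      have c: "\<rho> g \<in> carrier_mat n n" "\<sigma> g \<in> carrier_mat n n" "\<tau> g \<in> carrier_mat n n"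
        using R r g n by auto
      have "(P' * P) * \<rho> g = P' * (P * \<rho> g)" using c P(1) P'(1) by (simp add: assoc_mult_mat[of _ n n _ n _ n])
      also have "\<dots> = (P' * \<sigma> g) * P" unfolding P(3)[OF g] using c P(1) P'(1) by (simp add: assoc_mult_mat[of _ n n _ n _ n])
      also have "\<dots> = \<tau> g * (P' * P)" unfolding P'(3)[OF g] using c P(1) P'(1) by (simp add: assoc_mult_mat[of _ n n _ n _ n])
      finally show ?thesis .
    qed
    moreover have "invertible_mat (P' * P)" using invertible_mat_mult[OF P'(2,1) P(2,1)] .
    ultimately have "rep_iso M (n, \<rho>) (n'', \<tau>)"
      unfolding rep_iso_def fst_conv snd_conv n using mult_carrier_mat[OF P'(1) P(1)] by blast
    then show "(x, z) \<in> {(r, s). r \<in> R \<and> s \<in> R \<and> rep_iso M r s}" using r by (simp add: x z)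
  qed
qed

section \<open>The unipotent group\<close>

text \<open>The library version is restricted to the class \<^class>\<open>finite_field\<close>, of which a type of sort
  \<open>{field, finite}\<close> is not automatically an instance.\<close>

lemma finite_field_power_card:
  fixes x :: "'a::{field, finite}"
  shows "x ^ card (UNIV :: 'a set) = x"
proof (cases "x = 0")
  case False
  have "bij_betw ((*) x) (UNIV - {0}) (UNIV - {0})"
    by (rule bij_betw_byWitness[where f' = "\<lambda>y. y / x"]) (use False in auto)
  then have "\<Prod>(UNIV - {0}) = (\<Prod>y\<in>UNIV - {0}. x * y)"
    by (rule prod.reindex_bij_betw[symmetric])
  also have "\<dots> = x ^ (card (UNIV :: 'a set) - 1) * \<Prod>(UNIV - {0})"
    by (simp add: prod.distrib card_Diff_singleton)
  finally have "x ^ (card (UNIV :: 'a set) - 1) = 1" by simp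
  then have "x ^ Suc (card (UNIV :: 'a set) - 1) = x" by simp
  moreover have "card (UNIV :: 'a set) > 0" by (simp add: card_gt_0_iff)
  ultimately show ?thesis by (simp only: Suc_pred' flip: Suc_pred')
qed (simp add: card_gt_0_iff)

locale conductor_character =
  fixes p q e h :: nat and \<psi> :: "'a::{field, finite} \<Rightarrow> 'k::field_char_0"
  assumes p: "prime p" and e: "0 < e" and q: "q = p ^ e"
    and card_field: "card (UNIV :: 'a set) = q ^ 2"
    and h: "h \<ge> 2"
    and \<psi>: "additive_character \<psi>"
    and conductor: "has_conductor_q2 q \<psi>"
begin

section \<open>The field with q^2 elements and its commutator form\<close>

lemma q_pos: "q > 1"
  using p e unfolding q by (metis One_nat_def prime_gt_1_nat one_less_power)

lemma CHAR_eq: "CHAR('a) = p"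
proof -
  have "prime CHAR('a)"
    using prime_CHAR_semidom finite_imp_CHAR_pos[where ?'a = 'a] by auto
  moreover have "CHAR('a) dvd p ^ (e * 2)"
    using CHAR_dvd_CARD[where ?'a = 'a] card_field by (simp add: q power_mult)
  ultimately show ?thesis using p by (metis prime_dvd_power primes_dvd_imp_eq)
qed

lemma frob_add: "(x + y :: 'a) ^ q = x ^ q + y ^ q"
  using freshmans_dream'[where ?'a = 'a, of q e x y] p by (simp add: CHAR_eq q)

lemma frob_minus: "(- x :: 'a) ^ q = - (x ^ q)"
  using frob_add[of x "- x"] q_pos by (simp add: zero_power eq_neg_iff_add_eq_0 add.commute)

lemma frob_diff: "(x - y :: 'a) ^ q = x ^ q - y ^ q"
  using frob_add[of x "- y"] by (simp add: frob_minus)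

lemma frob_frob: "((x :: 'a) ^ q) ^ q = x"
  using finite_field_power_card[of x] by (simp add: card_field power2_eq_square power_mult)

lemma frob_power: "(x :: 'a) ^ (q ^ i) = (if even i then x else x ^ q)"
  by (induction i) (auto simp: power_mult frob_frob mult.commute[of q])

lemma frob_sum: "(\<Sum>i\<in>I. f i :: 'a) ^ q = (\<Sum>i\<in>I. f i ^ q)"
  using q_pos by (induction I rule: infinite_finite_induct) (auto simp: frob_add)

lemma \<psi>_add: "\<psi> (x + y) = \<psi> x * \<psi> y" and \<psi>_nz: "\<psi> x \<noteq> 0"
  using \<psi> by (auto simp: additive_character_def)

lemma \<psi>_0: "\<psi> 0 = 1"
  using \<psi>_add[of 0 0] \<psi>_nz[of 0] by simp

lemma \<psi>_uminus: "\<psi> (- x) = inverse (\<psi> x)"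
  using \<psi>_add[of x "- x"] \<psi>_0 by (metis inverse_unique add.right_inverse)

lemma \<psi>_diff: "\<psi> (x - y) = \<psi> x / \<psi> y"
  using \<psi>_add[of x "- y"] by (simp add: \<psi>_uminus divide_inverse)

text \<open>Shifting the summation variable by \<open>x0\<close> multiplies the sum by
  \<open>\<psi> (f x0)\<close>, which is not 1.\<close>

lemma sum_\<psi>_eq_0:
  assumes add: "\<And>x y :: 'a. f (x + y) = f x + f y" and nontriv: "\<psi> (f x0) \<noteq> 1"
  shows "(\<Sum>x\<in>UNIV. \<psi> (f x)) = 0"
proof -
  have "bij_betw (\<lambda>x. x + x0) UNIV (UNIV :: 'a set)"
    by (rule bij_betw_byWitness[where f' = "\<lambda>x. x - x0"]) auto
  then have "(\<Sum>x\<in>UNIV. \<psi> (f x)) = (\<Sum>x\<in>UNIV. \<psi> (f (x + x0)))"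
    by (rule sum.reindex_bij_betw[symmetric])
  also have "\<dots> = (\<Sum>x\<in>UNIV. \<psi> (f x)) * \<psi> (f x0)"
    by (simp add: add \<psi>_add sum_distrib_right)
  finally show ?thesis using nontriv by simp
qed

text \<open>The coefficient of the commutator of x tau^i and y tau^j for odd i and j. It is an
  alternating form, bilinear over the fixed field of the q-power map, with values z satisfying z^q =
  -z.\<close>

definition herm :: "'a \<Rightarrow> 'a \<Rightarrow> 'a" where
  "herm x y = x * y ^ q - y * x ^ q"

lemma herm_add: "herm (x + x') y = herm x y + herm x' y" "herm x (y + y') = herm x y + herm x y'"
  by (simp_all add: herm_def frob_add algebra_simps)

lemma herm_swap: "herm y x = - herm x y"
  by (simp add: herm_def)

lemma herm_0: "herm 0 y = 0" "herm x 0 = 0"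
  using q_pos by (simp_all add: herm_def)

lemma herm_fixed: "x ^ q = x \<Longrightarrow> y ^ q = y \<Longrightarrow> herm x y = 0"
  by (simp add: herm_def)

text \<open>Every y^q - y has the form \<open>herm x a\<close>, with a = y / x^q, and the conductor
  condition supplies a y with \<open>\<psi> (y ^ q - y)\<close> different from 1.\<close>

lemma herm_nondeg:
  assumes "x \<noteq> 0"
  shows "\<exists>a. \<psi> (herm x a) \<noteq> 1"
proof -
  obtain y where y: "\<psi> (y ^ q) \<noteq> \<psi> y" using conductor by (auto simp: has_conductor_q2_def)
  have "herm x (y / x ^ q) = y ^ q - y"
    using assms by (simp add: herm_def power_divide frob_frob)
  then have "\<psi> (herm x (y / x ^ q)) \<noteq> 1" using y \<psi>_nz[of y] by (simp add: \<psi>_diff)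
  then show ?thesis by blast
qed

text \<open>The fixed field contains its orthogonal complement. For fixed a, \<open>herm x a\<close>
  is (x - x^q) a; both x - x^q and y^q - y change sign under the q-power map, so their quotient is
  fixed and serves as a.\<close>

lemma herm_nondeg_fixed:
  assumes "x ^ q \<noteq> x"
  shows "\<exists>a. a ^ q = a \<and> \<psi> (herm x a) \<noteq> 1"
proof -
  obtain y where y: "\<psi> (y ^ q) \<noteq> \<psi> y" using conductor by (auto simp: has_conductor_q2_def)
  define d where "d = x - x ^ q"
  have d: "d \<noteq> 0" "d ^ q = - d" using assms by (auto simp: d_def frob_diff frob_frob)
  define a where "a = (y ^ q - y) / d"
  have a: "a ^ q = a" using d(1) by (simp add: a_def power_divide frob_diff frob_frob d(2) divide_simps)
  have "herm x a = d * a" by (simp add: herm_def a d_def algebra_simps)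
  also have "\<dots> = y ^ q - y" using d by (simp add: a_def)
  finally have "\<psi> (herm x a) \<noteq> 1" using y \<psi>_nz[of y] by (simp add: \<psi>_diff)
  with a show ?thesis by blast
qed

text \<open>Kernel and image of the additive map x^q - x consist of roots of X^q - X and X^q + X, so
  each has at most q elements, while their cardinalities multiply to q^2.\<close>

lemma card_fixed_field: "card {x::'a. x ^ q = x} = q"
proof (rule antisym)
  let ?K = "{x::'a. x ^ q = x}" and ?f = "\<lambda>x::'a. x ^ q - x"
  let ?P = "\<lambda>c. Polynomial.monom 1 q + [:0, c:] :: 'a poly"
  have P: "?P c \<noteq> 0" "degree (?P c) = q" for c
  proof -
    have "degree [:0, c:] \<le> 1" by (simp add: degree_pCons_eq_if)
    then have "degree [:0, c:] < degree (Polynomial.monom 1 q :: 'a poly)" using q_pos by (simp add: degree_monom_eq)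
    then have "degree (?P c) = degree (Polynomial.monom 1 q :: 'a poly)" by (rule degree_add_eq_left)
    then show "degree (?P c) = q" by (simp add: degree_monom_eq)
    then show "?P c \<noteq> 0" using q_pos by auto
  qed
  have roots: "card {x. x ^ q + c * x = 0} \<le> q" for c :: 'a
    using card_poly_roots_bound[OF P(1)[of c]] P(2)[of c] by (simp add: poly_monom mult.commute)
  show K: "card ?K \<le> q" using roots[of "-1"] by simp
  have "?f ` UNIV \<subseteq> {y. y ^ q + 1 * y = 0}" by (auto simp: frob_diff frob_frob)
  then have im: "card (?f ` UNIV) \<le> q" using roots[of 1] card_mono[OF finite] le_trans by blast
  have fib: "card {x. ?f x = ?f x0} = card ?K" for x0
  proof -
    have "bij_betw (\<lambda>x. x + x0) ?K {x. ?f x = ?f x0}"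
      by (rule bij_betw_byWitness[where f' = "\<lambda>x. x - x0"]) (auto simp: frob_add frob_diff algebra_simps)
    from bij_betw_same_card[OF this] show ?thesis by (rule sym)
  qed
  have "q ^ 2 = (\<Sum>y\<in>?f ` UNIV. card {x \<in> UNIV. ?f x = y})"
    using sum.image_gen[of "UNIV :: 'a set" "\<lambda>_. 1::nat" ?f] card_field by simp
  also have "\<dots> = (\<Sum>y\<in>?f ` UNIV. card ?K)"
  proof (rule sum.cong)
    fix y assume "y \<in> ?f ` UNIV"
    then obtain x0 where "y = ?f x0" by blast
    then show "card {x \<in> UNIV. ?f x = y} = card ?K" using fib[of x0] by simp
  qed simp
  also have "\<dots> = card (?f ` UNIV) * card ?K" by simp
  also have "\<dots> \<le> q * card ?K" using im by simp
  finally show "q \<le> card ?K" using q_pos by (simp add: power2_eq_square)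
qed

section \<open>The group U\<close>

definition N :: nat where "N = 2 * (h - 1)"

definition U :: "(nat \<Rightarrow> 'a) monoid" where
  "U = \<lparr>carrier = trunc_carrier N, monoid.mult = U_mul q N, one = (\<lambda>_. 0)\<rparr>"

abbreviation umul (infixl "\<star>" 70) where "a \<star> b \<equiv> a \<otimes>\<^bsub>U\<^esub> b"

lemma U_simps: "carrier U = trunc_carrier N" "monoid.mult U = U_mul q N" "one U = (\<lambda>_. 0)"
  by (simp_all add: U_def)

lemma trunc_carrier_iff: "a \<in> trunc_carrier M \<longleftrightarrow> a 0 = 0 \<and> (\<forall>i>M. a i = 0)"
  by (auto simp: trunc_carrier_def)

lemma finite_trunc_carrier: "finite (trunc_carrier M :: (nat \<Rightarrow> 'a) set)"
proof (rule finite_subset)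
  show "trunc_carrier M \<subseteq> {f. \<forall>x. (x \<in> {..M} \<longrightarrow> f x \<in> (UNIV :: 'a set)) \<and> (x \<notin> {..M} \<longrightarrow> f x = 0)}"
    by (auto simp: trunc_carrier_iff)
  show "finite {f. \<forall>x. (x \<in> {..M} \<longrightarrow> f x \<in> (UNIV :: 'a set)) \<and> (x \<notin> {..M} \<longrightarrow> f x = 0)}"
    by (rule finite_set_of_finite_funs) auto
qed

lemma umul_closed: "a \<in> trunc_carrier N \<Longrightarrow> b \<in> trunc_carrier N \<Longrightarrow> a \<star> b \<in> trunc_carrier N"
  by (auto simp: U_simps U_mul_def trunc_carrier_iff)

lemma umul_coeff: "1 \<le> k \<Longrightarrow> k \<le> N \<Longrightarrow>
    (a \<star> b) k = a k + b k + (\<Sum>i\<in>{1..<k}. a i * b (k - i) ^ (q ^ i))"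
  by (simp add: U_simps U_mul_def)

lemma umul_assoc:
  assumes "a \<in> trunc_carrier N" "b \<in> trunc_carrier N" "c \<in> trunc_carrier N"
  shows "a \<star> b \<star> c = a \<star> (b \<star> c)"
proof -
  \<comment> \<open>Restoring the constant coefficient 1 turns the product into a single twisted
    convolution, so associativity becomes the usual rearrangement of a triple sum; the twist q^(i+j)
    on the third factor matches on both sides.\<close>
  define F :: "(nat \<Rightarrow> 'a) \<Rightarrow> nat \<Rightarrow> 'a" where "F a k = (if k = 0 then 1 else a k)" for a k
  have F: "F (a \<star> b) k = (\<Sum>i=0..k. F a i * F b (k - i) ^ (q ^ i))" if "k \<le> N" for a b k
  proof (cases "k = 0")
    case False
    then obtain k' where k': "k = Suc k'" by (cases k) auto
    have "(\<Sum>i=0..k. F a i * F b (k - i) ^ (q ^ i)) =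
        F b k + (\<Sum>i\<in>{1..<k}. F a i * F b (k - i) ^ (q ^ i)) + F a k"
      unfolding k' by (simp add: sum.atLeast0_atMost_Suc sum.atLeast_Suc_atMost F_def
          atLeastLessThanSuc_atLeastAtMost)
    also have "\<dots> = F (a \<star> b) k"
      using False that by (simp add: F_def umul_coeff)
    finally show ?thesis by simp
  qed (simp add: F_def)
  have frobs: "(\<Sum>i\<in>I. f i :: 'a) ^ (q ^ j) = (\<Sum>i\<in>I. f i ^ (q ^ j))" for I :: "nat set" and f j
    by (simp add: frob_power frob_sum)
  show ?thesis
  proof
    fix k
    show "(a \<star> b \<star> c) k = (a \<star> (b \<star> c)) k"
    proof (cases "1 \<le> k \<and> k \<le> N")
      case True
      have "F (a \<star> b \<star> c) k = (\<Sum>j=0..k. \<Sum>i=0..j. F a i * F b (j - i) ^ (q ^ i) * F c (k - j) ^ (q ^ (i + (j - i))))"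
        using True by (simp add: F sum_distrib_right)
      also have "\<dots> = (\<Sum>j=0..k. \<Sum>i=0..k-j. F a j * F b i ^ (q ^ j) * F c (k - j - i) ^ (q ^ (j + i)))"
        by (rule fps_mult_assoc_lemma[of "\<lambda>i j l. F a i * F b j ^ (q ^ i) * F c l ^ (q ^ (i + j))"])
      also have "\<dots> = F (a \<star> (b \<star> c)) k"
      proof -
        have "F (b \<star> c) (k - j) ^ (q ^ j) =
            (\<Sum>i=0..k-j. F b i ^ (q ^ j) * F c (k - j - i) ^ (q ^ (j + i)))" for j
        proof -
          have "k - j \<le> N" using True by linarith
          then show ?thesis
            by (simp add: F[of "k - j"] frobs power_mult_distrib power_add mult.commute flip: power_mult)
        qed
        then show ?thesis
          using True by (simp only: F[of k a "b \<star> c"] sum_distrib_left mult.assoc)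
      qed
      finally show ?thesis using True by (simp add: F_def)
    qed (auto simp: U_simps U_mul_def)
  qed
qed

text \<open>Coefficient k of the product is \<open>a k\<close> plus terms involving only c and lower
  coefficients of a.\<close>

lemma umul_right_cancel:
  assumes "a \<in> trunc_carrier N" "b \<in> trunc_carrier N" "a \<star> c = b \<star> c"
  shows "a = b"
proof
  fix k
  show "a k = b k"
  proof (induction k rule: less_induct)
    case (less k)
    show ?case
    proof (cases "1 \<le> k \<and> k \<le> N")
      case True
      have "(a \<star> c) k = (b \<star> c) k" using assms by simp
      moreover have "(\<Sum>i\<in>{1..<k}. a i * c (k - i) ^ (q ^ i)) = (\<Sum>i\<in>{1..<k}. b i * c (k - i) ^ (q ^ i))"
        using less by (intro sum.cong) auto
      ultimately show ?thesis using True by (simp add: umul_coeff)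
    qed (use assms in \<open>auto simp: trunc_carrier_iff not_le\<close>)
  qed
qed

lemma zero_in_trunc_carrier: "(\<lambda>_. 0) \<in> trunc_carrier M"
  by (simp add: trunc_carrier_iff)

lemma umul_zero_left: "a \<in> trunc_carrier N \<Longrightarrow> (\<lambda>_. 0) \<star> a = a"
  by (intro ext) (auto simp: U_simps U_mul_def trunc_carrier_iff not_le Suc_le_eq)

text \<open>Left inverses need no formula: right translation is injective on a finite set, hence
  hits the unit.\<close>

lemma group_U: "group U"
proof (rule groupI)
  fix x assume "x \<in> carrier U"
  then have x: "x \<in> trunc_carrier N" by (simp add: U_simps)
  have "(\<lambda>y. y \<star> x) ` trunc_carrier N = trunc_carrier N"
    by (rule endo_inj_surj[OF finite_trunc_carrier])
      (use x umul_closed umul_right_cancel in \<open>auto intro: inj_onI\<close>)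
  then have "(\<lambda>_. 0) \<in> (\<lambda>y. y \<star> x) ` trunc_carrier N" using zero_in_trunc_carrier by metis
  then show "\<exists>y\<in>carrier U. y \<star> x = \<one>\<^bsub>U\<^esub>" by (auto simp: U_simps)
qed (use umul_closed umul_assoc umul_zero_left zero_in_trunc_carrier in \<open>auto simp: U_simps(1,3)\<close>)

end

sublocale conductor_character \<subseteq> G: group U
  by (rule group_U)

context conductor_character
begin

lemma carrier_U: "a \<in> carrier U \<longleftrightarrow> a 0 = 0 \<and> (\<forall>i>N. a i = 0)"
  by (simp add: U_simps trunc_carrier_iff)

lemma one_U: "\<one>\<^bsub>U\<^esub> = (\<lambda>_. 0)"
  by (simp add: U_simps)

lemma finite_U: "finite (carrier U)"
  by (simp add: U_simps finite_trunc_carrier)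

lemma N_half: "h - 1 < N" "0 < h - 1" "N = (h - 1) + (h - 1)" "even N"
  using h by (auto simp: N_def)

lemma umul_coeff_no_cross:
  assumes "1 \<le> k" "k \<le> N" "\<And>i. 1 \<le> i \<Longrightarrow> i < k \<Longrightarrow> a i = 0 \<or> b (k - i) = 0"
  shows "(a \<star> b) k = a k + b k"
proof -
  have "(\<Sum>i\<in>{1..<k}. a i * b (k - i) ^ (q ^ i)) = 0"
    using assms(3) q_pos by (intro sum.neutral) auto
  then show ?thesis using assms by (simp add: umul_coeff)
qed

text \<open>Pair index i of one product with k - i of the other. For even k these have the same
  parity: even pairs cancel, since even powers of the Frobenius are trivial here, and odd pairs
  leave \<open>herm\<close>.\<close>

lemma umul_commutator_coeff:
  assumes "1 \<le> k" "k \<le> N" "even k"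
  shows "(a \<star> b) k - (b \<star> a) k = (\<Sum>i\<in>{1..<k}. if odd i then herm (a i) (b (k - i)) else 0)"
proof -
  have "(\<Sum>i\<in>{1..<k}. b i * a (k - i) ^ (q ^ i)) =
      (\<Sum>i\<in>{1..<k}. b (k - i) * a (k - (k - i)) ^ (q ^ (k - i)))"
    by (subst sum.atLeastLessThan_rev) simp
  also have "\<dots> = (\<Sum>i\<in>{1..<k}. b (k - i) * a i ^ (q ^ (k - i)))"
    by (intro sum.cong) auto
  finally have "(a \<star> b) k - (b \<star> a) k =
      (\<Sum>i\<in>{1..<k}. a i * b (k - i) ^ (q ^ i) - b (k - i) * a i ^ (q ^ (k - i)))"
    using assms by (simp add: umul_coeff sum_subtractf)
  also have "\<dots> = (\<Sum>i\<in>{1..<k}. if odd i then herm (a i) (b (k - i)) else 0)"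
    using assms(3) by (intro sum.cong) (auto simp: frob_power herm_def)
  finally show ?thesis .
qed

text \<open>Here t is the quotient of two elements that agree at the places in K. The closure
  condition on K lets induction kill all cross terms, so agreement forces t to vanish on K.\<close>

lemma quotient_coeff_vanish:
  assumes t: "t \<in> carrier U" and k: "k \<in> K"
    and eq: "\<And>k. k \<in> K \<Longrightarrow> 1 \<le> k \<Longrightarrow> k \<le> N \<Longrightarrow> (t \<star> m) k = m k"
    and K: "\<And>k l. k \<in> K \<Longrightarrow> 1 \<le> l \<Longrightarrow> l < k \<Longrightarrow> k \<le> N \<Longrightarrow> l \<in> K \<or> m (k - l) = 0"
  shows "t k = 0"
  using k
proof (induction k rule: less_induct)
  case (less k)
  show ?case
  proof (cases "1 \<le> k \<and> k \<le> N")
    case True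
    then have "(t \<star> m) k = t k + m k"
      using less K[OF less.prems] by (intro umul_coeff_no_cross) auto
    then show ?thesis using eq[OF less.prems] True by simp
  next
    case False
    then show ?thesis using t by (cases "k = 0") (auto simp: carrier_U)
  qed
qed

section \<open>The subgroups T, J0, J, S and their commutators\<close>

text \<open>S normalises the group T below and fixes its character \<open>\<psi> (t N)\<close>;
  elements outside S move that character on suitable elements of T, which is the first half of
  Mackey's condition.\<close>

definition S :: "(nat \<Rightarrow> 'a) set" where
  "S = {g \<in> carrier U. \<forall>i. odd i \<longrightarrow> i < h - 1 \<longrightarrow> g i = 0}"

text \<open>When \<open>h - 1\<close> is even there is no odd layer in the middle, and \<open>J = J0 = S\<close> below.\<close>

definition middle :: "(nat \<Rightarrow> 'a) \<Rightarrow> 'a" where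
  "middle g = (if odd (h - 1) then g (h - 1) else 0)"

text \<open>The fixed field is isotropic for \<open>herm\<close> by \<open>herm_fixed\<close> and
  maximal so by \<open>herm_nondeg_fixed\<close>: small enough for characters to extend from J0 to
  J, large enough for the induced representation to be irreducible.\<close>

definition J :: "(nat \<Rightarrow> 'a) set" where
  "J = {g \<in> S. middle g ^ q = middle g}"

definition J0 :: "(nat \<Rightarrow> 'a) set" where
  "J0 = {g \<in> S. middle g = 0}"

text \<open>Nonzero coefficients sit only strictly above N/2, so products of two elements have no
  cross terms, and T is abelian with coefficientwise addition.\<close>

definition T :: "(nat \<Rightarrow> 'a) set" where
  "T = {t \<in> carrier U. (\<forall>i. odd i \<longrightarrow> i \<le> h - 1 \<longrightarrow> t i = 0) \<and> (\<forall>i. even i \<longrightarrow> i < N \<longrightarrow> t i = 0)}"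

lemma T_subset_J0: "T \<subseteq> J0"
  by (auto simp: T_def J0_def S_def middle_def)

lemma J0_subset_J: "J0 \<subseteq> J"
  using q_pos by (auto simp: J0_def J_def)

lemma J_subset_S: "J \<subseteq> S"
  by (auto simp: J_def)

lemma S_subset: "S \<subseteq> carrier U"
  by (auto simp: S_def)

lemmas SD = subsetD[OF S_subset]
lemmas JD = subsetD[OF J_subset_S]
lemmas J0D = subsetD[OF J0_subset_J]
lemmas TD = subsetD[OF T_subset_J0]

lemma T_coeff:
  assumes "t \<in> T" "t i \<noteq> 0"
  shows "h - 1 < i" "i \<le> N" "odd i \<or> i = N"
proof -
  have t: "\<And>i. i > N \<Longrightarrow> t i = 0" "\<And>i. odd i \<Longrightarrow> i \<le> h - 1 \<Longrightarrow> t i = 0"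
    "\<And>i. even i \<Longrightarrow> i < N \<Longrightarrow> t i = 0"
    using assms(1) by (auto simp: T_def carrier_U)
  show "i \<le> N" using t(1)[of i] assms(2) by (meson not_le)
  then show "odd i \<or> i = N" using t(3)[of i] assms(2) by linarith
  show "h - 1 < i" using t(2)[of i] t(3)[of i] assms(2) N_half(1) by (meson le_less_trans not_le)
qed

text \<open>An odd index k splits into an odd and an even part; the odd part is below h-1, where
  elements of S vanish. In particular \<open>middle\<close> is additive on S.\<close>

lemma umul_S_odd_coeff:
  assumes "s \<in> S" "j \<in> S" "odd k" "k \<le> h - 1"
  shows "(s \<star> j) k = s k + j k"
proof (rule umul_coeff_no_cross)
  show "1 \<le> k" "k \<le> N" using assms N_half by (auto simp: odd_pos Suc_le_eq)
  fix i assume i: "1 \<le> i" "i < k"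
  show "s i = 0 \<or> j (k - i) = 0"
    using assms i by (cases "odd i") (auto simp: S_def)
qed

lemma S_mult:
  assumes "s \<in> S" "j \<in> S"
  shows "s \<star> j \<in> S" "middle (s \<star> j) = middle s + middle j"
  using assms umul_S_odd_coeff[OF assms] G.m_closed[of s j]
  by (auto simp: S_def middle_def)

lemma one_in_T: "\<one>\<^bsub>U\<^esub> \<in> T"
  by (simp add: T_def one_U carrier_U)

lemma subgroup_S: "subgroup S U"
  by (rule G.finite_subgroupI) (use S_subset finite_subset[OF S_subset finite_U] S_mult one_in_T
    TD J0D JD in blast)+

lemma subgroup_J: "subgroup J U"
proof (rule G.finite_subgroupI)
  show "J \<subseteq> carrier U" using JD SD by blast
  then show "finite J" using finite_U finite_subset by blast
  show "J \<noteq> {}" using one_in_T TD J0D by blast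
  show "x \<star> y \<in> J" if "x \<in> J" "y \<in> J" for x y
    using that S_mult[of x y] by (simp add: J_def frob_add)
qed

lemma subgroup_J0: "subgroup J0 U"
proof (rule G.finite_subgroupI)
  show "J0 \<subseteq> carrier U" using J0D JD SD by blast
  then show "finite J0" using finite_U finite_subset by blast
  show "J0 \<noteq> {}" using one_in_T TD by blast
  show "x \<star> y \<in> J0" if "x \<in> J0" "y \<in> J0" for x y
    using that S_mult[of x y] by (simp add: J0_def)
qed

lemma T_mult:
  assumes "t \<in> T" "t' \<in> T"
  shows "t \<star> t' = (\<lambda>k. t k + t' k)" "t \<star> t' \<in> T"
proof -
  have tU: "t \<in> carrier U" "t' \<in> carrier U" using assms by (auto simp: T_def)
  show eq: "t \<star> t' = (\<lambda>k. t k + t' k)"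
  proof
    fix k
    show "(t \<star> t') k = t k + t' k"
    proof (cases "1 \<le> k \<and> k \<le> N")
      case True
      then show ?thesis
      proof (intro umul_coeff_no_cross)
        fix i assume i: "1 \<le> i" "i < k"
        show "t i = 0 \<or> t' (k - i) = 0"
        proof -
          have "\<not> (h - 1 < i \<and> h - 1 < k - i)" using True N_half(3) by linarith
          then show ?thesis using T_coeff(1)[OF assms(1), of i] T_coeff(1)[OF assms(2), of "k - i"] by blast
        qed
      qed simp_all
    next
      case False
      then show ?thesis using tU G.m_closed[OF tU] by (cases "k = 0") (auto simp: carrier_U)
    qed
  qed
  show "t \<star> t' \<in> T" using G.m_closed[OF tU] assms unfolding eq by (auto simp: T_def)
qed

text \<open>Odd coefficients in S start at h-1 or later. Two odd indices with nonzero coefficients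
  thus sum to at least N, and to exactly N only if both are h-1; so even coefficients below N are
  unaffected by the order of the factors and the top one changes by \<open>herm\<close> of the
  middle ones.\<close>

lemma S_commutator:
  assumes s: "s \<in> S" and j: "j \<in> S"
  obtains t where "t \<in> T" "t N = herm (middle s) (middle j)" "s \<star> j = t \<star> (j \<star> s)"
proof -
  have c: "s \<in> carrier U" "j \<in> carrier U" using s j SD by auto
  define t where "t = (s \<star> j) \<star> inv\<^bsub>U\<^esub> (j \<star> s)"
  have tc: "t \<in> carrier U" using c by (simp add: t_def)
  have ts: "t \<star> (j \<star> s) = s \<star> j" using c by (simp add: t_def G.m_assoc)
  have js: "j \<star> s \<in> S" using S_mult s j by blast
  \<comment> \<open>Exactly the places below N where membership in T demands a zero.\<close>
  define K where "K = {k. odd k \<and> k \<le> h - 1 \<or> even k \<and> k < N}"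
  have vanish: "t k = 0" if "k \<in> K" for k
  proof (rule quotient_coeff_vanish[OF tc that])
    fix k assume k: "k \<in> K" "1 \<le> k" "k \<le> N"
    show "(t \<star> (j \<star> s)) k = (j \<star> s) k"
    proof (cases "odd k")
      case True
      then show ?thesis using k umul_S_odd_coeff[OF s j] umul_S_odd_coeff[OF j s]
        by (auto simp: ts K_def)
    next
      case False
      then have kN: "k < N" using k by (auto simp: K_def)
      have "(s \<star> j) k - (j \<star> s) k = (\<Sum>i\<in>{1..<k}. if odd i then herm (s i) (j (k - i)) else 0)"
        using False k by (intro umul_commutator_coeff) auto
      also have "\<dots> = 0"
      proof (intro sum.neutral ballI)
        fix i assume i: "i \<in> {1..<k}"
        show "(if odd i then herm (s i) (j (k - i)) else 0) = 0"
        proof (cases "odd i \<and> i < h - 1")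
          case True
          then show ?thesis using s by (auto simp: S_def herm_0)
        next
          case F: False
          then have "odd i \<Longrightarrow> k - i < h - 1 \<and> odd (k - i)" using i kN N_half(3) False by auto
          then show ?thesis using j by (auto simp: S_def herm_0)
        qed
      qed
      finally show ?thesis by (simp add: ts)
    qed
  next
    fix k l assume kl: "k \<in> K" "1 \<le> l" "l < k" "k \<le> N"
    show "l \<in> K \<or> (j \<star> s) (k - l) = 0"
    proof (cases "l \<in> K")
      case False
      then have l: "odd l" "h - 1 < l" using kl by (auto simp: K_def)
      then have "odd (k - l)" "k - l < h - 1" using kl N_half(3) by (auto simp: K_def)
      then show ?thesis using js by (auto simp: S_def)
    qed simp
  qed
  have "(t \<star> (j \<star> s)) N = t N + (j \<star> s) N"
  proof (rule umul_coeff_no_cross)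
    fix l assume l: "1 \<le> l" "l < N"
    show "t l = 0 \<or> (j \<star> s) (N - l) = 0"
    proof (cases "l \<in> K")
      case False
      then have l': "odd l" "h - 1 < l" using l by (auto simp: K_def)
      then have "odd (N - l)" "N - l < h - 1" using l N_half by auto
      then show ?thesis using js by (auto simp: S_def)
    qed (use vanish in auto)
  qed (use N_half in auto)
  then have "t N = (s \<star> j) N - (j \<star> s) N" by (simp add: ts)
  also have "\<dots> = (\<Sum>i\<in>{1..<N}. if odd i then herm (s i) (j (N - i)) else 0)"
    using N_half by (intro umul_commutator_coeff) auto
  also have "\<dots> = (\<Sum>i\<in>{1..<N}. if i = h - 1 then herm (middle s) (middle j) else 0)"
  proof (intro sum.cong refl)
    fix i assume i: "i \<in> {1..<N}"
    show "(if odd i then herm (s i) (j (N - i)) else 0) = (if i = h - 1 then herm (middle s) (middle j) else 0)"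
    proof (cases i "h - 1" rule: linorder_cases)
      case less
      then show ?thesis using s by (auto simp: S_def herm_0)
    next
      case equal
      then have "N - i = h - 1" using N_half by simp
      then show ?thesis using equal by (auto simp: middle_def herm_0)
    next
      case greater
      then have "odd i \<Longrightarrow> odd (N - i)" "N - i < h - 1" using N_half i by auto
      then show ?thesis using greater j by (auto simp: S_def herm_0)
    qed
  qed
  also have "\<dots> = herm (middle s) (middle j)" using N_half by simp
  finally have "t N = herm (middle s) (middle j)" .
  moreover have "t \<in> T" using tc vanish by (auto simp: T_def K_def)
  ultimately show thesis using that ts by metis
qed

lemma mono_elem_T:
  assumes "h - 1 < i" "odd i \<or> i = N" "i \<le> N"
  shows "mono_elem i a \<in> T"
  using assms N_half by (auto simp: T_def mono_elem_def carrier_U)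

text \<open>Lowest odd places i of u and N - i of m meet only in degree N, which gives the top
  coefficient. That t has no odd coefficient up to N - i puts it one step deeper in the filtration
  of T than m; the induction in \<open>exists_T_eigenvector\<close> rests on this.\<close>

lemma leading_commutator:
  assumes u: "u \<in> carrier U" and i: "odd i" "i < h - 1" and u_i: "\<And>k. odd k \<Longrightarrow> k < i \<Longrightarrow> u k = 0"
    and m: "m \<in> T" "\<And>k. odd k \<Longrightarrow> k < N - i \<Longrightarrow> m k = 0"
  obtains t where "t \<in> T" "\<And>k. odd k \<Longrightarrow> k \<le> N - i \<Longrightarrow> t k = 0" "t N = herm (u i) (m (N - i))"
    "u \<star> m = t \<star> (m \<star> u)"
proof -
  have iN: "odd (N - i)" "h - 1 < N - i" "N - i < N" "i < N - i"
    using i N_half odd_pos[OF i(1)] by auto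
  have c: "u \<in> carrier U" "m \<in> carrier U" using u m(1) by (auto simp: T_def)
  have m_low: "m k = 0" if "k < N - i" for k
    using T_coeff(3)[OF m(1), of k] m(2)[of k] that iN(3) by (cases "odd k") auto
  define t where "t = (u \<star> m) \<star> inv\<^bsub>U\<^esub> (m \<star> u)"
  have tc: "t \<in> carrier U" using c by (simp add: t_def)
  have ts: "t \<star> (m \<star> u) = u \<star> m" using c by (simp add: t_def G.m_assoc)
  have low: "(u \<star> m) k = u k + m k" "(m \<star> u) k = u k + m k" if "1 \<le> k" "k \<le> N - i" for k
    using that iN by (subst umul_coeff_no_cross; auto simp: m_low)+
  have mu: "(m \<star> u) k = 0" if "odd k" "k < i" for k
    using that low(2)[of k] u_i[of k] iN by (auto simp: m_low odd_pos Suc_le_eq)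
  \<comment> \<open>A nonzero term needs l at least i because of u and k - l at least N - i because
    of m, hence k = N and l = i.\<close>
  have even_sum: "(if odd l then herm (u l) (m (k - l)) else 0) =
      (if l = i \<and> k = N then herm (u i) (m (N - i)) else 0)" if "even k" "k \<le> N" "l \<in> {1..<k}" for k l
  proof (cases "l = i \<and> k = N")
    case True
    then show ?thesis using i by simp
  next
    case False
    show ?thesis
    proof (cases "odd l \<and> N - i \<le> k - l")
      case True
      then have "l < i" using False that iN by (cases "k = N"; cases "l = i") auto
      then show ?thesis using u_i[of l] True False by (auto simp: herm_0)
    qed (use False m_low in \<open>auto simp: herm_0 not_le\<close>)
  qed
  define K where "K = {k. odd k \<and> k \<le> N - i \<or> even k \<and> k < N}"
  have vanish: "t k = 0" if "k \<in> K" for k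
  proof (rule quotient_coeff_vanish[OF tc that])
    fix k assume k: "k \<in> K" "1 \<le> k" "k \<le> N"
    show "(t \<star> (m \<star> u)) k = (m \<star> u) k"
    proof (cases "odd k")
      case True
      then show ?thesis using k low by (auto simp: ts K_def)
    next
      case False
      then have "k < N" using k by (auto simp: K_def)
      have "(u \<star> m) k - (m \<star> u) k = (\<Sum>l\<in>{1..<k}. if odd l then herm (u l) (m (k - l)) else 0)"
        using False k by (intro umul_commutator_coeff) auto
      also have "\<dots> = (\<Sum>l\<in>{1..<k}. if l = i \<and> k = N then herm (u i) (m (N - i)) else 0)"
        using even_sum False k by (intro sum.cong) auto
      also have "\<dots> = 0" using \<open>k < N\<close> by simp
      finally show ?thesis by (simp add: ts)
    qed
  next
    fix k l assume kl: "k \<in> K" "1 \<le> l" "l < k" "k \<le> N"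
    show "l \<in> K \<or> (m \<star> u) (k - l) = 0"
    proof (cases "l \<in> K")
      case False
      then have l: "odd l" "N - i < l" using kl by (auto simp: K_def)
      then have "odd (k - l)" "k - l < i" using kl iN by (auto simp: K_def)
      then show ?thesis using mu by simp
    qed simp
  qed
  have "(t \<star> (m \<star> u)) N = t N + (m \<star> u) N"
  proof (rule umul_coeff_no_cross)
    fix l assume l: "1 \<le> l" "l < N"
    show "t l = 0 \<or> (m \<star> u) (N - l) = 0"
    proof (cases "l \<in> K")
      case False
      then have l': "odd l" "N - i < l" using l by (auto simp: K_def)
      then have "odd (N - l)" "N - l < i" using l N_half by auto
      then show ?thesis using mu by simp
    qed (use vanish in auto)
  qed (use N_half in auto)
  then have "t N = (u \<star> m) N - (m \<star> u) N" by (simp add: ts)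
  also have "\<dots> = (\<Sum>l\<in>{1..<N}. if odd l then herm (u l) (m (N - l)) else 0)"
    using N_half by (intro umul_commutator_coeff) auto
  also have "\<dots> = (\<Sum>l\<in>{1..<N}. if l = i then herm (u i) (m (N - i)) else 0)"
    using even_sum[of N] N_half by (intro sum.cong) auto
  also have "\<dots> = herm (u i) (m (N - i))" using i N_half by (simp add: odd_pos Suc_le_eq)
  finally have "t N = herm (u i) (m (N - i))" .
  moreover have "t \<in> T" using tc vanish iN by (auto simp: T_def K_def)
  moreover have "t k = 0" if "odd k" "k \<le> N - i" for k using vanish[of k] that by (simp add: K_def)
  ultimately show thesis using that ts by metis
qed

section \<open>Comparison with the unit group of L\<close>

text \<open>pi corresponds to tau^2, which commutes with scalars because the Frobenius squared is
  trivial. \<open>even_embed\<close> realises the units of L as the subgroup H, and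
  \<open>even_part\<close> retracts J0 onto them.\<close>

definition even_part :: "(nat \<Rightarrow> 'a) \<Rightarrow> (nat \<Rightarrow> 'a)" where
  "even_part g = (\<lambda>i. g (2 * i))"

definition even_embed :: "(nat \<Rightarrow> 'a) \<Rightarrow> (nat \<Rightarrow> 'a)" where
  "even_embed a = (\<lambda>i. if even i then a (i div 2) else 0)"

lemma even_part_embed: "even_part (even_embed a) = a"
  by (auto simp: even_part_def even_embed_def)

lemma even_part_closed: "g \<in> carrier U \<Longrightarrow> even_part g \<in> trunc_carrier (h - 1)"
  by (auto simp: even_part_def carrier_U trunc_carrier_iff N_def)

lemma even_embed_closed:
  assumes "a \<in> trunc_carrier (h - 1)"
  shows "even_embed a \<in> J0"
proof -
  have "a (i div 2) = 0" if "i > N" "even i" for i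
  proof -
    have "i div 2 > h - 1" using that by (auto simp: N_def)
    then show ?thesis using assms by (auto simp: trunc_carrier_iff)
  qed
  then show ?thesis using assms
    by (auto simp: J0_def S_def middle_def even_embed_def carrier_U trunc_carrier_iff)
qed

text \<open>Two odd indices with sum at most N cannot both exceed h-1, and J0 has no odd coefficient
  up to h-1, so only even cross terms remain; their twist is trivial.\<close>

lemma even_part_J0_mult:
  assumes "g \<in> J0" "g' \<in> J0"
  shows "even_part (g \<star> g') = L_mul (h - 1) (even_part g) (even_part g')"
proof
  fix k
  show "even_part (g \<star> g') k = L_mul (h - 1) (even_part g) (even_part g') k"
  proof (cases "1 \<le> k \<and> k \<le> h - 1")
    case True
    have odd0: "g i = 0" "g' i = 0" if "odd i" "i \<le> h - 1" for i
      using assms that by (cases "i = h - 1"; auto simp: J0_def S_def middle_def)+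
    have "(\<Sum>i\<in>{1..<2*k}. g i * g' (2 * k - i) ^ (q ^ i)) =
        (\<Sum>i\<in>(\<lambda>i. 2 * i) ` {1..<k}. g i * g' (2 * k - i) ^ (q ^ i))"
    proof (rule sum.mono_neutral_right)
      show "\<forall>i\<in>{1..<2*k} - (\<lambda>i. 2 * i) ` {1..<k}. g i * g' (2 * k - i) ^ (q ^ i) = 0"
      proof
        fix i assume i: "i \<in> {1..<2*k} - (\<lambda>i. 2 * i) ` {1..<k}"
        have "odd i"
        proof
          assume "even i"
          then obtain i' where "i = 2 * i'" by (elim evenE)
          then show False using i by auto
        qed
        then have "odd (2 * k - i)" using i by auto
        have "i \<le> h - 1 \<or> 2 * k - i \<le> h - 1" using True by auto
        then show "g i * g' (2 * k - i) ^ (q ^ i) = 0"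
          using odd0 \<open>odd i\<close> \<open>odd (2 * k - i)\<close> q_pos by auto
      qed
    qed auto
    also have "\<dots> = (\<Sum>i\<in>{1..<k}. g (2 * i) * g' (2 * (k - i)))"
      by (subst sum.reindex) (auto simp: inj_on_def frob_power diff_mult_distrib2)
    finally show ?thesis using True
      by (simp add: even_part_def L_mul_def umul_coeff N_def)
  next
    case False
    have "g \<star> g' \<in> carrier U" using assms J0D JD SD by blast
    then have "even_part (g \<star> g') k = 0"
      using False even_part_closed[of "g \<star> g'"] by (cases "k = 0") (auto simp: trunc_carrier_iff)
    then show ?thesis using False by (auto simp: L_mul_def)
  qed
qed

lemma J0_odd_coeff: "g \<in> J0 \<Longrightarrow> odd i \<Longrightarrow> i \<le> h - 1 \<Longrightarrow> g i = 0"
  by (cases "i = h - 1") (auto simp: J0_def S_def middle_def)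

text \<open>Dividing by the even part leaves an element of T with top coefficient 0, on which the
  prescribed character is 1. A character of J0 that is \<open>\<psi> (t N)\<close> on T is therefore
  determined by its values on H.\<close>

lemma J0_decomp:
  assumes g: "g \<in> J0"
  obtains t where "t \<in> T" "t N = 0" "g = t \<star> even_embed (even_part g)"
proof -
  define d where "d = even_embed (even_part g)"
  have gc: "g \<in> carrier U" using g J0D JD SD by blast
  have dJ: "d \<in> J0" unfolding d_def using even_embed_closed even_part_closed gc by blast
  then have dc: "d \<in> carrier U" using J0D JD SD by blast
  have d: "d i = (if even i then g i else 0)" for i
    by (simp add: d_def even_embed_def even_part_def)
  define t where "t = g \<star> inv\<^bsub>U\<^esub> d"
  have tc: "t \<in> carrier U" using gc dc by (simp add: t_def)
  have td: "t \<star> d = g" using gc dc by (simp add: t_def G.m_assoc)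
  have vanish: "t k = 0" if "k \<in> {k. even k \<or> k \<le> h - 1}" for k
    by (rule quotient_coeff_vanish[OF tc that, of d])
      (use J0_odd_coeff[OF g] in \<open>auto simp: td d\<close>)
  then have "t \<in> T" using tc by (auto simp: T_def)
  then show thesis using that vanish[of N] N_half td unfolding d_def by auto
qed

lemma even_embed_mult:
  assumes "a \<in> trunc_carrier (h - 1)" "b \<in> trunc_carrier (h - 1)"
  shows "even_embed (L_mul (h - 1) a b) = even_embed a \<star> even_embed b"
proof -
  have J: "even_embed a \<in> J0" "even_embed b \<in> J0" using assms even_embed_closed by auto
  have c: "even_embed a \<star> even_embed b \<in> carrier U" using J J0D JD SD by blast
  have "(even_embed a \<star> even_embed b) k = 0" if "odd k" for k
  proof (cases "k \<le> N")
    case True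
    then have "(even_embed a \<star> even_embed b) k = even_embed a k + even_embed b k"
      using that by (intro umul_coeff_no_cross) (auto simp: even_embed_def odd_pos Suc_le_eq)
    then show ?thesis using that by (simp add: even_embed_def)
  qed (use c in \<open>auto simp: carrier_U\<close>)
  moreover have "L_mul (h - 1) a b = even_part (even_embed a \<star> even_embed b)"
    using even_part_J0_mult[OF J] by (simp add: even_part_embed)
  ultimately show ?thesis by (auto simp: even_embed_def even_part_def)
qed

lemma even_part_T: "t \<in> T \<Longrightarrow> even_part t = mono_elem (h - 1) (t N)"
  unfolding even_part_def mono_elem_def
proof
  fix i assume t: "t \<in> T"
  show "t (2 * i) = (if i = h - 1 then t N else 0)"
    using T_coeff(3)[OF t, of "2 * i"] by (auto simp: N_def)
qed

lemma even_embed_mono: "even_embed (mono_elem (h - 1) a) = mono_elem N a"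
  unfolding even_embed_def mono_elem_def N_def by (intro ext) (auto elim!: evenE)

section \<open>Orders of U and J\<close>

lemma card_coefficientwise:
  fixes A :: "nat \<Rightarrow> 'a set"
  assumes "\<And>i. i = 0 \<or> i > M \<Longrightarrow> A i = {0}"
  shows "card {g. \<forall>i. g i \<in> A i} = (\<Prod>i\<in>{1..M}. card (A i))"
proof -
  have "bij_betw (\<lambda>g. restrict g {1..M}) {g. \<forall>i. g i \<in> A i} (PiE {1..M} A)"
  proof (rule bij_betw_byWitness[where f' = "\<lambda>g i. if i \<in> {1..M} then g i else 0"])
    show "\<forall>g\<in>{g. \<forall>i. g i \<in> A i}. (\<lambda>i. if i \<in> {1..M} then restrict g {1..M} i else 0) = g"
    proof (intro ballI ext)
      fix g i assume "g \<in> {g. \<forall>i. g i \<in> A i}"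
      then have "g i \<in> A i" by simp
      then show "(if i \<in> {1..M} then restrict g {1..M} i else 0) = g i"
        using assms[of i] by (cases "i \<in> {1..M}") (auto simp: not_le Suc_le_eq)
    qed
    show "\<forall>g\<in>PiE {1..M} A. restrict (\<lambda>i. if i \<in> {1..M} then g i else 0) {1..M} = g"
    proof (intro ballI ext)
      fix g i assume g: "g \<in> PiE {1..M} A"
      show "restrict (\<lambda>i. if i \<in> {1..M} then g i else 0) {1..M} i = g i"
        using PiE_arb[OF g, of i] by (cases "i \<in> {1..M}") simp_all
    qed
    show "(\<lambda>g i. if i \<in> {1..M} then g i else 0) ` PiE {1..M} A \<subseteq> {g. \<forall>i. g i \<in> A i}"
    proof (intro image_subsetI CollectI allI)
      fix g i assume g: "g \<in> PiE {1..M} A"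
      show "(if i \<in> {1..M} then g i else 0) \<in> A i"
        using PiE_mem[OF g, of i] assms[of i] by (cases "i \<in> {1..M}") (auto simp: not_le Suc_le_eq)
    qed
  qed auto
  from bij_betw_same_card[OF this] show ?thesis by (simp add: card_PiE)
qed

lemma card_U: "card (carrier U) = q ^ (4 * (h - 1))"
proof -
  let ?A = "\<lambda>i. if i = 0 \<or> i > N then {0} else (UNIV :: 'a set)"
  have "carrier U = {g. \<forall>i. g i \<in> ?A i}" unfolding set_eq_iff carrier_U by auto
  then have "card (carrier U) = (\<Prod>i\<in>{1..N}. card (?A i))"
    using card_coefficientwise[of N ?A] by simp
  also have "\<dots> = (\<Prod>i\<in>{1..N}. q ^ 2)" by (intro prod.cong) (auto simp: card_field)
  also have "\<dots> = q ^ (4 * (h - 1))" by (simp add: N_def flip: power_mult)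
  finally show ?thesis .
qed

text \<open>\<open>q ^ d i\<close> counts the choices for coefficient i. The reflection of i to N -
  i pairs each forbidden odd index with a free one, and an odd middle index counts 1, so odd indices
  contribute 1 on average and even ones 2. Each parity occurs h-1 times.\<close>

lemma card_J: "card J = q ^ (3 * (h - 1))"
proof -
  define A where "A i = (if i = 0 \<or> i > N \<or> odd i \<and> i < h - 1 then {0}
    else if odd i \<and> i = h - 1 then {x. x ^ q = x} else (UNIV :: 'a set))" for i
  define d where "d i = (if odd i \<and> i < h - 1 then 0 else if odd i \<and> i = h - 1 then 1 else 2 :: nat)" for i
  have A0: "A i = {0}" if "i = 0 \<or> i > N" for i using that by (auto simp: A_def)
  have "J = {g. \<forall>i. g i \<in> A i}"
  proof (intro Set.set_eqI iffI)
    fix g assume "g \<in> {g. \<forall>i. g i \<in> A i}"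
    then have g: "g i \<in> A i" for i by auto
    have "g 0 = 0" "\<And>i. i > N \<Longrightarrow> g i = 0" "\<And>i. odd i \<Longrightarrow> i < h - 1 \<Longrightarrow> g i = 0"
      subgoal using g[of 0] by (simp add: A_def)
      subgoal for i using g[of i] by (simp add: A_def)
      subgoal for i using g[of i] by (simp add: A_def)
      done
    moreover have "middle g ^ q = middle g"
      using g[of "h - 1"] N_half q_pos by (auto simp: middle_def A_def)
    ultimately show "g \<in> J" by (auto simp: J_def S_def carrier_U)
  qed (auto simp: J_def S_def carrier_U middle_def A_def)
  then have "card J = (\<Prod>i\<in>{1..N}. card (A i))"
    using card_coefficientwise[of N A] A0 by simp
  also have "\<dots> = (\<Prod>i\<in>{1..N}. q ^ d i)"
    by (intro prod.cong) (auto simp: card_field card_fixed_field d_def A_def)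
  also have "\<dots> = q ^ (\<Sum>i\<in>{1..N}. d i)" by (simp add: power_sum)
  also have "(\<Sum>i\<in>{1..N}. d i) = 3 * (h - 1)"
  proof -
    have rev: "(\<Sum>i\<in>{1..<N}. d i) = (\<Sum>i\<in>{1..<N}. d (N - i))"
      by (subst sum.atLeastLessThan_rev) simp
    have "2 * (\<Sum>i\<in>{1..<N}. d i) = (\<Sum>i\<in>{1..<N}. d i) + (\<Sum>i\<in>{1..<N}. d (N - i))"
      using rev by simp
    also have "\<dots> = (\<Sum>i\<in>{1..<N}. d i + d (N - i))" by (simp add: sum.distrib)
    also have "\<dots> = (\<Sum>i\<in>{1..<N}. if odd i then 2 else 4)"
    proof (intro sum.cong refl)
      fix i assume i: "i \<in> {1..<N}"
      then have "odd (N - i) \<longleftrightarrow> odd i" using N_half(4) by auto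
      moreover have "N - i < h - 1 \<longleftrightarrow> h - 1 < i" "N - i = h - 1 \<longleftrightarrow> i = h - 1"
        using i N_half(3) by auto
      ultimately show "d i + d (N - i) = (if odd i then 2 else 4)"
        unfolding d_def by (cases "odd i"; cases i "h - 1" rule: linorder_cases) simp_all
    qed
    \<comment> \<open>The reflected range omits i = N, which has \<open>d N = 2\<close> and adds 4
      to the doubled sum.\<close>
    also have "\<dots> + 4 = 6 * (h - 1)"
    proof -
      have "(\<Sum>i\<in>{1..<2 * Suc n}. if odd i then 2 else 4::nat) + 4 = 6 * Suc n" for n
      proof (induction n)
        case 0
        show ?case by (simp add: numeral_2_eq_2)
      next
        case (Suc n)
        define l where "l = 2 * Suc n"
        have "2 * Suc (Suc n) = Suc (Suc l)" "even l" "1 \<le> l" by (auto simp: l_def)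
        then show ?case using Suc unfolding l_def[symmetric] by (simp add: sum.atLeastLessThan_Suc)
      qed
      moreover have "Suc (h - 2) = h - 1" using h by simp
      ultimately show ?thesis unfolding N_def by metis
    qed
    finally have "(\<Sum>i\<in>{1..<N}. d i) + 2 = 3 * (h - 1)" by simp
    moreover have "(\<Sum>i\<in>{1..N}. d i) = (\<Sum>i\<in>{1..<N}. d i) + d N"
      using sum.atLeastLessThan_Suc[of 1 N d] N_half by (simp add: atLeastLessThanSuc_atLeastAtMost)
    moreover have "d N = 2" using N_half by (auto simp: d_def)
    ultimately show ?thesis by simp
  qed
  finally show ?thesis .
qed

lemma index_J: "card (carrier U) = m * card J \<Longrightarrow> m = q ^ (h - 1)"
proof -
  assume "card (carrier U) = m * card J"
  then have "q ^ (h - 1) * q ^ (3 * (h - 1)) = m * q ^ (3 * (h - 1))"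
    unfolding card_U card_J by (simp flip: power_add)
  then show ?thesis using q_pos by simp
qed

end

section \<open>Representations of the unipotent group\<close>

context conductor_character
begin

lemma T_closed: "t \<in> T \<Longrightarrow> t \<in> carrier U"
  by (simp add: T_def)

lemma subgroup_T_filtration: "subgroup {t \<in> T. \<forall>k<i. odd k \<longrightarrow> t k = 0} U"
proof (rule G.finite_subgroupI)
  let ?A = "{t \<in> T. \<forall>k<i. odd k \<longrightarrow> t k = 0}"
  show "?A \<subseteq> carrier U" using T_closed by auto
  then show "finite ?A" using finite_U finite_subset by blast
  show "?A \<noteq> {}" using one_in_T by (auto simp: one_U)
  show "x \<star> y \<in> ?A" if "x \<in> ?A" "y \<in> ?A" for x y
    using that T_mult[of x y] by auto
qed

lemma subgroup_T: "subgroup T U"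
  using subgroup_T_filtration[of 0] by simp

lemma T_commute: "t \<in> T \<Longrightarrow> t' \<in> T \<Longrightarrow> t \<star> t' = t' \<star> t"
  by (simp add: T_mult(1) add.commute)

lemma T_inv_top:
  assumes "t \<in> T"
  shows "inv\<^bsub>U\<^esub> t \<in> T" "(inv\<^bsub>U\<^esub> t) N = - t N"
proof -
  show i: "inv\<^bsub>U\<^esub> t \<in> T" using subgroup.m_inv_closed[OF subgroup_T assms] .
  have "inv\<^bsub>U\<^esub> t \<star> t = (\<lambda>_. 0)" using T_closed[OF assms] by (simp add: one_U)
  then have "(inv\<^bsub>U\<^esub> t) N + t N = 0" using T_mult(1)[OF i assms] by metis
  then show "(inv\<^bsub>U\<^esub> t) N = - t N" by (simp add: eq_neg_iff_add_eq_0)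
qed

lemma middle_inv:
  assumes "s \<in> S"
  shows "inv\<^bsub>U\<^esub> s \<in> S" "middle (inv\<^bsub>U\<^esub> s) = - middle s"
proof -
  show i: "inv\<^bsub>U\<^esub> s \<in> S" using subgroup.m_inv_closed[OF subgroup_S assms] .
  have "middle (inv\<^bsub>U\<^esub> s \<star> s) = 0" using SD[OF assms] by (simp add: one_U middle_def)
  then show "middle (inv\<^bsub>U\<^esub> s) = - middle s" using S_mult(2)[OF i assms] by (simp add: eq_neg_iff_add_eq_0)
qed

text \<open>The left-hand version applied to inverses. The commutator stands on the right so that it
  is the first factor to act on a vector, where it is a known scalar.\<close>

lemma S_commutator_right:
  assumes s: "s \<in> S" and j: "j \<in> S"
  obtains t where "t \<in> T" "t N = herm (middle s) (middle j)" "s \<star> j = (j \<star> s) \<star> t"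
proof -
  have c: "s \<in> carrier U" "j \<in> carrier U" using s j SD by auto
  obtain t where t: "t \<in> T" "t N = herm (middle (inv\<^bsub>U\<^esub> j)) (middle (inv\<^bsub>U\<^esub> s))"
    "inv\<^bsub>U\<^esub> j \<star> inv\<^bsub>U\<^esub> s = t \<star> (inv\<^bsub>U\<^esub> s \<star> inv\<^bsub>U\<^esub> j)"
    using S_commutator middle_inv(1) s j by metis
  have tc: "t \<in> carrier U" using t(1) by (rule T_closed)
  have "s \<star> j = inv\<^bsub>U\<^esub> (inv\<^bsub>U\<^esub> j \<star> inv\<^bsub>U\<^esub> s)" using c by (simp add: G.inv_mult_group)
  also have "\<dots> = (j \<star> s) \<star> inv\<^bsub>U\<^esub> t" unfolding t(3) using c tc by (simp add: G.inv_mult_group)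
  finally have "s \<star> j = (j \<star> s) \<star> inv\<^bsub>U\<^esub> t" .
  moreover have "(inv\<^bsub>U\<^esub> t) N = herm (middle s) (middle j)"
    using T_inv_top[OF t(1)] t(2) middle_inv s j by (simp add: herm_def frob_minus)
  ultimately show thesis using that T_inv_top(1)[OF t(1)] by blast
qed

lemma sum_\<psi>_herm:
  "(\<Sum>x\<in>UNIV. \<psi> (- herm x a)) = (if a = 0 then of_nat (card (UNIV :: 'a set)) else 0)"
proof (cases "a = 0")
  case False
  then obtain x0 where "\<psi> (herm a x0) \<noteq> 1" using herm_nondeg by blast
  then have "(\<Sum>x\<in>UNIV. \<psi> (herm a x)) = 0"
    by (intro sum_\<psi>_eq_0) (auto simp: herm_add)
  then show ?thesis using False herm_swap[of a] by simp
qed (simp add: herm_0 \<psi>_0)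

definition top_scalar :: "nat \<Rightarrow> ((nat \<Rightarrow> 'a) \<Rightarrow> 'k mat) \<Rightarrow> bool" where
  "top_scalar n \<rho> \<longleftrightarrow> (\<forall>a. \<rho> (mono_elem N a) = \<psi> a \<cdot>\<^sub>m 1\<^sub>m n)"

text \<open>Downward induction along the filtration \<open>F i\<close> by the lowest odd place. In
  \<open>F N\<close> only the top coefficient is left, which acts by a scalar. To pass from
  \<open>Suc i\<close> to i, the vector is translated by the elements 1 + x tau^(N-i): moving t past
  them costs \<open>\<psi> (herm x (t i))\<close>, and summing over x detects
  \<open>t i = 0\<close>, that is, membership in \<open>F (Suc i)\<close>.\<close>

lemma exists_T_eigenvector:
  assumes \<rho>: "mat_rep U n \<rho>" "top_scalar n \<rho>" and n: "0 < n"
  shows "\<exists>v\<in>carrier_vec n. v \<noteq> 0\<^sub>v n \<and> (\<forall>t\<in>T. \<rho> t *\<^sub>v v = \<psi> (t N) \<cdot>\<^sub>v v)"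
proof -
  define F where "F i = {t \<in> T. \<forall>k<i. odd k \<longrightarrow> t k = 0}" for i
  note closed = mat_rep_vec_carrier[OF \<rho>(1)]
  have FT: "t \<in> F i \<Longrightarrow> t \<in> T" for t i by (simp add: F_def)
  have Tc: "t \<in> T \<Longrightarrow> t \<in> carrier U" for t by (rule T_closed)
  have "\<exists>v\<in>carrier_vec n. v \<noteq> 0\<^sub>v n \<and> (\<forall>t\<in>F 0. \<rho> t *\<^sub>v v = \<psi> (t N) \<cdot>\<^sub>v v)"
  proof (rule inc_induct[of 0 N])
    have "\<rho> t *\<^sub>v unit_vec n 0 = \<psi> (t N) \<cdot>\<^sub>v unit_vec n 0" if t: "t \<in> F N" for t
    proof -
      have "t = mono_elem N (t N)"
      proof
        fix k
        have "t k = 0" if "k \<noteq> N"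
        proof (rule ccontr)
          assume nz: "t k \<noteq> 0"
          have "odd k" "k < N" using T_coeff(2,3)[OF FT[OF t] nz] that by auto
          then show False using t nz by (simp add: F_def)
        qed
        then show "t k = mono_elem N (t N) k" by (simp add: mono_elem_def)
      qed
      then have "\<rho> t = \<psi> (t N) \<cdot>\<^sub>m 1\<^sub>m n" using \<rho>(2) unfolding top_scalar_def by metis
      then show ?thesis by (auto intro!: eq_vecI)
    qed
    moreover have "unit_vec n 0 \<noteq> (0\<^sub>v n :: 'k vec)" using n by simp
    ultimately show "\<exists>v\<in>carrier_vec n. v \<noteq> 0\<^sub>v n \<and> (\<forall>t\<in>F N. \<rho> t *\<^sub>v v = \<psi> (t N) \<cdot>\<^sub>v v)"
      by (intro bexI[of _ "unit_vec n 0"]) auto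
  next
    fix i assume i: "0 \<le> i" "i < N"
      and "\<exists>v\<in>carrier_vec n. v \<noteq> 0\<^sub>v n \<and> (\<forall>t\<in>F (Suc i). \<rho> t *\<^sub>v v = \<psi> (t N) \<cdot>\<^sub>v v)"
    then obtain v where v: "v \<in> carrier_vec n" "v \<noteq> 0\<^sub>v n"
      and eig: "\<And>t. t \<in> F (Suc i) \<Longrightarrow> \<rho> t *\<^sub>v v = \<psi> (t N) \<cdot>\<^sub>v v" by blast
    have F_Suc: "F (Suc i) = {t \<in> F i. odd i \<longrightarrow> t i = 0}" by (auto simp: F_def less_Suc_eq)
    show "\<exists>v\<in>carrier_vec n. v \<noteq> 0\<^sub>v n \<and> (\<forall>t\<in>F i. \<rho> t *\<^sub>v v = \<psi> (t N) \<cdot>\<^sub>v v)"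
    proof (cases "odd i \<and> h - 1 < i")
      case False
      then have "F (Suc i) = F i" unfolding F_Suc by (auto simp: F_def T_def)
      then show ?thesis using v eig by auto
    next
      case True
      define r where "r = N - i"
      have r: "odd r" "r < h - 1" "N - r = i" using True i N_half by (auto simp: r_def)
      define x_elem where "x_elem x = (mono_elem r x :: nat \<Rightarrow> 'a)" for x
      have xc: "x_elem x \<in> carrier U" for x
        using r N_half by (auto simp: x_elem_def carrier_U mono_elem_def odd_pos)
      have x_coeff: "x_elem x k = (if k = r then x else 0)" for x k
        by (simp add: x_elem_def mono_elem_def)
      show ?thesis
      proof (rule G.exists_translated_eigenvector[where A = "F i" and B = "F (Suc i)" and \<theta> = "\<lambda>t. \<psi> (t N)"
            and u = x_elem and f = "\<lambda>x t. \<psi> (- herm x (t i))" and X = UNIV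
            and c = "of_nat (card (UNIV :: 'a set))"])
        show "subgroup (F i) U" unfolding F_def by (rule subgroup_T_filtration)
        show "F (Suc i) \<noteq> {}" using one_in_T by (auto simp: F_def one_U)
        show "\<psi> ((x \<star> y) N) = \<psi> (x N) * \<psi> (y N)" if "x \<in> F i" "y \<in> F i" for x y
          using T_mult(1)[OF FT[OF that(1)] FT[OF that(2)]] by (simp add: \<psi>_add)
        show "\<psi> (\<one>\<^bsub>U\<^esub> N) = 1" by (simp add: one_U \<psi>_0)
        fix x t assume t: "t \<in> F i"
        have tT: "t \<in> T" and tc: "t \<in> carrier U" using FT[OF t] Tc by auto
        obtain c where c: "c \<in> T" "\<And>k. odd k \<Longrightarrow> k \<le> i \<Longrightarrow> c k = 0" "c N = herm x (t i)"
          "x_elem x \<star> t = c \<star> (t \<star> x_elem x)"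
          using leading_commutator[OF xc[of x] r(1,2), of t] tT t unfolding r(3)
          by (auto simp: F_def x_coeff)
        have cc: "c \<in> carrier U" using c(1) Tc by blast
        have cF: "c \<in> F (Suc i)" using c by (auto simp: F_def)
        have c_low: "k > i" if "c k \<noteq> 0" for k
          using T_coeff(3)[OF c(1) that] c(2)[of k] that i by (meson not_le)
        \<comment> \<open>All nonzero coefficients of c lie above i, and i + r = N, so every cross
          term falls beyond the truncation. Commuting c to the right lets it act on v by its
          eigenvalue.\<close>
        have "c \<star> x_elem x = x_elem x \<star> c"
        proof
          fix k
          show "(c \<star> x_elem x) k = (x_elem x \<star> c) k"
          proof (cases "1 \<le> k \<and> k \<le> N")
            case True
            have "c a = 0 \<or> x_elem x b = 0" if "a + b \<le> N" for a b
            proof (rule ccontr)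
              assume "\<not> (c a = 0 \<or> x_elem x b = 0)"
              then have "i < a" "b = r" using c_low[of a] x_coeff[of x b] by (auto split: if_splits)
              then show False using that i(2) by (simp add: r_def)
            qed
            note cross = this
            have "c l = 0 \<or> x_elem x (k - l) = 0" "x_elem x l = 0 \<or> c (k - l) = 0"
              if "l < k" for l
              using cross[of l "k - l"] cross[of "k - l" l] True that by auto
            then have "(c \<star> x_elem x) k = c k + x_elem x k" "(x_elem x \<star> c) k = x_elem x k + c k"
              using True by (auto intro!: umul_coeff_no_cross)
            then show ?thesis by simp
          next
            case False
            then show ?thesis using G.m_closed[OF cc xc[of x]] G.m_closed[OF xc[of x] cc]
              by (cases "k = 0") (auto simp: carrier_U)
          qed
        qed
        then have "x_elem x \<star> t = (t \<star> x_elem x) \<star> c"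
          unfolding c(4) using T_commute[OF c(1) tT] tc cc xc[of x] by (metis G.m_assoc)
        then have "\<rho> (x_elem x) *\<^sub>v (\<rho> t *\<^sub>v v) = \<rho> t *\<^sub>v (\<rho> (x_elem x) *\<^sub>v (\<rho> c *\<^sub>v v))"
          using tc cc xc[of x] v
          by (simp add: mat_rep_mult_vec[OF \<rho>(1)] closed flip: mat_rep_mult_vec[OF \<rho>(1) _ _ v(1), of "x_elem x" t])
        also have "\<dots> = \<psi> (herm x (t i)) \<cdot>\<^sub>v (\<rho> t *\<^sub>v (\<rho> (x_elem x) *\<^sub>v v))"
          using eig[OF cF] c(3) mult_mat_vec[OF mat_repD(1)[OF \<rho>(1) xc] v(1)]
            mult_mat_vec[OF mat_repD(1)[OF \<rho>(1) tc] closed[OF xc v(1)]] by simp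
        finally show "\<rho> t *\<^sub>v (\<rho> (x_elem x) *\<^sub>v v) =
            \<psi> (- herm x (t i)) \<cdot>\<^sub>v (\<rho> (x_elem x) *\<^sub>v (\<rho> t *\<^sub>v v))"
          using \<psi>_nz by (simp add: smult_smult_assoc \<psi>_uminus)
      qed (use finite_U \<rho> v eig xc F_Suc True sum_\<psi>_herm in \<open>auto simp: card_eq_0_iff\<close>)
    qed
  qed simp
  then show ?thesis by (simp add: F_def)
qed

text \<open>On the \<open>\<theta>\<close>-eigenspace W of A, a commutator of elements of S with
  vanishing \<open>herm\<close> of middles lies in T with top coefficient 0 and acts trivially. So B
  preserves W and commutes there. Used twice: from T to J0, and from J0 to J.\<close>

lemma exists_common_eigenvector_S:
  assumes alg: "\<forall>f::'k poly. 0 < degree f \<longrightarrow> (\<exists>x. poly f x = 0)"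
    and \<rho>: "mat_rep U n \<rho>"
    and A: "T \<subseteq> A" "A \<subseteq> S" and B: "B \<subseteq> S"
    and \<theta>: "\<And>t. t \<in> T \<Longrightarrow> \<theta> t = \<psi> (t N)"
    and AB: "\<And>a b. a \<in> A \<Longrightarrow> b \<in> B \<Longrightarrow> herm (middle a) (middle b) = 0"
    and BB: "\<And>a b. a \<in> B \<Longrightarrow> b \<in> B \<Longrightarrow> herm (middle a) (middle b) = 0"
    and v0: "v0 \<in> carrier_vec n" "v0 \<noteq> 0\<^sub>v n" "\<And>a. a \<in> A \<Longrightarrow> \<rho> a *\<^sub>v v0 = \<theta> a \<cdot>\<^sub>v v0"
  shows "\<exists>v\<in>carrier_vec n. v \<noteq> 0\<^sub>v n \<and> (\<forall>a\<in>A. \<rho> a *\<^sub>v v = \<theta> a \<cdot>\<^sub>v v)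
    \<and> (\<forall>b\<in>B. \<exists>r. \<rho> b *\<^sub>v v = r \<cdot>\<^sub>v v)"
proof -
  note closed = mat_rep_vec_carrier[OF \<rho>]
  define W where "W = {v \<in> carrier_vec n. \<forall>a\<in>A. \<rho> a *\<^sub>v v = \<theta> a \<cdot>\<^sub>v v}"
  have Ac: "a \<in> carrier U" if "a \<in> A" for a using that A SD by blast
  have Bc: "b \<in> carrier U" if "b \<in> B" for b using that B SD by blast
  have swap: "\<rho> a *\<^sub>v (\<rho> b *\<^sub>v v) = \<rho> b *\<^sub>v (\<rho> a *\<^sub>v v)"
    if ab: "a \<in> S" "b \<in> S" and "herm (middle a) (middle b) = 0" and vW: "v \<in> W" for a b v
  proof -
    obtain t where t: "t \<in> T" "t N = 0" "a \<star> b = (b \<star> a) \<star> t"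
      using S_commutator_right[OF ab] by (metis \<open>herm (middle a) (middle b) = 0\<close>)
    have v: "v \<in> carrier_vec n" "\<rho> t *\<^sub>v v = v"
      using vW t A \<theta>[OF t(1)] by (auto simp: W_def \<psi>_0)
    have c: "a \<in> carrier U" "b \<in> carrier U" "t \<in> carrier U" using ab t T_closed SD by auto
    have "\<rho> a *\<^sub>v (\<rho> b *\<^sub>v v) = \<rho> (a \<star> b) *\<^sub>v v" using mat_rep_mult_vec[OF \<rho> c(1,2) v(1)] by simp
    also have "\<dots> = \<rho> (b \<star> a) *\<^sub>v v" unfolding t(3) using c v by (subst mat_rep_mult_vec[OF \<rho>]) auto
    also have "\<dots> = \<rho> b *\<^sub>v (\<rho> a *\<^sub>v v)" using mat_rep_mult_vec[OF \<rho> c(2,1) v(1)] by simp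
    finally show ?thesis .
  qed
  have WD: "v \<in> carrier_vec n" "a \<in> A \<Longrightarrow> \<rho> a *\<^sub>v v = \<theta> a \<cdot>\<^sub>v v" if "v \<in> W" for v a
    using that by (auto simp: W_def)
  have "\<exists>v\<in>W. v \<noteq> 0\<^sub>v n \<and> (\<forall>b\<in>B. \<exists>r. \<rho> b *\<^sub>v v = r \<cdot>\<^sub>v v)"
  proof (rule common_eigenvector[OF alg])
    show "finite B" using finite_subset[OF _ finite_U, of B] Bc by blast
    show "\<rho> b \<in> carrier_mat n n" if "b \<in> B" for b using mat_repD(1)[OF \<rho> Bc[OF that]] .
    show "is_subspace_vec n W"
      unfolding is_subspace_vec_def
    proof (intro conjI ballI allI)
      show "W \<subseteq> carrier_vec n" by (auto simp: W_def)
      show "0\<^sub>v n \<in> W" using mult_mat_zero_vec[OF mat_repD(1)[OF \<rho> Ac]] by (auto simp: W_def)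
      show "v + w \<in> W" if "v \<in> W" "w \<in> W" for v w
        using that mult_add_distrib_mat_vec[OF mat_repD(1)[OF \<rho> Ac], of _ v w]
        by (auto simp: W_def smult_add_distrib_vec[of v n w])
      show "c \<cdot>\<^sub>v v \<in> W" if "v \<in> W" for c v
        using that mult_mat_vec[OF mat_repD(1)[OF \<rho> Ac], of _ v c]
        by (auto simp: W_def smult_smult_assoc mult.commute)
    qed
    show "W \<noteq> {0\<^sub>v n}" using v0 by (auto simp: W_def)
    show "\<rho> b *\<^sub>v v \<in> W" if b: "b \<in> B" and v: "v \<in> W" for b v
    proof -
      have "\<rho> a *\<^sub>v (\<rho> b *\<^sub>v v) = \<theta> a \<cdot>\<^sub>v (\<rho> b *\<^sub>v v)" if a: "a \<in> A" for a
        using swap[of a b v] AB[OF a b] a b v A B WD[OF v]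
          mult_mat_vec[OF mat_repD(1)[OF \<rho> Bc[OF b]] WD(1)[OF v]] by auto
      then show ?thesis using closed[OF Bc[OF b] WD(1)[OF v]] by (simp add: W_def)
    qed
    show "\<rho> a *\<^sub>v (\<rho> b *\<^sub>v v) = \<rho> b *\<^sub>v (\<rho> a *\<^sub>v v)" if "a \<in> B" "b \<in> B" "v \<in> W" for a b v
      using swap BB that B by blast
    show "\<exists>m>0. \<forall>v\<in>W. ((*\<^sub>v) (\<rho> b) ^^ m) v = v" if "b \<in> B" for b
      using mat_rep_pow_order[OF group_U finite_U \<rho> Bc[OF that]] WD(1) by blast
  qed
  then show ?thesis by (auto simp: W_def)
qed

section \<open>Conjugates of characters of J\<close>

definition extends_\<psi> :: "((nat \<Rightarrow> 'a) \<Rightarrow> 'k) \<Rightarrow> bool" where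
  "extends_\<psi> \<Theta> \<longleftrightarrow> (\<forall>x\<in>J. \<forall>y\<in>J. \<Theta> (x \<star> y) = \<Theta> x * \<Theta> y) \<and> (\<forall>t\<in>T. \<Theta> t = \<psi> (t N))"

text \<open>One computation with two uses: with equal characters the third conclusion is Mackey's
  condition, and with different ones the second shows that an induced representation determines
  \<open>\<chi>\<close>.\<close>

lemma extends_\<psi>_mackey:
  assumes "extends_\<psi> \<Theta>1" "extends_\<psi> \<Theta>2" and x: "x \<in> carrier U"
    and conj: "\<And>j. j \<in> J \<Longrightarrow> x \<star> j \<star> inv\<^bsub>U\<^esub> x \<in> J \<Longrightarrow> \<Theta>1 j = \<Theta>2 (x \<star> j \<star> inv\<^bsub>U\<^esub> x)"
  shows "x \<in> S" "\<And>j. j \<in> J0 \<Longrightarrow> \<Theta>1 j = \<Theta>2 j" "(\<And>j. j \<in> J \<Longrightarrow> \<Theta>1 j = \<Theta>2 j) \<Longrightarrow> x \<in> J"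
proof -
  have val: "\<Theta>1 t = \<psi> (t N)" "\<Theta>2 t = \<psi> (t N)" if "t \<in> T" for t
    using assms(1,2) that by (auto simp: extends_\<psi>_def)
  have mult: "\<Theta>2 (a \<star> b) = \<Theta>2 a * \<Theta>2 b" if "a \<in> J" "b \<in> J" for a b
    using assms(2) that by (auto simp: extends_\<psi>_def)
  have Tc: "t \<in> T \<Longrightarrow> t \<in> carrier U" for t by (rule T_closed)
  have conj_eq: "x \<star> j \<star> inv\<^bsub>U\<^esub> x = t \<star> j"
    if "x \<star> j = t \<star> (j \<star> x)" "j \<in> carrier U" "t \<in> carrier U" for j t
    unfolding that(1) using that x by (simp add: G.m_assoc)
  show xS: "x \<in> S"
  proof (rule ccontr)
    assume "x \<notin> S"
    then have ex: "\<exists>i. odd i \<and> i < h - 1 \<and> x i \<noteq> 0" using x by (auto simp: S_def)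
    define i where "i = (LEAST i. odd i \<and> i < h - 1 \<and> x i \<noteq> 0)"
    have i: "odd i" "i < h - 1" "x i \<noteq> 0" using LeastI_ex[OF ex] by (auto simp: i_def)
    have min: "x k = 0" if "odd k" "k < i" for k
      using not_less_Least[of k "\<lambda>i. odd i \<and> i < h - 1 \<and> x i \<noteq> 0"] that i(2) by (auto simp: i_def)
    obtain a where a: "\<psi> (herm (x i) a) \<noteq> 1" using herm_nondeg[OF i(3)] by blast
    define m where "m = mono_elem (N - i) a"
    have mT: "m \<in> T" unfolding m_def using i N_half by (intro mono_elem_T) auto
    obtain t where t: "t \<in> T" "t N = herm (x i) (m (N - i))" "x \<star> m = t \<star> (m \<star> x)"
      using leading_commutator[OF x i(1,2) min mT] by (auto simp: m_def mono_elem_def)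
    have eq: "x \<star> m \<star> inv\<^bsub>U\<^esub> x = t \<star> m" by (rule conj_eq[OF t(3) Tc[OF mT] Tc[OF t(1)]])
    have tm: "t \<star> m \<in> T" "(t \<star> m) N = t N + m N" using T_mult[OF t(1) mT] by simp_all
    have "\<Theta>1 m = \<Theta>2 (t \<star> m)" using conj[of m] eq tm(1) mT TD J0D by auto
    then have "\<psi> (m N) = \<psi> (t N) * \<psi> (m N)" by (simp add: val mT tm \<psi>_add)
    then have "\<psi> (t N) = 1" using \<psi>_nz[of "m N"] by simp
    then show False using a t(2) by (simp add: m_def mono_elem_def)
  qed
  \<comment> \<open>Conjugation by x in S twists a character of J by
    \<open>\<psi> (herm (middle x) (middle j))\<close>, which is trivial on J0.\<close>
  have key: "\<Theta>1 j = \<psi> (herm (middle x) (middle j)) * \<Theta>2 j" if j: "j \<in> J" for j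
  proof -
    have jS: "j \<in> S" using j JD by blast
    obtain t where t: "t \<in> T" "t N = herm (middle x) (middle j)" "x \<star> j = t \<star> (j \<star> x)"
      using S_commutator[OF xS jS] by metis
    have tJ: "t \<in> J" using t TD J0D by blast
    have eq: "x \<star> j \<star> inv\<^bsub>U\<^esub> x = t \<star> j" by (rule conj_eq[OF t(3) SD[OF jS] Tc[OF t(1)]])
    have "t \<star> j \<in> J" using subgroup.m_closed[OF subgroup_J tJ j] .
    then have "\<Theta>1 j = \<Theta>2 (t \<star> j)" using conj[OF j] eq by simp
    then show ?thesis by (simp add: mult tJ j val t)
  qed
  show "\<Theta>1 j = \<Theta>2 j" if "j \<in> J0" for j
    using key[OF J0D[OF that]] that by (simp add: J0_def herm_0 \<psi>_0)
  show "x \<in> J" if same: "\<And>j. j \<in> J \<Longrightarrow> \<Theta>1 j = \<Theta>2 j"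
  proof (rule ccontr)
    assume "x \<notin> J"
    then have mid: "middle x ^ q \<noteq> middle x" using xS by (simp add: J_def)
    have odd: "odd (h - 1)"
    proof (rule ccontr)
      assume "\<not> odd (h - 1)"
      then have "middle x = 0" by (simp add: middle_def)
      then show False using mid q_pos by simp
    qed
    \<comment> \<open>Since a is fixed, 1 + a tau^(h-1) lies in J, and its character value is
      changed by conjugation with x.\<close>
    obtain a where a: "a ^ q = a" "\<psi> (herm (middle x) a) \<noteq> 1" using herm_nondeg_fixed[OF mid] by blast
    define j where "j = mono_elem (h - 1) a"
    have ja: "middle j = a" using odd by (simp add: j_def middle_def mono_elem_def)
    have j: "j \<in> J" using a(1) N_half ja by (auto simp: J_def S_def carrier_U j_def mono_elem_def)
    have inv: "\<Theta>2 j \<noteq> 0"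
    proof -
      have jc: "j \<in> carrier U" "inv\<^bsub>U\<^esub> j \<in> J" using j JD SD subgroup.m_inv_closed[OF subgroup_J] by auto
      then have "\<Theta>2 (inv\<^bsub>U\<^esub> j) * \<Theta>2 j = \<Theta>2 \<one>\<^bsub>U\<^esub>" using mult[of "inv\<^bsub>U\<^esub> j" j] j by simp
      also have "\<dots> = 1" using val[OF one_in_T] by (simp add: one_U \<psi>_0)
      finally show ?thesis by auto
    qed
    have "\<Theta>2 j = \<psi> (herm (middle x) a) * \<Theta>2 j" using key[OF j] same[OF j] ja by simp
    then show False using a(2) inv by simp
  qed
qed

end

context conductor_character
begin

section \<open>The correspondence between characters and representations\<close>

lemma G_psi_reps_iff:
  "(n, \<rho>) \<in> G_psi_reps q h \<psi> \<longleftrightarrow>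
    \<rho> \<in> extensional (carrier U) \<and> irred_mat_rep U n \<rho> \<and> top_scalar n \<rho>"
  by (auto simp: G_psi_reps_def is_irreducible_U_rep_def is_U_rep_def irred_mat_rep_def
      mat_rep_def top_scalar_def U_simps N_def)

lemma mono_elem_N_central:
  assumes x: "x \<in> carrier U"
  shows "x \<star> mono_elem N a = mono_elem N a \<star> x"
proof
  fix k
  have z: "mono_elem N a \<in> carrier U" using N_half by (intro T_closed mono_elem_T) auto
  show "(x \<star> mono_elem N a) k = (mono_elem N a \<star> x) k"
  proof (cases "1 \<le> k \<and> k \<le> N")
    case True
    have "(x \<star> mono_elem N a) k = x k + mono_elem N a k"
      using True by (intro umul_coeff_no_cross) (auto simp: mono_elem_def)
    moreover have "(mono_elem N a \<star> x) k = mono_elem N a k + x k"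
      using True by (intro umul_coeff_no_cross) (auto simp: mono_elem_def)
    ultimately show ?thesis by simp
  next
    case False
    then show ?thesis using G.m_closed[OF x z] G.m_closed[OF z x]
      by (cases "k = 0") (auto simp: carrier_U)
  qed
qed

text \<open>\<open>\<chi>\<close> is the restriction to H; by \<open>J0_decomp\<close> nothing is
  lost. With \<open>A_psi_J0\<close> and \<open>A_psi_eqI\<close>, the set \<open>A_psi\<close>
  amounts to the characters of J0 that are \<open>\<psi> (t N)\<close> on T.\<close>

lemma character_of_J0:
  assumes mult: "\<And>x y. x \<in> J0 \<Longrightarrow> y \<in> J0 \<Longrightarrow> \<theta> (x \<star> y) = \<theta> x * \<theta> y"
    and T: "\<And>t. t \<in> T \<Longrightarrow> \<theta> t = \<psi> (t N)"
  shows "\<exists>\<chi>\<in>A_psi h \<psi>. \<forall>j\<in>J0. \<theta> j = \<chi> (even_part j)"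
proof -
  define \<chi> where "\<chi> = (\<lambda>a\<in>trunc_carrier (h - 1). \<theta> (even_embed a))"
  have nz: "\<theta> x \<noteq> 0" if x: "x \<in> J0" for x
  proof -
    have "\<theta> (inv\<^bsub>U\<^esub> x) * \<theta> x = \<theta> (inv\<^bsub>U\<^esub> x \<star> x)"
      using mult[OF subgroup.m_inv_closed[OF subgroup_J0 x] x] by simp
    also have "\<dots> = 1"
      using T[OF one_in_T] SD[OF JD[OF J0D[OF x]]] by (simp add: one_U \<psi>_0)
    finally show ?thesis by auto
  qed
  have L_closed: "L_mul (h - 1) x y \<in> trunc_carrier (h - 1)" for x y :: "nat \<Rightarrow> 'a"
    by (auto simp: L_mul_def trunc_carrier_iff)
  have mono: "mono_elem (h - 1) a \<in> trunc_carrier (h - 1)" for a :: 'a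
    using N_half(2) by (auto simp: mono_elem_def trunc_carrier_iff)
  have "\<chi> \<in> A_psi h \<psi>"
    unfolding A_psi_def
  proof (intro CollectI conjI ballI allI)
    show "\<chi> \<in> extensional (trunc_carrier (h - 1))" by (simp add: \<chi>_def)
    show "\<chi> x \<noteq> 0" if "x \<in> trunc_carrier (h - 1)" for x
      using nz[OF even_embed_closed[OF that]] that by (simp add: \<chi>_def)
    show "\<chi> (L_mul (h - 1) x y) = \<chi> x * \<chi> y"
      if "x \<in> trunc_carrier (h - 1)" "y \<in> trunc_carrier (h - 1)" for x y
      using that L_closed mult[OF even_embed_closed[OF that(1)] even_embed_closed[OF that(2)]]
        even_embed_mult[OF that] by (simp add: \<chi>_def)
    have "mono_elem N a \<in> T" for a using N_half by (intro mono_elem_T) auto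
    then show "\<chi> (mono_elem (h - 1) a) = \<psi> a" for a
      using mono[of a] T[of "mono_elem N a"] even_embed_mono[of a] by (simp add: \<chi>_def) (simp add: mono_elem_def)
  qed
  moreover have "\<theta> j = \<chi> (even_part j)" if j: "j \<in> J0" for j
  proof -
    have e: "even_part j \<in> trunc_carrier (h - 1)" using even_part_closed SD[OF JD[OF J0D[OF j]]] .
    obtain t where t: "t \<in> T" "t N = 0" "j = t \<star> even_embed (even_part j)"
      using J0_decomp[OF j] by metis
    have "\<theta> j = \<theta> t * \<theta> (even_embed (even_part j))"
      using mult[OF TD[OF t(1)] even_embed_closed[OF e]] t(3) by simp
    then show ?thesis using T[OF t(1)] t(2) e by (simp add: \<psi>_0 \<chi>_def)
  qed
  ultimately show ?thesis by blast
qed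

lemma A_psi_J0:
  assumes "\<chi> \<in> A_psi h \<psi>"
  shows "x \<in> J0 \<Longrightarrow> y \<in> J0 \<Longrightarrow> \<chi> (even_part (x \<star> y)) = \<chi> (even_part x) * \<chi> (even_part y)"
    "t \<in> T \<Longrightarrow> \<chi> (even_part t) = \<psi> (t N)"
proof -
  have c: "even_part x \<in> trunc_carrier (h - 1)" if "x \<in> J0" for x
    using even_part_closed SD[OF JD[OF J0D[OF that]]] .
  show "x \<in> J0 \<Longrightarrow> y \<in> J0 \<Longrightarrow> \<chi> (even_part (x \<star> y)) = \<chi> (even_part x) * \<chi> (even_part y)"
    using assms c even_part_J0_mult[of x y] by (auto simp: A_psi_def)
  show "t \<in> T \<Longrightarrow> \<chi> (even_part t) = \<psi> (t N)"
    using assms even_part_T[of t] by (auto simp: A_psi_def)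
qed

lemma A_psi_eqI:
  assumes "\<chi>1 \<in> A_psi h \<psi>" "\<chi>2 \<in> A_psi h \<psi>" "\<And>j. j \<in> J0 \<Longrightarrow> \<chi>1 (even_part j) = \<chi>2 (even_part j)"
  shows "\<chi>1 = \<chi>2"
proof (rule extensionalityI)
  show "\<chi>1 \<in> extensional (trunc_carrier (h - 1))" "\<chi>2 \<in> extensional (trunc_carrier (h - 1))"
    using assms by (auto simp: A_psi_def)
  show "\<chi>1 a = \<chi>2 a" if "a \<in> trunc_carrier (h - 1)" for a
    using assms(3)[OF even_embed_closed[OF that]] by (simp add: even_part_embed)
qed

text \<open>The extension is read off an eigenvector: inside the representation induced from J0,
  which need not be irreducible, the \<open>\<chi>\<close>-eigenspace of J0 contains a common
  eigenvector of J, and its eigenvalues form \<open>\<Theta>\<close>.\<close>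

lemma exists_extension_to_J:
  assumes alg: "\<forall>f::'k poly. 0 < degree f \<longrightarrow> (\<exists>x. poly f x = 0)" and \<chi>: "\<chi> \<in> A_psi h \<psi>"
  shows "\<exists>\<Theta>. extends_\<psi> \<Theta> \<and> (\<forall>j\<in>J0. \<Theta> j = \<chi> (even_part j))"
proof -
  note \<chi>J0 = A_psi_J0[OF \<chi>]
  obtain u m i0 where "left_transversal U J0 u m i0"
    using G.exists_transversal[OF finite_U subgroup_J0] by blast
  note tr = left_transversalD[OF this]
  interpret I: induced_rep U J0 "\<lambda>j. \<chi> (even_part j)" u m i0
  proof (rule induced_rep.intro[OF group_U induced_rep_axioms.intro])
    show "\<chi> (even_part \<one>\<^bsub>U\<^esub>) = 1" using \<chi>J0(2)[OF one_in_T] by (simp add: one_U \<psi>_0)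
  qed (fact finite_U subgroup_J0 \<chi>J0(1) tr)+
  have "\<exists>v\<in>carrier_vec m. v \<noteq> 0\<^sub>v m \<and> (\<forall>a\<in>J0. I.ind a *\<^sub>v v = \<chi> (even_part a) \<cdot>\<^sub>v v)
    \<and> (\<forall>b\<in>J. \<exists>r. I.ind b *\<^sub>v v = r \<cdot>\<^sub>v v)"
  proof (rule exists_common_eigenvector_S[OF alg I.mat_rep_ind])
    show "herm (middle a) (middle b) = 0" if "a \<in> J0" "b \<in> J" for a b
      using that by (simp add: J0_def herm_0)
    show "herm (middle a) (middle b) = 0" if "a \<in> J" "b \<in> J" for a b
      using that by (simp add: J_def herm_fixed)
    show "unit_vec m i0 \<noteq> 0\<^sub>v m" using tr(2) by simp
  qed (use T_subset_J0 J0_subset_J J_subset_S \<chi>J0(2) I.ind_eigenvector in auto)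
  then obtain v where v: "v \<in> carrier_vec m" "v \<noteq> 0\<^sub>v m"
    "\<And>a. a \<in> J0 \<Longrightarrow> I.ind a *\<^sub>v v = \<chi> (even_part a) \<cdot>\<^sub>v v"
    "\<And>b. b \<in> J \<Longrightarrow> \<exists>r. I.ind b *\<^sub>v v = r \<cdot>\<^sub>v v" by blast
  obtain \<Theta> where \<Theta>: "\<And>g. g \<in> J \<Longrightarrow> I.ind g *\<^sub>v v = \<Theta> g \<cdot>\<^sub>v v"
    "\<And>x y. x \<in> J \<Longrightarrow> y \<in> J \<Longrightarrow> \<Theta> (x \<star> y) = \<Theta> x * \<Theta> y"
    using G.exists_eigencharacter[OF I.mat_rep_ind subgroup_J v(1,2,4)] by blast
  have "\<Theta> j = \<chi> (even_part j)" if "j \<in> J0" for j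
    using \<Theta>(1)[OF J0D[OF that]] v(3)[OF that] smult_vec_cancel[OF v(1,2)] by metis
  then show ?thesis
    using \<Theta>(2) \<chi>J0(2) TD by (auto simp: extends_\<psi>_def intro!: exI[of _ \<Theta>])
qed

lemma exists_J0_eigencharacter:
  assumes alg: "\<forall>f::'k poly. 0 < degree f \<longrightarrow> (\<exists>x. poly f x = 0)"
    and \<rho>: "mat_rep U n \<rho>" "top_scalar n \<rho>" and n: "0 < n"
  shows "\<exists>\<chi>\<in>A_psi h \<psi>. \<exists>v\<in>carrier_vec n. v \<noteq> 0\<^sub>v n
    \<and> (\<forall>j\<in>J0. \<rho> j *\<^sub>v v = \<chi> (even_part j) \<cdot>\<^sub>v v)"
proof -
  obtain v0 where v0: "v0 \<in> carrier_vec n" "v0 \<noteq> 0\<^sub>v n" "\<And>t. t \<in> T \<Longrightarrow> \<rho> t *\<^sub>v v0 = \<psi> (t N) \<cdot>\<^sub>v v0"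
    using exists_T_eigenvector[OF \<rho> n] by blast
  have "\<exists>v\<in>carrier_vec n. v \<noteq> 0\<^sub>v n \<and> (\<forall>a\<in>T. \<rho> a *\<^sub>v v = \<psi> (a N) \<cdot>\<^sub>v v)
    \<and> (\<forall>b\<in>J0. \<exists>r. \<rho> b *\<^sub>v v = r \<cdot>\<^sub>v v)"
  proof (rule exists_common_eigenvector_S[OF alg \<rho>(1) _ _ _ _ _ _ v0])
    show "herm (middle a) (middle b) = 0" if "a \<in> T" "b \<in> J0" for a b
      using that by (simp add: J0_def herm_0)
    show "herm (middle a) (middle b) = 0" if "a \<in> J0" "b \<in> J0" for a b
      using that by (simp add: J0_def herm_0)
  qed (use T_subset_J0 J0_subset_J J_subset_S in auto)
  then obtain v where v: "v \<in> carrier_vec n" "v \<noteq> 0\<^sub>v n"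
    "\<And>t. t \<in> T \<Longrightarrow> \<rho> t *\<^sub>v v = \<psi> (t N) \<cdot>\<^sub>v v"
    "\<And>b. b \<in> J0 \<Longrightarrow> \<exists>r. \<rho> b *\<^sub>v v = r \<cdot>\<^sub>v v" by blast
  obtain \<theta> where \<theta>: "\<And>g. g \<in> J0 \<Longrightarrow> \<rho> g *\<^sub>v v = \<theta> g \<cdot>\<^sub>v v"
    "\<And>x y. x \<in> J0 \<Longrightarrow> y \<in> J0 \<Longrightarrow> \<theta> (x \<star> y) = \<theta> x * \<theta> y"
    using G.exists_eigencharacter[OF \<rho>(1) subgroup_J0 v(1,2,4)] by blast
  have "\<theta> t = \<psi> (t N)" if "t \<in> T" for t
    using \<theta>(1)[OF TD[OF that]] v(3)[OF that] smult_vec_cancel[OF v(1,2)] by metis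
  from character_of_J0[OF \<theta>(2) this] \<theta>(1) v(1,2) show ?thesis by metis
qed

text \<open>Extensions of the same character of J0 cannot be told apart by the representation:
  translation by 1 + x tau^(h-1) changes the action of J by
  \<open>\<psi> (- herm x (middle j))\<close> for odd h-1, and summing over x isolates J0 inside J.
  For even h-1 the two groups coincide.\<close>

lemma exists_J_eigenvector:
  assumes \<rho>: "mat_rep U n \<rho>" and \<Theta>: "extends_\<psi> \<Theta>"
    and v: "v \<in> carrier_vec n" "v \<noteq> 0\<^sub>v n" "\<And>j. j \<in> J0 \<Longrightarrow> \<rho> j *\<^sub>v v = \<Theta> j \<cdot>\<^sub>v v"
  shows "\<exists>w\<in>carrier_vec n. w \<noteq> 0\<^sub>v n \<and> (\<forall>j\<in>J. \<rho> j *\<^sub>v w = \<Theta> j \<cdot>\<^sub>v w)"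
proof -
  define s where "s x = (mono_elem (h - 1) x :: nat \<Rightarrow> 'a)" for x
  have sS: "s x \<in> S" for x
    using N_half by (auto simp: s_def S_def carrier_U mono_elem_def)
  have mid: "middle (s x) = (if odd (h - 1) then x else 0)" for x
    by (simp add: s_def middle_def mono_elem_def)
  show ?thesis
  proof (rule G.exists_translated_eigenvector[OF finite_U \<rho> subgroup_J J0_subset_J, where u = s
        and f = "\<lambda>x j. \<psi> (- herm (middle (s x)) (middle j))" and X = UNIV
        and c = "of_nat (card (UNIV :: 'a set))"])
    show "J0 \<noteq> {}" using one_in_T TD by blast
    show "\<Theta> (x \<star> y) = \<Theta> x * \<Theta> y" if "x \<in> J" "y \<in> J" for x y
      using \<Theta> that by (simp add: extends_\<psi>_def)
    show "\<Theta> \<one>\<^bsub>U\<^esub> = 1" using \<Theta> one_in_T by (simp add: extends_\<psi>_def one_U \<psi>_0)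
    show "s x \<in> carrier U" for x by (rule SD[OF sS])
    show "(\<Sum>x\<in>UNIV. \<psi> (- herm (middle (s x)) (middle j))) = of_nat (card (UNIV :: 'a set))"
      if "j \<in> J0" for j using that by (simp add: J0_def herm_0 \<psi>_0)
    show "(\<Sum>x\<in>UNIV. \<psi> (- herm (middle (s x)) (middle j))) = 0" if "j \<in> J" "j \<notin> J0" for j
    proof -
      have nz: "middle j \<noteq> 0" using that by (auto simp: J_def J0_def)
      then have "odd (h - 1)" by (metis middle_def)
      then show ?thesis using nz sum_\<psi>_herm[of "middle j"] by (simp add: mid)
    qed
    fix x j assume j: "j \<in> J"
    obtain t where t: "t \<in> T" "t N = herm (middle (s x)) (middle j)" "s x \<star> j = (j \<star> s x) \<star> t"
      using S_commutator_right[OF sS JD[OF j]] by metis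
    have c: "s x \<in> carrier U" "j \<in> carrier U" "t \<in> carrier U"
      using SD[OF sS] SD[OF JD[OF j]] T_closed[OF t(1)] by auto
    note closed = mat_rep_vec_carrier[OF \<rho>]
    have tv: "\<rho> t *\<^sub>v v = \<psi> (t N) \<cdot>\<^sub>v v"
      using v(3)[OF TD[OF t(1)]] \<Theta> t(1) by (simp add: extends_\<psi>_def)
    have "\<rho> (s x) *\<^sub>v (\<rho> j *\<^sub>v v) = \<rho> ((j \<star> s x) \<star> t) *\<^sub>v v"
      unfolding t(3)[symmetric] by (rule mat_rep_mult_vec[OF \<rho> c(1,2) v(1), symmetric])
    also have "\<dots> = \<rho> (j \<star> s x) *\<^sub>v (\<psi> (t N) \<cdot>\<^sub>v v)"
      using mat_rep_mult_vec[OF \<rho> G.m_closed[OF c(2,1)] c(3) v(1)] tv by simp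
    also have "\<dots> = \<psi> (t N) \<cdot>\<^sub>v (\<rho> j *\<^sub>v (\<rho> (s x) *\<^sub>v v))"
      using mult_mat_vec[OF mat_repD(1)[OF \<rho> G.m_closed[OF c(2,1)]] v(1)]
        mat_rep_mult_vec[OF \<rho> c(2,1) v(1)] by simp
    finally show "\<rho> j *\<^sub>v (\<rho> (s x) *\<^sub>v v) =
        \<psi> (- herm (middle (s x)) (middle j)) \<cdot>\<^sub>v (\<rho> (s x) *\<^sub>v (\<rho> j *\<^sub>v v))"
      using \<psi>_nz t(2) by (simp add: smult_smult_assoc \<psi>_uminus)
  qed (use v in \<open>auto simp: card_eq_0_iff\<close>)
qed

theorem characters_bij_representations:
  assumes alg: "\<forall>f::'k poly. 0 < degree f \<longrightarrow> (\<exists>x. poly f x = 0)"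
  shows "(\<exists>F. bij_betw F (A_psi h \<psi>) (G_psi q h \<psi>))
    \<and> (\<forall>(n, \<rho>)\<in>G_psi_reps q h \<psi>. n = q ^ (h - 1))"
proof -
  let ?A = "A_psi h \<psi>" and ?R = "G_psi_reps q h \<psi>"
  define iso where "iso = {(r, s). r \<in> ?R \<and> s \<in> ?R \<and> rep_iso N r s}"
  have equiv: "equiv ?R iso"
    unfolding iso_def
    by (rule rep_iso_equiv) (auto simp: G_psi_reps_iff irred_mat_rep_def mat_rep_def U_simps)
  have quot: "G_psi q h \<psi> = ?R // iso" by (simp add: G_psi_def iso_def N_def)
  \<comment> \<open>A single transversal for all characters, so that all induced matrices have the
    same size m.\<close>
  obtain u m i0 where "left_transversal U J u m i0"
    using G.exists_transversal[OF finite_U subgroup_J] by blast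
  note tr = left_transversalD[OF this]
  have ind: "induced_rep U J \<Theta> u m i0" if \<Theta>: "extends_\<psi> \<Theta>" for \<Theta>
  proof (rule induced_rep.intro[OF group_U induced_rep_axioms.intro])
    show "\<Theta> (x \<star> y) = \<Theta> x * \<Theta> y" if "x \<in> J" "y \<in> J" for x y
      using \<Theta> that by (simp add: extends_\<psi>_def)
    show "\<Theta> \<one>\<^bsub>U\<^esub> = 1" using \<Theta> one_in_T by (simp add: extends_\<psi>_def one_U \<psi>_0)
  qed (fact finite_U subgroup_J tr)+
  have mackey: "mackey_induced_rep U J \<Theta> u m i0" if \<Theta>: "extends_\<psi> \<Theta>" for \<Theta>
  proof -
    interpret induced_rep U J \<Theta> u m i0 by (rule ind[OF \<Theta>])
    show ?thesis
    proof (unfold_locales, rule ccontr)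
      fix x assume x: "x \<in> carrier U" "x \<notin> J"
        and no: "\<not> (\<exists>j\<in>J. x \<star> j \<star> inv\<^bsub>U\<^esub> x \<in> J \<and> \<Theta> (x \<star> j \<star> inv\<^bsub>U\<^esub> x) \<noteq> \<Theta> j)"
      have "x \<in> J"
      proof (rule extends_\<psi>_mackey(3)[OF \<Theta> \<Theta> x(1) _ refl])
        fix j assume j: "j \<in> J" "x \<star> j \<star> inv\<^bsub>U\<^esub> x \<in> J"
        show "\<Theta> j = \<Theta> (x \<star> j \<star> inv\<^bsub>U\<^esub> x)"
        proof (rule ccontr)
          assume "\<Theta> j \<noteq> \<Theta> (x \<star> j \<star> inv\<^bsub>U\<^esub> x)"
          then show False using no j by (auto simp: eq_commute)
        qed
      qed
      then show False using x(2) by contradiction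
    qed
  qed
  \<comment> \<open>X fixes one extension to J for each \<open>\<chi>\<close>;
    \<open>exists_J_eigenvector\<close> makes this arbitrary choice harmless.\<close>
  obtain X where X: "\<And>\<chi>. \<chi> \<in> ?A \<Longrightarrow> extends_\<psi> (X \<chi>)"
    "\<And>\<chi> j. \<chi> \<in> ?A \<Longrightarrow> j \<in> J0 \<Longrightarrow> X \<chi> j = \<chi> (even_part j)"
    using exists_extension_to_J[OF alg] by metis
  define M where "M \<chi> = induced_rep.ind U J (X \<chi>) u m" for \<chi>
  have m: "m = q ^ (h - 1)" if "\<chi> \<in> ?A" for \<chi>
    using index_J[OF induced_rep.card_carrier[OF ind[OF X(1)[OF that]]]] .
  have MR: "(m, M \<chi>) \<in> ?R" if \<chi>: "\<chi> \<in> ?A" for \<chi>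
  proof -
    interpret mackey_induced_rep U J "X \<chi>" u m i0 by (rule mackey[OF X(1)[OF \<chi>]])
    have "top_scalar m ind"
      unfolding top_scalar_def
    proof
      fix a
      have z: "mono_elem N a \<in> T" using N_half by (intro mono_elem_T) auto
      from ind_central[OF J0D[OF TD[OF z]] mono_elem_N_central]
      have "ind (mono_elem N a) = X \<chi> (mono_elem N a) \<cdot>\<^sub>m 1\<^sub>m m" .
      also have "X \<chi> (mono_elem N a) = \<psi> a"
        using X(1)[OF \<chi>] z by (auto simp: extends_\<psi>_def mono_elem_def)
      finally show "ind (mono_elem N a) = \<psi> a \<cdot>\<^sub>m 1\<^sub>m m" .
    qed
    moreover have "ind \<in> extensional (carrier U)" by (simp add: ind_def)
    ultimately show ?thesis unfolding M_def using irred_mat_rep_ind by (simp add: G_psi_reps_iff)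
  qed
  \<comment> \<open>The representation contains some \<open>\<chi>\<close> on J0, hence the chosen
    extension on J, hence by reciprocity it is the induced one.\<close>
  have surj: "\<exists>\<chi>\<in>?A. n = m \<and> ((m, M \<chi>), (n, \<rho>)) \<in> iso" if r: "(n, \<rho>) \<in> ?R" for n \<rho>
  proof -
    have \<rho>: "irred_mat_rep U n \<rho>" "mat_rep U n \<rho>" "top_scalar n \<rho>" "0 < n"
      using r by (auto simp: G_psi_reps_iff irred_mat_rep_def)
    obtain \<chi> v where \<chi>: "\<chi> \<in> ?A" and v: "v \<in> carrier_vec n" "v \<noteq> 0\<^sub>v n"
      "\<And>j. j \<in> J0 \<Longrightarrow> \<rho> j *\<^sub>v v = \<chi> (even_part j) \<cdot>\<^sub>v v"
      using exists_J0_eigencharacter[OF alg \<rho>(2-4)] by blast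
    have "\<rho> j *\<^sub>v v = X \<chi> j \<cdot>\<^sub>v v" if "j \<in> J0" for j using v(3) X(2)[OF \<chi>] that by simp
    from exists_J_eigenvector[OF \<rho>(2) X(1)[OF \<chi>] v(1,2) this]
    obtain w where w: "w \<in> carrier_vec n" "w \<noteq> 0\<^sub>v n" "\<And>j. j \<in> J \<Longrightarrow> \<rho> j *\<^sub>v w = X \<chi> j \<cdot>\<^sub>v w"
      by blast
    from mackey_induced_rep.ind_iso[OF mackey[OF X(1)[OF \<chi>]] \<rho>(1) w]
    have "n = m" "rep_iso N (m, M \<chi>) (n, \<rho>)"
      unfolding M_def by (auto simp: rep_iso_def U_simps)
    then show ?thesis using \<chi> r MR[OF \<chi>] by (auto simp: iso_def)
  qed
  \<comment> \<open>An isomorphism carries the distinguished eigenvector of the first representation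
    to an eigenvector of J in the second. So \<open>X \<chi>1\<close> agrees with a conjugate of
    \<open>X \<chi>2\<close> on an intersection, which forces equality on J0.\<close>
  have inj: "\<chi>1 = \<chi>2" if \<chi>: "\<chi>1 \<in> ?A" "\<chi>2 \<in> ?A" and iso12: "((m, M \<chi>1), (m, M \<chi>2)) \<in> iso" for \<chi>1 \<chi>2
  proof -
    obtain P where P: "P \<in> carrier_mat m m" "invertible_mat P"
      "\<And>g. g \<in> carrier U \<Longrightarrow> P * M \<chi>1 g = M \<chi>2 g * P"
      using iso12 by (auto simp: iso_def rep_iso_def U_simps)
    interpret I1: induced_rep U J "X \<chi>1" u m i0 by (rule ind[OF X(1)[OF \<chi>(1)]])
    interpret I2: induced_rep U J "X \<chi>2" u m i0 by (rule ind[OF X(1)[OF \<chi>(2)]])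
    define e where "e = (unit_vec m i0 :: 'k vec)"
    have e: "e \<in> carrier_vec m" "e \<noteq> 0\<^sub>v m" using tr(2) by (auto simp: e_def)
    obtain Q where Qc: "Q \<in> carrier_mat m m" and Q: "P * Q = 1\<^sub>m m" "Q * P = 1\<^sub>m m"
      using invertible_mat_inverse[OF P(2,1)] .
    have Pe: "P *\<^sub>v e \<in> carrier_vec m" using P(1) e by auto
    have Pe0: "P *\<^sub>v e \<noteq> 0\<^sub>v m"
    proof
      assume "P *\<^sub>v e = 0\<^sub>v m"
      then have "(Q * P) *\<^sub>v e = Q *\<^sub>v 0\<^sub>v m" using assoc_mult_mat_vec[OF Qc P(1) e(1)] by simp
      then show False using Q(2) e mult_mat_zero_vec[OF Qc] by simp
    qed
    have eig: "I2.ind j *\<^sub>v (P *\<^sub>v e) = X \<chi>1 j \<cdot>\<^sub>v (P *\<^sub>v e)" if j: "j \<in> J" for j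
    proof -
      have jc: "j \<in> carrier U" using SD[OF JD[OF j]] .
      have "I2.ind j *\<^sub>v (P *\<^sub>v e) = (I2.ind j * P) *\<^sub>v e"
        by (rule assoc_mult_mat_vec[OF I2.ind_carrier[OF jc] P(1) e(1), symmetric])
      also have "\<dots> = (P * I1.ind j) *\<^sub>v e" using P(3)[OF jc] by (simp add: M_def)
      also have "\<dots> = P *\<^sub>v (I1.ind j *\<^sub>v e)"
        by (rule assoc_mult_mat_vec[OF P(1) I1.ind_carrier[OF jc] e(1)])
      also have "\<dots> = X \<chi>1 j \<cdot>\<^sub>v (P *\<^sub>v e)"
        unfolding e_def I1.ind_eigenvector[OF j] by (rule mult_mat_vec[OF P(1)]) simp
      finally show ?thesis .
    qed
    from I2.ind_conjugate_character[OF Pe Pe0 eig]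
    obtain x where x: "x \<in> carrier U"
      "\<forall>j\<in>J. inv\<^bsub>U\<^esub> x \<star> j \<star> x \<in> J \<longrightarrow> X \<chi>1 j = X \<chi>2 (inv\<^bsub>U\<^esub> x \<star> j \<star> x)"
      by (rule bexE)
    have "X \<chi>1 j = X \<chi>2 j" if j: "j \<in> J0" for j
    proof (rule extends_\<psi>_mackey(2)[OF X(1)[OF \<chi>(1)] X(1)[OF \<chi>(2)] G.inv_closed[OF x(1)] _ j])
      show "X \<chi>1 i = X \<chi>2 (inv\<^bsub>U\<^esub> x \<star> i \<star> inv\<^bsub>U\<^esub> (inv\<^bsub>U\<^esub> x))"
        if "i \<in> J" "inv\<^bsub>U\<^esub> x \<star> i \<star> inv\<^bsub>U\<^esub> (inv\<^bsub>U\<^esub> x) \<in> J" for i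
        using x(2) that by (simp only: G.inv_inv[OF x(1)])
    qed
    then show ?thesis using X(2)[OF \<chi>(1)] X(2)[OF \<chi>(2)] by (intro A_psi_eqI[OF \<chi>]) simp
  qed
  define F where "F \<chi> = iso `` {(m, M \<chi>)}" for \<chi>
  have "bij_betw F ?A (G_psi q h \<psi>)"
    unfolding bij_betw_def
  proof
    show "inj_on F ?A"
    proof (rule inj_onI)
      fix \<chi>1 \<chi>2 assume \<chi>: "\<chi>1 \<in> ?A" "\<chi>2 \<in> ?A" and "F \<chi>1 = F \<chi>2"
      then have "((m, M \<chi>1), (m, M \<chi>2)) \<in> iso"
        unfolding F_def using eq_equiv_class[OF _ equiv MR[OF \<chi>(2)]] by blast
      then show "\<chi>1 = \<chi>2" by (rule inj[OF \<chi>])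
    qed
    show "F ` ?A = G_psi q h \<psi>"
    proof
      show "F ` ?A \<subseteq> G_psi q h \<psi>" unfolding quot F_def using MR by (auto intro: quotientI)
      show "G_psi q h \<psi> \<subseteq> F ` ?A"
      proof
        fix C assume "C \<in> G_psi q h \<psi>"
        then obtain n \<rho> where r: "(n, \<rho>) \<in> ?R" "C = iso `` {(n, \<rho>)}"
          unfolding quot by (auto elim!: quotientE)
        obtain \<chi> where \<chi>: "\<chi> \<in> ?A" "((m, M \<chi>), (n, \<rho>)) \<in> iso" using surj[OF r(1)] by blast
        then have "F \<chi> = C" unfolding F_def r(2) by (intro equiv_class_eq[OF equiv])
        then show "C \<in> F ` ?A" using \<chi>(1) by blast
      qed
    qed
  qed
  moreover have "n = q ^ (h - 1)" if "(n, \<rho>) \<in> ?R" for n \<rho>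
    using surj[OF that] m by blast
  ultimately show ?thesis by blast
qed

end

theorem theorem2p1:
  fixes p q e h :: nat
    and \<psi> :: "'a::{field,finite} \<Rightarrow> 'k::field_char_0"
  assumes "prime p" and "0 < e" and "q = p ^ e"
    and "card (UNIV :: 'a set) = q ^ 2"
    and "h \<ge> 2"
    and "\<forall>f::'k poly. 0 < degree f \<longrightarrow> (\<exists>x. poly f x = 0)"
    and "additive_character \<psi>"
    and "has_conductor_q2 q \<psi>"
  shows "(\<exists>F. bij_betw F (A_psi h \<psi>) (G_psi q h \<psi>))
    \<and> (\<forall>(n, \<rho>)\<in>G_psi_reps q h \<psi>. n = q ^ (h - 1))"
proof -
  interpret conductor_character p q e h \<psi>
    using assms by unfold_locales
  show ?thesis by (rule characters_bij_representations[OF assms(6)])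
qed

end
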